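(* Let $\lambda\in(0,\tfrac12]$ and let $f:\mathbb{R}\to\mathbb{R}$ be a $C^2$ function such that $f'(0)\ge 0$, $|f''(u_1)-f''(u_2)|\le L|u_1-u_2|$ for all $u_1,u_2\in\mathbb{R}$ and some constant $L$, and $|f''|$ is uniformly bounded on $\mathbb{R}$. Let $u_0\in W^{1,1/\lambda}_{loc}(\mathbb{R}^+)$ satisfy the compatibility condition $u_0(0)=0$ and $u_0'(0)=0$. Then the initial boundary value problem on $(x,t)\in\mathbb{R}^+\times\mathbb{R}^+$ $$u_{tx}+f'(u)\,u_{xx}+\lambda f''(u)\,(u_x)^2=0,\qquad u(0,t)=0,\qquad u(x,0)=u_0(x),$$ has a weak solution $u(x,t)$ (in the sense defined in the context). When $\lambda\in(0,\tfrac13]\cup\{\tfrac12\}$, $u(x,t)$ is locally Hölder continuous in both $x$ and $t$ with exponent $1-\lambda$.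
   Context: $x\in\mathbb{R}^+$ is the space variable and $t\in\mathbb{R}^+$ the time variable. $W^{1,1/\lambda}_{loc}(\mathbb{R}^+)$ denotes the functions belonging to the Sobolev space $W^{1,1/\lambda}$ on every bounded interval $[x_1,x_2]\subset[0,\infty)$. Weak solution: a function $u(x,t)$, defined for all $(x,t)\in\mathbb{R}^+\times\mathbb{R}^+$, is a weak solution of the problem if the initial and boundary conditions $u(x,0)=u_0(x)$, $u(0,t)=0$ (with $u_0(0)=0$, $u_0'(0)=0$) are satisfied pointwise, and: (i) the equation holds in the weak sense $$\int_0^\infty\!\!\int_0^\infty\Big\{-u_x\,\big(\phi_t+f'(u)\,\phi_x\big)+(\lambda-1)\,f''(u)\,u_x^2\,\phi\Big\}\,dx\,dt=0$$ for every test function $\phi\in C^1_c(\mathbb{R}^+\times\mathbb{R}^+)$, i.e. $\phi$ is $C^1$ with compact support in the open quadrant $(0,\infty)\times(0,\infty)$; (ii) for every fixed $t>0$, the function $u(\cdot,t)$ is in $W^{1,1/\lambda}_{loc}(\mathbb{R}^+)$ (hence is locally Hölder continuous in $x$ with exponent $1-\lambda$ by Sobolev embedding). *)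

theory Defs
  imports "HOL-Analysis.Analysis"
begin

definition C1_fun :: "('a::real_normed_vector \<Rightarrow> real) \<Rightarrow> bool" where
  "C1_fun g \<longleftrightarrow>
     (\<exists>D :: 'a \<Rightarrow> 'a \<Rightarrow>\<^sub>L real.
        (\<forall>p. (g has_derivative blinfun_apply (D p)) (at p)) \<and> continuous_on UNIV D)"

definition C2_fun :: "(real \<Rightarrow> real) \<Rightarrow> bool" where
  "C2_fun g \<longleftrightarrow>
     (\<forall>x. g field_differentiable at x) \<and> (\<forall>x. deriv g field_differentiable at x) \<and>
     continuous_on UNIV (deriv (deriv g))"

(* Test functions on an open set are represented by their extension by zero to the whole space. *)
definition C1c :: "'a::real_normed_vector set \<Rightarrow> ('a \<Rightarrow> real) set" where
  "C1c S = {\<phi>. C1_fun \<phi> \<and> compact (closure {p. \<phi> p \<noteq> 0}) \<and> closure {p. \<phi> p \<noteq> 0} \<subseteq> S}"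

definition Lp_on :: "real \<Rightarrow> real set \<Rightarrow> (real \<Rightarrow> real) \<Rightarrow> bool" where
  "Lp_on p S g \<longleftrightarrow>
     set_borel_measurable lborel S g \<and> set_integrable lborel S (\<lambda>x. \<bar>g x\<bar> powr p)"

definition locally_integrable_on :: "real set \<Rightarrow> (real \<Rightarrow> real) \<Rightarrow> bool" where
  "locally_integrable_on S g \<longleftrightarrow> (\<forall>K. compact K \<and> K \<subseteq> S \<longrightarrow> set_integrable lborel K g)"

definition weak_derivative_on :: "real set \<Rightarrow> (real \<Rightarrow> real) \<Rightarrow> (real \<Rightarrow> real) \<Rightarrow> bool" where
  "weak_derivative_on S g v \<longleftrightarrow>
     locally_integrable_on S g \<and> locally_integrable_on S v \<and>
     (\<forall>\<phi>\<in>C1c S. (LINT x:S|lborel. g x * deriv \<phi> x) = - (LINT x:S|lborel. v x * \<phi> x))"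

definition sobolev_W1 :: "real \<Rightarrow> real set \<Rightarrow> (real \<Rightarrow> real) \<Rightarrow> bool" where
  "sobolev_W1 p S g \<longleftrightarrow> Lp_on p S g \<and> (\<exists>v. Lp_on p S v \<and> weak_derivative_on S g v)"

(* W^{1,p} on every bounded interval of the closed half-line, up to and including the endpoint 0.
   An element of this space is an a.e. class; since point values are used (initial and boundary
   conditions, Hoelder continuity), the function is required to be its continuous
   representative. *)
definition sobolev_W1_loc :: "real \<Rightarrow> (real \<Rightarrow> real) \<Rightarrow> bool" where
  "sobolev_W1_loc p g \<longleftrightarrow>
     continuous_on {0..} g \<and> (\<forall>a b. 0 \<le> a \<and> a < b \<longrightarrow> sobolev_W1 p {a<..<b} g)"

definition locally_holder_on ::
    "real \<Rightarrow> 'a::metric_space set \<Rightarrow> ('a \<Rightarrow> real) \<Rightarrow> bool" where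
  "locally_holder_on \<alpha> S g \<longleftrightarrow>
     (\<forall>K. compact K \<and> K \<subseteq> S \<longrightarrow>
        (\<exists>C. \<forall>p\<in>K. \<forall>q\<in>K. \<bar>g p - g q\<bar> \<le> C * dist p q powr \<alpha>))"

definition partial_x :: "(real \<times> real \<Rightarrow> real) \<Rightarrow> real \<times> real \<Rightarrow> real" where
  "partial_x \<phi> = (\<lambda>(x, t). deriv (\<lambda>y. \<phi> (y, t)) x)"

definition partial_t :: "(real \<times> real \<Rightarrow> real) \<Rightarrow> real \<times> real \<Rightarrow> real" where
  "partial_t \<phi> = (\<lambda>(x, t). deriv (\<lambda>s. \<phi> (x, s)) t)"

definition weak_form ::
    "real \<Rightarrow> (real \<Rightarrow> real) \<Rightarrow> (real \<times> real \<Rightarrow> real) \<Rightarrow> (real \<times> real \<Rightarrow> real) \<Rightarrow>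
     (real \<times> real \<Rightarrow> real) \<Rightarrow> real \<times> real \<Rightarrow> real" where
  "weak_form lam f u ux \<phi> z =
     - ux z * (partial_t \<phi> z + deriv f (u z) * partial_x \<phi> z)
     + (lam - 1) * deriv (deriv f) (u z) * (ux z)\<^sup>2 * \<phi> z"

(* Points are pairs (x, t).  ux is a jointly measurable version of the weak x-derivative of u; two
   such versions agree almost everywhere in the quadrant, so the integrals do not depend on the
   choice.  Integrability is stated because non-integrable functions have integral 0. *)
definition weak_solution ::
    "real \<Rightarrow> (real \<Rightarrow> real) \<Rightarrow> (real \<Rightarrow> real) \<Rightarrow> (real \<times> real \<Rightarrow> real) \<Rightarrow> bool" where
  "weak_solution lam f u0 u \<longleftrightarrow>
     (\<forall>x\<ge>0. u (x, 0) = u0 x) \<and>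
     (\<forall>t\<ge>0. u (0, t) = 0) \<and>
     (\<exists>ux. set_borel_measurable lborel ({0<..} \<times> {0<..}) ux \<and>
        (\<forall>t>0. weak_derivative_on {0<..} (\<lambda>x. u (x, t)) (\<lambda>x. ux (x, t))) \<and>
        (\<forall>\<phi>\<in>C1c ({0<..} \<times> {0<..}).
           set_integrable lborel ({0<..} \<times> {0<..}) (weak_form lam f u ux \<phi>) \<and>
           (LINT z:{0<..} \<times> {0<..}|lborel. weak_form lam f u ux \<phi> z) = 0)) \<and>
     (\<forall>t>0. sobolev_W1_loc (1 / lam) (\<lambda>x. u (x, t)))"

end

theory Submission
  imports Defs
begin

text \<open>Write \<open>r = 1 / lam \<ge> 2\<close>. Along the characteristics \<open>dx/dt = f'(u)\<close> the slope \<open>v = u_x\<close> satisfies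
  \<open>v' = - lam f''(u) v\<^sup>2\<close>, so that \<open>\<bar>v\<bar> powr r dx\<close> is transported. In terms of labels \<open>s\<close> this says that
  \<open>v = k / M\<close> and \<open>dx = \<bar>M\<bar> powr r ds\<close> with \<open>k\<close> independent of time and \<open>\<partial>M/\<partial>t = lam k f''(u)\<close>. Together with
  \<open>\<partial>u/\<partial>s = k sgn M \<bar>M\<bar> powr (r - 1)\<close> this is a semilinear system, solved globally by Picard iteration; the map
  \<open>X t\<close> from labels to points pushes \<open>\<bar>M\<bar> powr r ds\<close> to Lebesgue measure, and the weak form becomes
  an integration by parts in \<open>t\<close> for each fixed label.

  As the initial datum lies in the Sobolev space only locally, the plain system can fail: for
  \<open>u0 x = c x\<close> at large \<open>x\<close> and \<open>f'' = -1\<close>, infinitely many characteristics focus simultaneously in one point, and the labels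
  do not cover the half-line at that time. The cure is to insert into the initial energy locally finitely
  many unit point masses (``fans'', on which \<open>M = 0\<close> at time \<open>0\<close>). A fan opens up wherever the neighbouring
  ordinary labels are about to collapse, and sufficiently many of them force
  \<open>X t s\<close> to tend to infinity with \<open>s\<close>, uniformly for bounded \<open>t\<close>. The initial condition is not affected.\<close>

section \<open>Primitives of locally integrable functions\<close>

text \<open>The slope equation v' = - lam f'' v^2 becomes linear for the reciprocal: with v = k / M
  it reads M' = lam k f'', which stays regular when M passes through 0. This is how the solution
  continues beyond the blow-up of u_x, and why absolute values and signed powers of M appear.

  Two identities drive everything. The rate of |M|^r is f''(u) du/ds = d/ds f'(u), so positions
  obtained by adding up lengths move with speed f'(u). The rate of the density H = du/ds is (1 -
  lam) f'' k^2 |M|^(r-2), the pull-back of (1 - lam) f'' u_x^2 dx; hence the pulled-back weak form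
  is minus the time derivative of H phi along a label.

  The iteration is global because boundedness of f'' bounds the time integral A by C T for every
  iterate, so that one weight (p + |k|)^r dominates all densities. Local integrability of this
  weight suffices, since U at the label s depends only on the labels between 0 and s.

  Across a fan p = 0, so that position and value are constant there at time 0.\<close>

definition loc_integrable :: "(real \<Rightarrow> real) \<Rightarrow> bool" where
  "loc_integrable h \<longleftrightarrow> (\<forall>a b. set_integrable lborel {a..b} h)"

text \<open>Oriented integral from 0: for every \<open>s\<close> at least one of the two intervals
  is empty or a single point. Labels and times both range over the whole line.\<close>

definition prim :: "(real \<Rightarrow> real) \<Rightarrow> real \<Rightarrow> real" where
  "prim h s = (LINT z:{0..s}|lborel. h z) - (LINT z:{s..0}|lborel. h z)"

lemma prim_0 [simp]: "prim h 0 = 0"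
  by (simp add: prim_def)

lemma set_integral_Icc_split:
  fixes h :: "real \<Rightarrow> real"
  assumes "a \<le> b" "b \<le> c" and h: "set_integrable lborel {a..c} h"
  shows "(LINT z:{a..c}|lborel. h z) = (LINT z:{a..b}|lborel. h z) + (LINT z:{b..c}|lborel. h z)"
proof -
  have "{a..c} = {a..b} \<union> {b..c}" using assms by auto
  moreover have "AE x in lborel. \<not> (x \<in> {a..b} \<and> x \<in> {b..c})"
    using AE_lborel_singleton[of b] by eventually_elim auto
  ultimately show ?thesis
    using assms by (auto intro!: set_integral_Un_AE set_integrable_subset[OF h])
qed

lemma prim_diff:
  assumes h: "loc_integrable h" and "a \<le> b"
  shows "prim h b - prim h a = (LINT z:{a..b}|lborel. h z)"
proof -
  have i: "set_integrable lborel {c..d} h" for c d using h by (auto simp: loc_integrable_def)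
  have null: "(LINT z:{c..d}|lborel. h z) = 0" if "d \<le> c" for c d
  proof (cases "c = d")
    case True
    have "AE z in lborel. indicator {c..d} z *\<^sub>R h z = 0"
      by (rule AE_mp[OF AE_lborel_singleton[of d]]) (use True in \<open>auto intro!: AE_I2\<close>)
    then show ?thesis unfolding set_lebesgue_integral_def by (rule integral_eq_zero_AE)
  next
    case False with that show ?thesis by (simp add: set_lebesgue_integral_def)
  qed
  consider "0 \<le> a" "0 \<le> b" | "a \<le> 0" "0 \<le> b" | "a \<le> 0" "b \<le> 0" using \<open>a \<le> b\<close> by linarith
  then show ?thesis
  proof cases
    case 1
    have "(LINT z:{a..0}|lborel. h z) = 0" "(LINT z:{b..0}|lborel. h z) = 0"
      by (rule null; use 1 in simp)+
    with set_integral_Icc_split[OF 1(1) \<open>a \<le> b\<close> i] show ?thesis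
      by (simp add: prim_def)
  next
    case 2
    have "(LINT z:{0..a}|lborel. h z) = 0" "(LINT z:{b..0}|lborel. h z) = 0"
      by (rule null; use 2 in simp)+
    with set_integral_Icc_split[OF 2 i] show ?thesis
      by (simp add: prim_def)
  next
    case 3
    have "(LINT z:{0..a}|lborel. h z) = 0" "(LINT z:{0..b}|lborel. h z) = 0"
      by (rule null; use 3 in simp)+
    with set_integral_Icc_split[OF \<open>a \<le> b\<close> 3(2) i] show ?thesis
      by (simp add: prim_def)
  qed
qed

lemma loc_integrableD: "loc_integrable h \<Longrightarrow> set_integrable lborel {a..b} h"
  by (auto simp: loc_integrable_def)

lemma loc_integrable_continuous:
  assumes "continuous_on UNIV h" shows "loc_integrable h"
  unfolding loc_integrable_def
  by (intro allI borel_integrable_atLeastAtMost' continuous_on_subset[OF assms]) simp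

lemma loc_integrable_bound:
  assumes "loc_integrable g" "h \<in> borel_measurable borel" "\<And>z. \<bar>h z\<bar> \<le> g z"
  shows "loc_integrable h"
  unfolding loc_integrable_def
proof (intro allI)
  fix a b
  show "set_integrable lborel {a..b} h"
    using assms(2,3)
    by (intro set_integrable_bound[OF loc_integrableD[OF assms(1), of a b]])
       (auto simp: set_borel_measurable_def intro!: AE_I2 order_trans[OF _ abs_ge_self])
qed

lemma prim_eq_integral:
  assumes h: "loc_integrable h" and "a \<le> b"
  shows "prim h b = prim h a + integral {a..b} h"
proof -
  have "(LINT z:{a..b}|lborel. h z) = integral {a..b} h"
    by (rule set_borel_integral_eq_integral(2)[OF loc_integrableD[OF h]])
  then show ?thesis using prim_diff[OF assms] by linarith
qed

lemma prim_continuous [continuous_intros]: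
  assumes h: "loc_integrable h"
  shows "continuous_on UNIV (prim h)"
proof -
  have "isCont (prim h) x" for x
  proof -
    have "continuous_on {x-1..x+1} (\<lambda>y. prim h (x-1) + integral {x-1..y} h)"
      using set_borel_integral_eq_integral[OF loc_integrableD[OF h, of "x-1" "x+1"]]
      by (intro continuous_intros indefinite_integral_continuous_1)
    then have "continuous_on {x-1..x+1} (prim h)"
      by (rule continuous_on_eq) (auto intro!: prim_eq_integral[OF h, symmetric])
    then show ?thesis by (rule continuous_on_interior) auto
  qed
  then show ?thesis by (simp add: continuous_at_imp_continuous_on)
qed

lemma prim_has_derivative:
  assumes h: "continuous_on UNIV h"
  shows "(prim h has_real_derivative h x) (at x)"
proof -
  have l: "loc_integrable h" by (rule loc_integrable_continuous[OF h])
  have "((\<lambda>y. prim h (x-1) + integral {x-1..y} h) has_real_derivative h x) (at x within {x-1..x+1})"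
    by (auto intro!: derivative_eq_intros integral_has_real_derivative continuous_on_subset[OF h])
  then have "(prim h has_real_derivative h x) (at x within {x-1..x+1})"
    by (rule has_field_derivative_transform_within[where d=1])
       (auto intro!: prim_eq_integral[OF l, symmetric])
  then show ?thesis
    using at_within_Icc_at[of "x-1" x "x+1"] by simp
qed

lemma set_integral_nonneg_real:
  fixes h :: "'a \<Rightarrow> real"
  assumes "\<And>z. z \<in> S \<Longrightarrow> 0 \<le> h z" shows "0 \<le> (LINT z:S|M. h z)"
  unfolding set_lebesgue_integral_def
  using assms by (intro Bochner_Integration.integral_nonneg) (auto simp: indicator_def)

lemma prim_mono:
  assumes h: "loc_integrable h" and "\<And>z. 0 \<le> h z" "a \<le> b"
  shows "prim h a \<le> prim h b"
proof -
  have "0 \<le> (LINT z:{a..b}|lborel. h z)" by (rule set_integral_nonneg_real) (rule assms(2))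
  then show ?thesis using prim_diff[OF h \<open>a \<le> b\<close>] by linarith
qed

lemma set_integral_abs_bound:
  fixes h g :: "'a \<Rightarrow> real"
  assumes g: "set_integrable M S g" and b: "\<And>z. z \<in> S \<Longrightarrow> \<bar>h z\<bar> \<le> g z"
  shows "\<bar>LINT z:S|M. h z\<bar> \<le> (LINT z:S|M. g z)"
proof (cases "set_integrable M S h")
  case True
  have "norm (LINT z|M. indicator S z *\<^sub>R h z) \<le> (LINT z|M. norm (indicator S z *\<^sub>R h z))"
    by (rule integral_norm_bound)
  also have "\<dots> \<le> (LINT z|M. indicator S z *\<^sub>R g z)"
    by (rule integral_mono)
      (use True g b in \<open>auto simp: set_integrable_def indicator_def intro!: integrable_abs\<close>)
  finally have "norm (LINT z|M. indicator S z *\<^sub>R h z) \<le> (LINT z|M. indicator S z *\<^sub>R g z)" .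
  then show ?thesis by (simp add: set_lebesgue_integral_def)
next
  case False
  then have "(LINT z:S|M. h z) = 0"
    by (simp add: set_lebesgue_integral_def set_integrable_def not_integrable_integral_eq)
  moreover have "0 \<le> g z" if "z \<in> S" for z using b[OF that] by linarith
  ultimately show ?thesis using set_integral_nonneg_real[of S g M] by simp
qed

lemma prim_abs_diff_le:
  assumes h: "loc_integrable h" and g: "loc_integrable g" and "\<And>z. z \<in> {a..b} \<Longrightarrow> \<bar>h z\<bar> \<le> g z" "a \<le> b"
  shows "\<bar>prim h b - prim h a\<bar> \<le> prim g b - prim g a"
proof -
  have "\<bar>LINT z:{a..b}|lborel. h z\<bar> \<le> (LINT z:{a..b}|lborel. g z)"
    by (rule set_integral_abs_bound[OF loc_integrableD[OF g] assms(3)])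
  then show ?thesis using prim_diff[OF h \<open>a \<le> b\<close>] prim_diff[OF g \<open>a \<le> b\<close>] by simp
qed

text \<open>Against the weight \<open>exp (K * \<bar>t\<bar>)\<close> integration gains the factor
  \<open>1 / K\<close>. This makes the Picard map contract on time intervals of any length, in both
  directions of time.\<close>

lemma prim_exp_bound:
  assumes h: "loc_integrable h" and K: "0 < K" and "0 \<le> c"
    and b: "\<And>\<tau>. \<bar>\<tau>\<bar> \<le> \<bar>t\<bar> \<Longrightarrow> \<bar>h \<tau>\<bar> \<le> c * exp (K * \<bar>\<tau>\<bar>)"
  shows "\<bar>prim h t\<bar> \<le> c / K * exp (K * \<bar>t\<bar>)"
proof -
  have ce: "continuous_on UNIV (\<lambda>\<tau>. c * exp (K * \<bar>\<tau>\<bar>))" by (intro continuous_intros)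
  have l: "loc_integrable (\<lambda>\<tau>. c * exp (K * \<bar>\<tau>\<bar>))" by (rule loc_integrable_continuous[OF ce])
  show ?thesis
  proof (cases "0 \<le> t")
    case True
    have "\<bar>prim h t - prim h 0\<bar> \<le> prim (\<lambda>\<tau>. c * exp (K * \<bar>\<tau>\<bar>)) t - prim (\<lambda>\<tau>. c * exp (K * \<bar>\<tau>\<bar>)) 0"
      using True by (intro prim_abs_diff_le h l b) auto
    also have "\<dots> = integral {0..t} (\<lambda>\<tau>. c * exp (K * \<bar>\<tau>\<bar>))"
      using prim_eq_integral[OF l True] by simp
    also have "\<dots> = integral {0..t} (\<lambda>\<tau>. c * exp (K * \<tau>))"
      by (intro Henstock_Kurzweil_Integration.integral_cong) auto
    also have "\<dots> = c / K * exp (K * t) - c / K * exp (K * 0)"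
      using True K by (intro integral_unique fundamental_theorem_of_calculus)
        (auto intro!: derivative_eq_intros simp: has_real_derivative_iff_has_vector_derivative[symmetric])
    also have "\<dots> \<le> c / K * exp (K * \<bar>t\<bar>)" using True K \<open>0 \<le> c\<close> by simp
    finally show ?thesis by simp
  next
    case False
    have "\<bar>prim h 0 - prim h t\<bar> \<le> prim (\<lambda>\<tau>. c * exp (K * \<bar>\<tau>\<bar>)) 0 - prim (\<lambda>\<tau>. c * exp (K * \<bar>\<tau>\<bar>)) t"
      using False by (intro prim_abs_diff_le h l b) auto
    also have "\<dots> = integral {t..0} (\<lambda>\<tau>. c * exp (K * \<bar>\<tau>\<bar>))"
      using prim_eq_integral[OF l, of t 0] False by simp
    also have "\<dots> = integral {t..0} (\<lambda>\<tau>. c * exp (- K * \<tau>))"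
      by (intro Henstock_Kurzweil_Integration.integral_cong) auto
    also have "\<dots> = - c / K * exp (- K * 0) - (- c / K * exp (- K * t))"
      using False K by (intro integral_unique fundamental_theorem_of_calculus)
        (auto intro!: derivative_eq_intros simp: has_real_derivative_iff_has_vector_derivative[symmetric])
    also have "\<dots> \<le> c / K * exp (K * \<bar>t\<bar>)" using False K \<open>0 \<le> c\<close> by simp
    finally show ?thesis by simp
  qed
qed

section \<open>Push-forward of a density under its primitive, change of variables\<close>

lemma prim_pushforward:
  assumes w: "loc_integrable w" "w \<in> borel_measurable borel" "\<And>s. 0 \<le> w s"
    and X: "\<And>a b. a \<le> b \<Longrightarrow> X b - X a = (LINT z:{a..b}|lborel. w z)"
    and cX: "continuous_on UNIV X"
    and surj: "\<And>x. \<exists>s. X s = x"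
  shows "distr (density lborel (\<lambda>s. ennreal (w s))) borel X = lborel"
proof (rule sym, rule lborel_eqI)
  have mX: "X \<in> borel_measurable borel" using cX by (rule borel_measurable_continuous_onI)
  have mono: "X a \<le> X b" if "a \<le> b" for a b
    using X[OF that] set_integral_nonneg_real[of "{a..b}" w lborel] w(3) by simp
  fix l u :: real
  assume "\<And>b. b \<in> Basis \<Longrightarrow> l \<bullet> b \<le> u \<bullet> b"
  then have lu: "l \<le> u" by simp
  obtain a0 where a0: "X a0 = l" using surj by blast
  obtain b0 where b0: "X b0 = u" using surj by blast
  obtain a1 where a1: "X a1 = l - 1" using surj by blast
  obtain b1 where b1: "X b1 = u + 1" using surj by blast
  \<comment> \<open>\<open>X\<close> may have plateaus and hence no inverse. With the last point of
    value at most \<open>l\<close> and the first of value at least \<open>u\<close>, the preimage of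
    the open interval is exactly \<open>{a<..<b}\<close>.\<close>
  define a where "a = Sup {s. X s \<le> l}"
  define b where "b = Inf {s. u \<le> X s}"
  have clo: "closed {s. X s \<le> l}" "closed {s. u \<le> X s}"
    using cX by (auto intro!: closed_Collect_le continuous_intros)
  have bda: "bdd_above {s. X s \<le> l}"
  proof (rule bdd_aboveI[of _ b1])
    fix s assume "s \<in> {s. X s \<le> l}"
    then show "s \<le> b1" using mono[of b1 s] b1 lu by (cases "s \<le> b1") auto
  qed
  have bdb: "bdd_below {s. u \<le> X s}"
  proof (rule bdd_belowI[of _ a1])
    fix s assume "s \<in> {s. u \<le> X s}"
    then show "a1 \<le> s" using mono[of s a1] a1 lu by (cases "a1 \<le> s") auto
  qed
  have aI: "a \<in> {s. X s \<le> l}"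
    unfolding a_def using a0 by (intro closed_contains_Sup bda clo) auto
  have bI: "b \<in> {s. u \<le> X s}"
    unfolding b_def using b0 by (intro closed_contains_Inf bdb clo) auto
  have Xa: "X a = l" using aI a0 mono[of a0 a] cSup_upper[OF _ bda, of a0] a_def by force
  have Xb: "X b = u" using bI b0 mono[of b b0] cInf_lower[OF _ bdb, of b0] b_def by force
  have eqs: "X -` box l u = {a<..<b}"
  proof (intro set_eqI iffI)
    fix s assume "s \<in> X -` box l u"
    then have "l < X s" "X s < u" by (auto simp: box_real)
    then show "s \<in> {a<..<b}"
      using mono[of s a] mono[of b s] Xa Xb by force
  next
    fix s assume s: "s \<in> {a<..<b}"
    have "\<not> X s \<le> l" using cSup_upper[OF _ bda, of s] s a_def by force
    moreover have "\<not> u \<le> X s" using cInf_lower[OF _ bdb, of s] s b_def by force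
    ultimately show "s \<in> X -` box l u" by (auto simp: box_real)
  qed
  show "emeasure (distr (density lborel (\<lambda>s. ennreal (w s))) borel X) (box l u) =
        ennreal (\<Prod>b\<in>Basis. (u - l) \<bullet> b)"
  proof (cases "a \<le> b")
    case True
    have "emeasure (distr (density lborel (\<lambda>s. ennreal (w s))) borel X) (box l u)
       = emeasure (density lborel (\<lambda>s. ennreal (w s))) {a<..<b}"
      using mX by (subst emeasure_distr) (auto simp: eqs[unfolded box_real])
    also have "\<dots> = (\<integral>\<^sup>+ s. ennreal (w s) * indicator {a<..<b} s \<partial>lborel)"
      using w(2) by (subst emeasure_density) auto
    also have "\<dots> = (\<integral>\<^sup>+ s. ennreal (indicator {a..b} s *\<^sub>R w s) \<partial>lborel)"
    proof (rule nn_integral_cong_AE)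
      show "AE s in lborel. ennreal (w s) * indicator {a<..<b} s = ennreal (indicator {a..b} s *\<^sub>R w s)"
        using AE_lborel_singleton[of a] AE_lborel_singleton[of b]
        by eventually_elim (auto simp: indicator_def)
    qed
    also have "\<dots> = ennreal (LINT s|lborel. indicator {a..b} s *\<^sub>R w s)"
      using loc_integrableD[OF w(1), of a b] w(3)
      by (intro nn_integral_eq_integral) (auto simp: set_integrable_def)
    also have "\<dots> = ennreal (X b - X a)" using X[OF True] by (simp add: set_lebesgue_integral_def)
    finally show ?thesis using Xa Xb by simp
  next
    \<comment> \<open>Only possible for \<open>l = u\<close>: both points then lie on one plateau,
      in reversed order.\<close>
    case False
    then have "X b \<le> X a" by (intro mono) auto
    then have "l = u" using Xa Xb lu by simp
    then show ?thesis by simp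
  qed
qed simp

lemma density_pushforward_integral:
  fixes h :: "'b \<Rightarrow> real" and w :: "'a \<Rightarrow> real"
  assumes X: "X \<in> measurable M N" and w: "w \<in> borel_measurable M" "\<And>s. 0 \<le> w s"
    and push: "distr (density M (\<lambda>s. ennreal (w s))) N X = P" and h: "h \<in> borel_measurable N"
  shows "integrable P h \<longleftrightarrow> integrable M (\<lambda>s. w s * h (X s))"
    and "(LINT x|P. h x) = (LINT s|M. w s * h (X s))"
proof -
  have X': "X \<in> measurable (density M (\<lambda>s. ennreal (w s))) N" using X by simp
  have hX: "(\<lambda>s. h (X s)) \<in> borel_measurable M" by (rule measurable_compose[OF X h])
  have "AE s in M. 0 \<le> w s" using w(2) by simp
  then show "integrable P h \<longleftrightarrow> integrable M (\<lambda>s. w s * h (X s))"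
    and "(LINT x|P. h x) = (LINT s|M. w s * h (X s))"
    unfolding push[symmetric] integrable_distr_eq[OF X' h] integral_distr[OF X' h]
    using integrable_density[OF hX w(1)] integral_density[OF hX w(1)] by simp_all
qed

text \<open>The preimage of \<open>{X a..X b}\<close> may exceed \<open>{a..b}\<close> by plateaus
  at the two end levels. These carry no mass of \<open>w\<close>, so the two indicators agree almost
  everywhere once multiplied by \<open>w\<close>.\<close>

lemma prim_change_of_variables:
  assumes w: "loc_integrable w" "w \<in> borel_measurable borel" "\<And>s. 0 \<le> w s"
    and X: "\<And>a b. a \<le> b \<Longrightarrow> X b - X a = (LINT z:{a..b}|lborel. w z)"
    and cX: "continuous_on UNIV X" and surj: "\<And>x. \<exists>s. X s = x"
    and h: "loc_integrable h" "h \<in> borel_measurable borel"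
  shows "loc_integrable (\<lambda>s. w s * h (X s))"
    and "a \<le> b \<Longrightarrow> (LINT s:{a..b}|lborel. w s * h (X s)) = (LINT x:{X a..X b}|lborel. h x)"
proof -
  have mX: "X \<in> borel_measurable borel" by (rule borel_measurable_continuous_onI[OF cX])
  have mX': "X \<in> measurable lborel borel" and mw: "w \<in> borel_measurable lborel" using mX w(2) by simp_all
  have push: "distr (density lborel (\<lambda>s. ennreal (w s))) borel X = lborel"
    by (rule prim_pushforward[OF w X cX surj])
  note P = density_pushforward_integral[OF mX' mw w(3) push]
  have mono: "X a \<le> X b" if "a \<le> b" for a b
    using X[OF that] set_integral_nonneg_real[of "{a..b}" w lborel] w(3) by auto
  \<comment> \<open>Test the push-forward with the indicator of the null set
    \<open>{c}\<close>.\<close>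
  have plateau: "AE s in lborel. X s = c \<longrightarrow> w s = 0" for c
  proof -
    have 1: "(indicator {c} :: real \<Rightarrow> real) \<in> borel_measurable borel" by simp
    have "integrable lborel (indicator {c} :: real \<Rightarrow> real)" by simp
    moreover have "(LINT x|lborel. indicator {c} x :: real) = 0" by simp
    ultimately have "integrable lborel (\<lambda>s. w s * indicator {c} (X s))" "(LINT s|lborel. w s * indicator {c} (X s)) = 0"
      using P[OF 1] by simp_all
    then have "AE s in lborel. w s * indicator {c} (X s) = 0"
      using w(3) by (subst (asm) integral_nonneg_eq_0_iff_AE) (auto intro!: AE_I2)
    then show ?thesis by eventually_elim (auto simp: indicator_def split: if_splits)
  qed
  have ae: "AE s in lborel. indicator {a..b} s *\<^sub>R (w s * h (X s)) = w s * (indicator {X a..X b} (X s) * h (X s))" for a b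
    using plateau[of "X a"] plateau[of "X b"]
  proof eventually_elim
    case (elim s)
    show ?case
    proof (cases "w s = 0")
      case False
      then have "X s \<noteq> X a" "X s \<noteq> X b" using elim by auto
      then have "s \<in> {a..b} \<longleftrightarrow> X s \<in> {X a..X b}"
        using mono[of a s] mono[of s a] mono[of s b] mono[of b s] by (cases "a \<le> s"; cases "s \<le> b") auto
      then show ?thesis by (auto simp: indicator_def)
    qed simp
  qed
  have m1: "(\<lambda>x. indicator {X a..X b} x * h x) \<in> borel_measurable borel" for a b
    using h(2) by measurable
  have m2: "(\<lambda>s. indicator {a..b} s *\<^sub>R (w s * h (X s))) \<in> borel_measurable lborel" for a b
    using w(2) measurable_compose[OF mX h(2)] by measurable
  have m3: "(\<lambda>s. w s * (indicator {X a..X b} (X s) * h (X s))) \<in> borel_measurable lborel" for a b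
    using w(2) measurable_compose[OF mX m1[of a b]] by measurable
  show "loc_integrable (\<lambda>s. w s * h (X s))"
    unfolding loc_integrable_def set_integrable_def
  proof (intro allI)
    fix a b
    have "integrable lborel (\<lambda>x. indicator {X a..X b} x * h x)"
      using loc_integrableD[OF h(1), of "X a" "X b"] by (simp add: set_integrable_def)
    then show "integrable lborel (\<lambda>s. indicator {a..b} s *\<^sub>R (w s * h (X s)))"
      unfolding integrable_cong_AE[OF m2 m3 ae] P(1)[OF m1] .
  qed
  show "(LINT s:{a..b}|lborel. w s * h (X s)) = (LINT x:{X a..X b}|lborel. h x)" if "a \<le> b"
    unfolding set_lebesgue_integral_def integral_cong_AE[OF m2 m3 ae]
    using P(2)[OF m1, of a b] by simp
qed

section \<open>Chain rule and Fubini for oriented integrals\<close>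

text \<open>Reparametrized by \<open>H\<close>, the function \<open>E\<close> has derivative zero.\<close>

lemma quadratic_increment_const:
  fixes E H :: "real \<Rightarrow> real"
  assumes cH: "continuous_on {a..b} H" and mono: "\<And>x y. a \<le> x \<Longrightarrow> x \<le> y \<Longrightarrow> y \<le> b \<Longrightarrow> H x \<le> H y"
    and E: "\<And>x y. a \<le> x \<Longrightarrow> x \<le> y \<Longrightarrow> y \<le> b \<Longrightarrow> \<bar>E y - E x\<bar> \<le> K * (H y - H x)\<^sup>2"
    and "a \<le> b"
  shows "E b = E a"
proof -
  \<comment> \<open>\<open>H\<close> need not be injective, but any choice of preimage works: by the
    bound, \<open>E\<close> is constant wherever \<open>H\<close> is.\<close>
  define pick where "pick y = (SOME x. x \<in> {a..b} \<and> H x = y)" for y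
  have pick: "pick y \<in> {a..b} \<and> H (pick y) = y" if "y \<in> {H a..H b}" for y
  proof -
    have "\<exists>x\<ge>a. x \<le> b \<and> H x = y" 
      by (rule IVT'[OF _ _ \<open>a \<le> b\<close> cH]) (use that in auto)
    then have "\<exists>x. x \<in> {a..b} \<and> H x = y" by auto
    from someI_ex[OF this] show ?thesis by (simp only: pick_def)
  qed
  define e where "e y = E (pick y)" for y
  have eE: "\<bar>E y - E x\<bar> \<le> \<bar>K\<bar> * (H y - H x)\<^sup>2" if "x \<in> {a..b}" "y \<in> {a..b}" for x y
  proof -
    have "K * (H y - H x)\<^sup>2 \<le> \<bar>K\<bar> * (H y - H x)\<^sup>2" by (intro mult_right_mono) auto
    moreover have "\<bar>E y - E x\<bar> \<le> K * (H y - H x)\<^sup>2"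
      using E[of x y] E[of y x] that by (cases "x \<le> y") (auto simp: abs_minus_commute power2_commute)
    ultimately show ?thesis by linarith
  qed
  have q: "\<bar>e y - e x\<bar> \<le> \<bar>K\<bar> * \<bar>y - x\<bar> * \<bar>y - x\<bar>" if "x \<in> {H a..H b}" "y \<in> {H a..H b}" for x y
    using eE[of "pick x" "pick y"] pick[OF that(1)] pick[OF that(2)]
    by (simp add: e_def power2_eq_square)
  have "(e has_derivative (\<lambda>h. 0)) (at x within {H a..H b})" if x: "x \<in> {H a..H b}" for x
  proof -
    have "((\<lambda>y. (e y - e x) / norm (y - x)) \<longlongrightarrow> 0) (at x within {H a..H b})"
    proof (rule Lim_null_comparison)
      show "\<forall>\<^sub>F y in at x within {H a..H b}. norm ((e y - e x) / norm (y - x)) \<le> \<bar>K\<bar> * \<bar>y - x\<bar>"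
        unfolding eventually_at_filter
        using q[OF x] by (intro always_eventually) (auto simp: field_simps)
      show "((\<lambda>y. \<bar>K\<bar> * \<bar>y - x\<bar>) \<longlongrightarrow> 0) (at x within {H a..H b})"
        by (auto intro!: tendsto_eq_intros)
    qed
    then show ?thesis by (simp add: has_derivative_within)
  qed
  then have "\<exists>c. \<forall>x\<in>{H a..H b}. e x = c"
    by (intro has_derivative_zero_constant) auto
  then have "e (H a) = e (H b)" using mono[of a b] \<open>a \<le> b\<close> by auto
  moreover have "e (H x) = E x" if "x \<in> {a..b}" for x
  proof -
    have "H x \<in> {H a..H b}" using mono that by auto
    then show ?thesis using eE[of "pick (H x)" x] pick[of "H x"] that by (simp add: e_def)
  qed
  ultimately show ?thesis using \<open>a \<le> b\<close> by simp
qed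

text \<open>\<open>V = u0 + prim h\<close> is only absolutely continuous, so the classical chain
  rule does not apply. Over an interval from x to y, the increments of \<open>F (V z)\<close> and of
  the primitive of \<open>G (V z) * h z\<close> both differ from
  \<open>G (V x) * (V y - V x)\<close> by at most \<open>L\<close> times the square of
  \<open>H y - H x\<close>, where \<open>H\<close> is the variation of \<open>V\<close>. Their
  difference is therefore constant by \<open>quadratic_increment_const\<close>.\<close>

lemma prim_chain_rule:
  assumes h: "loc_integrable h" and c: "\<And>x. (F has_real_derivative G x) (at x)"
    and L: "\<And>x y. \<bar>G x - G y\<bar> \<le> L * \<bar>x - y\<bar>"
    and Gh: "loc_integrable (\<lambda>z. G (u0 + prim h z) * h z)"
    and "a \<le> b"
  shows "F (u0 + prim h b) - F (u0 + prim h a) = (LINT z:{a..b}|lborel. G (u0 + prim h z) * h z)"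
proof -
  define V where "V z = u0 + prim h z" for z
  define E where "E z = F (V z) - prim (\<lambda>z. G (V z) * h z) z" for z
  have ha: "loc_integrable (\<lambda>z. \<bar>h z\<bar>)"
    using h by (auto simp: loc_integrable_def intro: set_integrable_abs)
  define H where "H = prim (\<lambda>z. \<bar>h z\<bar>)"
  have L0: "0 \<le> L" using L[of 1 0] abs_ge_zero[of "G 1 - G 0"] by simp
  have Vd: "\<bar>V y - V x\<bar> \<le> H y - H x" if "x \<le> y" for x y
    using prim_abs_diff_le[OF h ha _ that] by (simp add: V_def H_def)
  have Hm: "H x \<le> H y" if "x \<le> y" for x y
    using prim_mono[OF ha _ that] by (simp add: H_def)
  have Eb: "\<bar>E y - E x\<bar> \<le> (2 * L) * (H y - H x)\<^sup>2" if xy: "x \<le> y" for x y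
  proof -
    have Hnn: "0 \<le> H y - H x" using Hm xy by simp
    have f1: "\<bar>F (V y) - F (V x) - G (V x) * (V y - V x)\<bar> \<le> L * (H y - H x) * (H y - H x)"
    proof (cases "V x = V y")
      case False
      have "\<exists>z. z \<in> closed_segment (V x) (V y) \<and> F (V y) - F (V x) = (V y - V x) * G z"
      proof (cases "V x < V y")
        case True
        obtain z where "V x < z" "z < V y" "F (V y) - F (V x) = (V y - V x) * G z"
          using MVT2[OF True] c by metis
        then show ?thesis by (intro exI[of _ z]) (auto simp: closed_segment_eq_real_ivl)
      next
        case ff: False
        with False have "V y < V x" by simp
        then obtain z where "V y < z" "z < V x" "F (V x) - F (V y) = (V x - V y) * G z"
          using MVT2[OF \<open>V y < V x\<close>] c by metis
        then show ?thesis by (intro exI[of _ z]) (auto simp: closed_segment_eq_real_ivl algebra_simps)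
      qed
      then obtain z where z: "z \<in> closed_segment (V x) (V y)" "F (V y) - F (V x) = (V y - V x) * G z" by blast
      have "F (V y) - F (V x) - G (V x) * (V y - V x) = (G z - G (V x)) * (V y - V x)"
        using z(2) by (simp add: algebra_simps)
      also have "\<bar>\<dots>\<bar> \<le> (L * \<bar>z - V x\<bar>) * \<bar>V y - V x\<bar>"
        unfolding abs_mult by (intro mult_right_mono L) auto
      also have "\<bar>z - V x\<bar> \<le> \<bar>V y - V x\<bar>" using z(1) by (auto simp: closed_segment_eq_real_ivl split: if_splits)
      then have "(L * \<bar>z - V x\<bar>) * \<bar>V y - V x\<bar> \<le> (L * (H y - H x)) * (H y - H x)"
        using L0 Vd[OF xy] Hnn by (intro mult_mono) auto
      finally show ?thesis .
    qed (use L0 Hnn in auto)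
    have "prim (\<lambda>z. G (V z) * h z) y - prim (\<lambda>z. G (V z) * h z) x - G (V x) * (V y - V x)
        = (LINT z:{x..y}|lborel. G (V z) * h z) - (LINT z:{x..y}|lborel. G (V x) * h z)"
      using prim_diff[OF Gh xy] prim_diff[OF h xy] by (simp add: V_def)
    also have "\<dots> = (LINT z:{x..y}|lborel. G (V z) * h z - G (V x) * h z)"
      using loc_integrableD[OF h, of x y] loc_integrableD[OF Gh, of x y]
      by (intro set_integral_diff(2)[symmetric]) (auto simp: V_def)
    also have "\<bar>\<dots>\<bar> \<le> (LINT z:{x..y}|lborel. L * (H y - H x) * \<bar>h z\<bar>)"
    proof (rule set_integral_abs_bound)
      show "set_integrable lborel {x..y} (\<lambda>z. L * (H y - H x) * \<bar>h z\<bar>)"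
        using loc_integrableD[OF ha, of x y] by auto
      fix z assume z: "z \<in> {x..y}"
      have "\<bar>G (V z) * h z - G (V x) * h z\<bar> = \<bar>G (V z) - G (V x)\<bar> * \<bar>h z\<bar>"
        by (simp add: abs_mult[symmetric] algebra_simps)
      also have "\<dots> \<le> L * \<bar>V z - V x\<bar> * \<bar>h z\<bar>" by (intro mult_right_mono L) auto
      also have "\<dots> \<le> L * (H y - H x) * \<bar>h z\<bar>"
        using Vd[of x z] Hm[of z y] z L0 by (intro mult_right_mono mult_left_mono) auto
      finally show "\<bar>G (V z) * h z - G (V x) * h z\<bar> \<le> L * (H y - H x) * \<bar>h z\<bar>" .
    qed
    also have "\<dots> = L * (H y - H x) * (H y - H x)"
      using prim_diff[OF ha xy] by (simp add: H_def)
    finally show ?thesis using f1 by (simp add: E_def power2_eq_square abs_if split: if_splits)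
  qed
  have cH: "continuous_on {a..b} H"
    unfolding H_def by (rule continuous_on_subset[OF prim_continuous[OF ha]]) simp
  have "E b = E a"
    by (rule quadratic_increment_const[OF cH _ _ \<open>a \<le> b\<close>]) (rule Hm Eb, assumption)+
  then show ?thesis
    using prim_diff[OF Gh \<open>a \<le> b\<close>] by (simp add: E_def V_def)
qed

lemma integrable_pair_times:
  fixes f g :: "real \<Rightarrow> real"
  assumes f: "integrable lborel f" and g: "integrable lborel g"
  shows "integrable (lborel \<Otimes>\<^sub>M lborel) (\<lambda>z. f (fst z) * g (snd z))"
proof (rule lborel_pair.Fubini_integrable)
  show "(\<lambda>z. f (fst z) * g (snd z)) \<in> borel_measurable (lborel \<Otimes>\<^sub>M lborel)"
    by (rule borel_measurable_times[OF measurable_compose[OF measurable_fst borel_measurable_integrable[OF f]]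
          measurable_compose[OF measurable_snd borel_measurable_integrable[OF g]]])
  show "integrable lborel (\<lambda>x. LINT y|lborel. norm (f (fst (x, y)) * g (snd (x, y))))"
    using f by (simp add: abs_mult)
  show "AE x in lborel. integrable lborel (\<lambda>y. f (fst (x, y)) * g (snd (x, y)))"
    using g by (intro AE_I2) simp
qed

lemma prim_eq_lborel: "prim h c = (LINT z|lborel. (indicator {0..c} z - indicator {c..0} z) * h z)"
proof -
  consider "c = 0" | "0 < c" | "c < 0" by linarith
  then show ?thesis by cases (simp_all add: prim_def set_lebesgue_integral_def)
qed

text \<open>Written with the signed kernel \<open>\<sigma>\<close>, an oriented integral is a single
  integral over the line, so one application of Fubini covers all signs of \<open>t\<close> and
  \<open>s\<close>.\<close>

lemma prim_Fubini:
  fixes g :: "real \<Rightarrow> real \<Rightarrow> real"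
  assumes m: "(\<lambda>z. g (fst z) (snd z)) \<in> borel_measurable borel" and w: "loc_integrable w"
    and b: "\<And>t s. \<bar>t\<bar> \<le> T \<Longrightarrow> \<bar>g t s\<bar> \<le> w s" and T: "\<bar>t\<bar> \<le> T"
  shows "prim (\<lambda>s. prim (\<lambda>t. g t s) t) s = prim (\<lambda>t. prim (\<lambda>s. g t s) s) t"
proof -
  define \<sigma> where "\<sigma> c z = indicator {0..c} z - (indicator {c..0} z :: real)" for c z :: real
  have [measurable]: "(\<lambda>z. \<sigma> c z) \<in> borel_measurable borel" for c unfolding \<sigma>_def by measurable
  have \<sigma>b: "\<bar>\<sigma> c z\<bar> \<le> indicator {-\<bar>c\<bar>..\<bar>c\<bar>} z" for c z by (auto simp: \<sigma>_def indicator_def)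
  have [measurable]: "(\<lambda>z. g (fst z) (snd z)) \<in> borel_measurable (lborel \<Otimes>\<^sub>M lborel)"
    using m by (simp add: lborel_prod)
  have w0: "0 \<le> w s" for s
  proof -
    have "\<bar>0\<bar> \<le> T" using T by simp
    from b[OF this, of s] show ?thesis by linarith
  qed
  have int: "integrable (lborel \<Otimes>\<^sub>M lborel) (\<lambda>z. \<sigma> t (fst z) * \<sigma> s (snd z) * g (fst z) (snd z))"
  proof (rule Bochner_Integration.integrable_bound[OF integrable_pair_times])
    show "integrable lborel (\<lambda>\<tau>. indicator {-\<bar>t\<bar>..\<bar>t\<bar>} \<tau> :: real)"
      by (rule integrable_real_indicator) (auto simp: emeasure_lborel_Icc_eq)
    show "integrable lborel (\<lambda>z. indicator {-\<bar>s\<bar>..\<bar>s\<bar>} z * w z)"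
      using loc_integrableD[OF w, of "-\<bar>s\<bar>" "\<bar>s\<bar>"] by (simp add: set_integrable_def)
    show "AE z in lborel \<Otimes>\<^sub>M lborel. norm (\<sigma> t (fst z) * \<sigma> s (snd z) * g (fst z) (snd z))
      \<le> norm (indicator {-\<bar>t\<bar>..\<bar>t\<bar>} (fst z) * (indicator {-\<bar>s\<bar>..\<bar>s\<bar>} (snd z) * w (snd z)))"
    proof (rule AE_I2)
      fix z :: "real \<times> real"
      show "norm (\<sigma> t (fst z) * \<sigma> s (snd z) * g (fst z) (snd z))
        \<le> norm (indicator {-\<bar>t\<bar>..\<bar>t\<bar>} (fst z) * (indicator {-\<bar>s\<bar>..\<bar>s\<bar>} (snd z) * w (snd z)))"
      proof (cases "\<bar>fst z\<bar> \<le> \<bar>t\<bar>")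
        case True
        then have "\<bar>fst z\<bar> \<le> T" using T by simp
        from b[OF this, of "snd z"] have "\<bar>\<sigma> t (fst z)\<bar> * \<bar>\<sigma> s (snd z)\<bar> * \<bar>g (fst z) (snd z)\<bar>
          \<le> indicator {-\<bar>t\<bar>..\<bar>t\<bar>} (fst z) * indicator {-\<bar>s\<bar>..\<bar>s\<bar>} (snd z) * w (snd z)"
          by (intro mult_mono \<sigma>b) auto
        then show ?thesis using w0 by (simp add: abs_mult mult_ac)
      next
        case False
        then have "\<sigma> t (fst z) = 0" by (auto simp: \<sigma>_def indicator_def)
        then show ?thesis by simp
      qed
    qed
  qed measurable
  have "(LINT z|lborel. \<sigma> s z * (LINT \<tau>|lborel. \<sigma> t \<tau> * g \<tau> z))
      = (LINT z|lborel. LINT \<tau>|lborel. \<sigma> t \<tau> * \<sigma> s z * g \<tau> z)"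
    by (simp add: mult.assoc mult.left_commute)
  also have "\<dots> = (LINT \<tau>|lborel. LINT z|lborel. \<sigma> t \<tau> * \<sigma> s z * g \<tau> z)"
    by (rule lborel_pair.Fubini_integral[of "\<lambda>\<tau> z. \<sigma> t \<tau> * \<sigma> s z * g \<tau> z"])
       (use int in \<open>simp only: case_prod_unfold\<close>)
  also have "\<dots> = (LINT \<tau>|lborel. \<sigma> t \<tau> * (LINT z|lborel. \<sigma> s z * g \<tau> z))"
    by (simp add: mult.assoc)
  finally show ?thesis by (simp only: prim_eq_lborel \<sigma>_def)
qed

section \<open>Signed powers\<close>

definition spow :: "real \<Rightarrow> real \<Rightarrow> real" where
  "spow q m = sgn m * \<bar>m\<bar> powr q"

text \<open>The case distinction is needed because \<open>0 powr 0 = 0\<close>.\<close>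

definition dpow :: "real \<Rightarrow> real \<Rightarrow> real" where
  "dpow r m = (r - 1) * (if r = 2 then 1 else \<bar>m\<bar> powr (r - 2))"

lemma abs_spow: "\<bar>spow q m\<bar> = \<bar>m\<bar> powr q"
  by (auto simp: spow_def abs_mult abs_sgn_eq)

lemma spow_0 [simp]: "spow q 0 = 0"
  by (simp add: spow_def)

lemma spow_borel [measurable]: "spow q \<in> borel_measurable borel"
  unfolding spow_def by measurable

lemma dpow_nonneg: "2 \<le> r \<Longrightarrow> 0 \<le> dpow r m"
  by (simp add: dpow_def)

lemma dpow_le:
  assumes "2 \<le> r" "\<bar>m\<bar> \<le> M" "0 < M"
  shows "dpow r m \<le> (r - 1) * M powr (r - 2)"
  using assms by (auto simp: dpow_def intro!: mult_left_mono powr_mono2)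

lemma dpow_nonzero: "m \<noteq> 0 \<Longrightarrow> dpow r m = (r - 1) * \<bar>m\<bar> powr (r - 2)"
  by (simp add: dpow_def)

lemma dpow_at_0: "r \<noteq> 2 \<Longrightarrow> dpow r 0 = 0"
  by (simp add: dpow_def)

lemma tendsto_abs_powr_0:
  assumes "0 < (q::real)" shows "((\<lambda>h::real. \<bar>h\<bar> powr q) \<longlongrightarrow> 0) (at 0)"
proof -
  have "((\<lambda>h::real. \<bar>h\<bar>) \<longlongrightarrow> 0) (at 0)" by (auto intro!: tendsto_eq_intros)
  then show ?thesis
    using tendsto_zero_powrI[of "\<lambda>h::real. \<bar>h\<bar>" "at 0" "\<lambda>_. q" q] assms by simp
qed

text \<open>At 0 this rests on \<open>2 \<le> r\<close>: for \<open>r = 2\<close> the function is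
  the identity, and for larger \<open>r\<close> the difference quotient has absolute value
  \<open>\<bar>h\<bar> powr (r - 2)\<close>, which tends to 0.\<close>

lemma spow_has_derivative:
  assumes r: "2 \<le> r"
  shows "(spow (r - 1) has_real_derivative dpow r m) (at m)"
proof -
  consider "0 < m" | "m < 0" | "m = 0" "r = 2" | "m = 0" "2 < r" using r by linarith
  then show ?thesis
  proof cases
    case 1
    then have "((\<lambda>z. z powr (r - 1)) has_real_derivative (r - 1) * m powr (r - 1 - 1)) (at m)"
      by (rule has_real_derivative_powr)
    then have "(spow (r - 1) has_real_derivative (r - 1) * m powr (r - 1 - 1)) (at m)"
      by (rule has_field_derivative_transform_within_open[where S="{0<..}"])
         (use 1 in \<open>auto simp: spow_def\<close>)
    then show ?thesis using 1 by (simp add: dpow_nonzero)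
  next
    case 2
    have "((\<lambda>z. - ((- z) powr (r - 1))) has_real_derivative (r - 1) * (-m) powr (r - 1 - 1)) (at m)"
      using 2 by (auto intro!: derivative_eq_intros)
    then have "(spow (r - 1) has_real_derivative (r - 1) * (-m) powr (r - 1 - 1)) (at m)"
      by (rule has_field_derivative_transform_within_open[where S="{..<0}"])
         (use 2 in \<open>auto simp: spow_def\<close>)
    then show ?thesis using 2 by (simp add: dpow_nonzero)
  next
    case 3
    have "spow (r - 1) = (\<lambda>z. z)" using 3 by (auto simp: fun_eq_iff spow_def sgn_mult_abs)
    then show ?thesis using 3 by (simp add: dpow_def)
  next
    case 4
    have "((\<lambda>h. spow (r - 1) h / h) \<longlongrightarrow> 0) (at 0)"
    proof (rule Lim_null_comparison)
      show "((\<lambda>h::real. \<bar>h\<bar> powr (r - 2)) \<longlongrightarrow> 0) (at 0)"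
        using 4 by (intro tendsto_abs_powr_0) auto
      have "norm (spow (r - 1) h / h) \<le> \<bar>h\<bar> powr (r - 2)" for h
        using powr_diff[of "\<bar>h\<bar>" "r - 1" 1] by (simp add: abs_divide abs_spow)
      then show "\<forall>\<^sub>F h in at 0. norm (spow (r - 1) h / h) \<le> \<bar>h\<bar> powr (r - 2)" by simp
    qed
    then show ?thesis using 4 by (simp add: DERIV_def dpow_at_0)
  qed
qed

lemma abs_powr_eq_spow: "\<bar>m\<bar> powr r = m * spow (r - 1) m"
  using powr_mult_base[of "\<bar>m\<bar>" "r - 1"]
  by (simp add: spow_def mult.assoc[symmetric] mult_sgn_abs abs_sgn[symmetric])

lemma abs_powr_has_derivative:
  assumes r: "2 \<le> r"
  shows "((\<lambda>m. \<bar>m\<bar> powr r) has_real_derivative r * spow (r - 1) m) (at m)"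
proof -
  have "((\<lambda>z. z * spow (r - 1) z) has_real_derivative spow (r - 1) m + dpow r m * m) (at m)"
    by (auto intro!: derivative_eq_intros spow_has_derivative[OF r])
  moreover have "dpow r m * m = (r - 1) * spow (r - 1) m"
  proof (cases "m = 0")
    case False
    then have "\<bar>m\<bar> powr (r - 2) * m = sgn m * \<bar>m\<bar> powr (r - 1)"
      using powr_mult_base[of "\<bar>m\<bar>" "r - 2"]
      by (cases "m > 0") (auto simp: sgn_if mult.commute)
    then show ?thesis using False by (simp add: dpow_nonzero spow_def)
  qed simp
  ultimately show ?thesis unfolding abs_powr_eq_spow by (simp add: algebra_simps)
qed

lemma spow_continuous: "2 \<le> r \<Longrightarrow> continuous_on S (spow (r - 1))"
  by (meson DERIV_continuous_on has_field_derivative_at_within spow_has_derivative)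

lemma dpow_continuous: "2 \<le> r \<Longrightarrow> continuous_on S (dpow r)"
  unfolding dpow_def by (cases "r = 2") (auto intro!: continuous_intros continuous_on_powr')

lemma spow_Lipschitz:
  assumes r: "2 \<le> r" and "\<bar>m\<bar> \<le> M" "\<bar>n\<bar> \<le> M" "0 < M"
  shows "\<bar>spow (r - 1) m - spow (r - 1) n\<bar> \<le> (r - 1) * M powr (r - 2) * \<bar>m - n\<bar>"
proof -
  have "norm (spow (r - 1) m - spow (r - 1) n) \<le> (r - 1) * M powr (r - 2) * norm (m - n)"
  proof (rule field_differentiable_bound[where S="{-M..M}"])
    show "\<And>z. z \<in> {-M..M} \<Longrightarrow> (spow (r - 1) has_field_derivative dpow r z) (at z within {-M..M})"
      by (rule has_field_derivative_at_within[OF spow_has_derivative[OF r]])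
    show "\<And>z. z \<in> {-M..M} \<Longrightarrow> norm (dpow r z) \<le> (r - 1) * M powr (r - 2)"
      using dpow_le[OF r _ \<open>0 < M\<close>] dpow_nonneg[OF r] by (simp add: abs_le_iff)
  qed (use assms in auto)
  then show ?thesis by simp
qed

text \<open>Holder's inequality with exponents \<open>r\<close> and \<open>r / (r - 1)\<close>, by
  Young's inequality for the two factors normalized with \<open>E\<close> and \<open>Y\<close>.
  \<open>E\<close> is only an upper bound for the energy, kept positive so that the normalization
  never divides by 0.\<close>

lemma Holder_spow:
  fixes k m :: "'a \<Rightarrow> real"
  assumes r: "2 \<le> r" and mk: "k \<in> borel_measurable M" and mm: "m \<in> borel_measurable M" and S: "S \<in> sets M"
    and ik: "set_integrable M S (\<lambda>z. \<bar>k z\<bar> powr r)" and im: "set_integrable M S (\<lambda>z. \<bar>m z\<bar> powr r)"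
    and E: "(LINT z:S|M. \<bar>k z\<bar> powr r) \<le> E" "0 < E"
    and i: "set_integrable M S (\<lambda>z. \<bar>k z\<bar> * \<bar>m z\<bar> powr (r - 1))"
  shows "(LINT z:S|M. \<bar>k z\<bar> * \<bar>m z\<bar> powr (r - 1)) \<le> E powr (1 / r) * (LINT z:S|M. \<bar>m z\<bar> powr r) powr (1 - 1 / r)"
proof -
  define Y where "Y = (LINT z:S|M. \<bar>m z\<bar> powr r)"
  have Y0: "0 \<le> Y" unfolding Y_def by (rule set_integral_nonneg_real) auto
  show ?thesis
  proof (cases "Y = 0")
    case True
    have "AE z in M. indicator S z *\<^sub>R \<bar>m z\<bar> powr r = 0"
      using True im unfolding Y_def set_lebesgue_integral_def set_integrable_def
      by (subst integral_nonneg_eq_0_iff_AE[symmetric]) (auto intro!: AE_I2)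
    then have "AE z in M. indicator S z *\<^sub>R (\<bar>k z\<bar> * \<bar>m z\<bar> powr (r - 1)) = 0"
      by eventually_elim (auto simp: indicator_def)
    then have "(LINT z:S|M. \<bar>k z\<bar> * \<bar>m z\<bar> powr (r - 1)) = 0"
      unfolding set_lebesgue_integral_def by (rule integral_eq_zero_AE)
    then show ?thesis by simp
  next
    case False
    then have Yp: "0 < Y" using Y0 by simp
    define q where "q = r / (r - 1)"
    have q: "0 < q" "1 < q" "1 / r + 1 / q = 1" using r by (auto simp: q_def field_simps)
    define c where "c = E powr (1 / r) * Y powr (1 - 1 / r)"
    have c0: "0 \<le> c" by (simp add: c_def)
    have pt: "\<bar>k z\<bar> * \<bar>m z\<bar> powr (r - 1) \<le> c * (\<bar>k z\<bar> powr r / E / r + \<bar>m z\<bar> powr r / Y / q)" for z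
    proof -
      define a where "a = \<bar>k z\<bar> / E powr (1 / r)"
      define b where "b = \<bar>m z\<bar> powr (r - 1) / Y powr (1 - 1 / r)"
      have "a * b \<le> a powr r / r + b powr q / q"
        using r q by (intro Youngs_inequality) (auto simp: a_def b_def)
      also have "a powr r = \<bar>k z\<bar> powr r / E"
        using r E(2) by (simp add: a_def powr_divide powr_powr)
      also have "b powr q = \<bar>m z\<bar> powr r / Y"
      proof -
        have "(r - 1) * q = r" "(1 - 1 / r) * q = 1" using r by (auto simp: q_def field_simps)
        then show ?thesis using Yp by (simp add: b_def powr_divide powr_powr)
      qed
      finally have "c * (a * b) \<le> c * (\<bar>k z\<bar> powr r / E / r + \<bar>m z\<bar> powr r / Y / q)"
        by (intro mult_left_mono c0)
      moreover have "c * (a * b) = \<bar>k z\<bar> * \<bar>m z\<bar> powr (r - 1)"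
        using E(2) Yp by (simp add: a_def b_def c_def)
      ultimately show ?thesis by simp
    qed
    have "(LINT z:S|M. \<bar>k z\<bar> * \<bar>m z\<bar> powr (r - 1))
        \<le> (LINT z:S|M. c * (\<bar>k z\<bar> powr r / E / r + \<bar>m z\<bar> powr r / Y / q))"
      using ik im i pt by (intro set_integral_mono set_integrable_mult_right set_integral_add set_integrable_divide) auto
    also have "\<dots> = c * ((LINT z:S|M. \<bar>k z\<bar> powr r) / E / r + Y / Y / q)"
      using ik im by (simp add: set_integral_add Y_def)
    also have "\<dots> \<le> c * (1 / r + 1 / q)"
      using E r False q(1) by (intro mult_left_mono add_mono c0 divide_right_mono) (auto simp: field_simps)
    finally show ?thesis using q by (simp add: c_def Y_def)
  qed
qed

section \<open>Weak derivatives and primitives\<close>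

lemma C1_fun_realI:
  assumes "\<And>x. (\<phi> has_real_derivative \<phi>' x) (at x)" "continuous_on UNIV \<phi>'"
  shows "C1_fun (\<phi> :: real \<Rightarrow> real)"
  unfolding C1_fun_def
proof (intro exI conjI allI)
  fix p show "(\<phi> has_derivative blinfun_apply (\<phi>' p *\<^sub>R id_blinfun)) (at p)"
    using assms(1)[of p] by (simp add: has_field_derivative_def scaleR_blinfun.rep_eq)
next
  show "continuous_on UNIV (\<lambda>p. \<phi>' p *\<^sub>R (id_blinfun :: real \<Rightarrow>\<^sub>L real))"
    by (intro continuous_intros assms(2))
qed

lemma C1_fun_realD:
  assumes "C1_fun (\<phi> :: real \<Rightarrow> real)"
  shows "(\<phi> has_real_derivative deriv \<phi> x) (at x)" "continuous_on UNIV (deriv \<phi>)"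
proof -
  obtain D where D: "\<And>p. (\<phi> has_derivative blinfun_apply (D p)) (at p)" and c: "continuous_on UNIV D"
    using assms unfolding C1_fun_def by blast
  have d: "(\<phi> has_real_derivative blinfun_apply (D p) 1) (at p)" for p
  proof -
    have e: "blinfun_apply (D p) = (*) (blinfun_apply (D p) 1)"
    proof
      fix h show "blinfun_apply (D p) h = blinfun_apply (D p) 1 * h"
        using blinfun.scaleR_right[of "D p" h 1] by (metis mult.commute mult.right_neutral real_scaleR_def)
    qed
    show ?thesis unfolding has_field_derivative_def
      by (rule subst[where P="\<lambda>f. (\<phi> has_derivative f) (at p)", OF e D])
  qed
  then have e: "deriv \<phi> = (\<lambda>p. blinfun_apply (D p) 1)" by (intro ext DERIV_imp_deriv)
  show "(\<phi> has_real_derivative deriv \<phi> x) (at x)" using d e by simp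
  show "continuous_on UNIV (deriv \<phi>)" unfolding e by (intro continuous_intros c)
qed

lemma vanish_off_closure:
  assumes "x \<notin> closure {p. \<phi> p \<noteq> 0}"
  shows "\<phi> x = 0"
  using assms closure_subset[of "{p. \<phi> p \<noteq> 0}"] by blast

lemma deriv_off_closure:
  assumes "x \<notin> closure {p :: real. \<phi> p \<noteq> (0::real)}"
  shows "deriv \<phi> x = 0"
proof -
  have "((\<lambda>_. 0) has_real_derivative 0) (at x)" by simp
  then have "(\<phi> has_real_derivative 0) (at x)"
  proof (rule has_field_derivative_transform_within_open)
    show "open (- closure {p. \<phi> p \<noteq> 0})" by (rule open_Compl[OF closed_closure])
    show "x \<in> - closure {p. \<phi> p \<noteq> 0}" using assms by blast
    show "0 = \<phi> y" if "y \<in> - closure {p. \<phi> p \<noteq> 0}" for y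
      using vanish_off_closure[of y \<phi>] that by fastforce
  qed
  then show ?thesis by (rule DERIV_imp_deriv)
qed

lemma loc_integrable_mult_continuous:
  assumes g: "continuous_on UNIV g" and h: "loc_integrable h" "h \<in> borel_measurable borel"
  shows "loc_integrable (\<lambda>z. g z * h z)"
  unfolding loc_integrable_def
proof (intro allI)
  fix x y
  have "compact (g ` {x..y})"
    by (rule compact_continuous_image[OF continuous_on_subset[OF g subset_UNIV] compact_Icc])
  then obtain B where B: "\<And>z. z \<in> {x..y} \<Longrightarrow> \<bar>g z\<bar> \<le> B"
    by (metis bounded_iff compact_imp_bounded imageI real_norm_def)
  have mg: "g \<in> borel_measurable borel" using g by (rule borel_measurable_continuous_onI)
  have "set_integrable lborel {x..y} (\<lambda>z. B * \<bar>h z\<bar>)"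
    using loc_integrableD[OF h(1), of x y] by (auto intro: set_integrable_abs)
  then show "set_integrable lborel {x..y} (\<lambda>z. g z * h z)"
  proof (rule set_integrable_bound)
    show "set_borel_measurable lborel {x..y} (\<lambda>z. g z * h z)"
      unfolding set_borel_measurable_def using mg h(2) by measurable
    show "AE z in lborel. z \<in> {x..y} \<longrightarrow> norm (g z * h z) \<le> norm (B * \<bar>h z\<bar>)"
    proof (intro AE_I2 impI)
      fix z assume "z \<in> {x..y}"
      from B[OF this] have "\<bar>g z\<bar> \<le> \<bar>B\<bar>" by linarith
      then show "norm (g z * h z) \<le> norm (B * \<bar>h z\<bar>)" by (simp add: abs_mult mult_right_mono)
    qed
  qed
qed

text \<open>Polarization reduces the product rule to the chain rule for the square.\<close>

lemma prim_integral_by_parts: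
  assumes v: "loc_integrable v" "v \<in> borel_measurable borel" and \<phi>: "C1_fun \<phi>"
    and "\<phi> a = 0" "\<phi> b = 0" "a \<le> b"
  shows "(LINT z:{a..b}|lborel. (c + prim v z) * deriv \<phi> z) = - (LINT z:{a..b}|lborel. v z * \<phi> z)"
proof -
  define V where "V z = c + prim v z" for z
  define w where "w = deriv \<phi>"
  note \<phi>d = C1_fun_realD[OF \<phi>]
  have cw: "continuous_on UNIV w" unfolding w_def by (rule \<phi>d(2))
  have c\<phi>: "continuous_on UNIV \<phi>" by (rule DERIV_continuous_on[OF \<phi>d(1)])
  have lw: "loc_integrable w" by (rule loc_integrable_continuous[OF cw])
  have \<phi>p: "\<phi> z = \<phi> 0 + prim w z" for z
  proof -
    have "\<forall>y. ((\<lambda>y. \<phi> y - prim w y) has_real_derivative 0) (at y)"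
      using DERIV_diff[OF \<phi>d(1) prim_has_derivative[OF cw]] by (simp add: w_def)
    from DERIV_isconst_all[OF this, of z 0] show ?thesis by simp
  qed
  have cV: "continuous_on UNIV V" unfolding V_def by (intro continuous_intros v)
  have mw: "w \<in> borel_measurable borel" using cw by (rule borel_measurable_continuous_onI)
  have add: "loc_integrable (\<lambda>z. g z + h z)" "loc_integrable (\<lambda>z. g z - h z)"
    if "loc_integrable g" "loc_integrable h" for g h :: "real \<Rightarrow> real"
    using that by (auto simp: loc_integrable_def)
  have sc: "loc_integrable (\<lambda>z. d * g z)" if "loc_integrable g" for g :: "real \<Rightarrow> real" and d
    using that by (auto simp: loc_integrable_def)
  have i1: "loc_integrable (\<lambda>z. V z * w z)" by (rule loc_integrable_mult_continuous[OF cV lw mw])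
  have i2: "loc_integrable (\<lambda>z. \<phi> z * v z)" by (rule loc_integrable_mult_continuous[OF c\<phi> v])
  have pa: "prim (\<lambda>z. v z + w z) z = prim v z + prim w z" "prim (\<lambda>z. v z - w z) z = prim v z - prim w z" for z
    using loc_integrableD[OF v(1)] loc_integrableD[OF lw] by (simp_all add: prim_def)
  have sq: "((\<lambda>x. x\<^sup>2) has_real_derivative 2 * x) (at x)" for x :: real
    by (auto intro!: derivative_eq_intros)
  have sqL: "\<bar>2 * x - 2 * y\<bar> \<le> 2 * \<bar>x - y\<bar>" for x y :: real by (simp add: abs_if)
  have plus: "(V b + \<phi> b)\<^sup>2 - (V a + \<phi> a)\<^sup>2 = (LINT z:{a..b}|lborel. 2 * (V z + \<phi> z) * (v z + w z))"
  proof -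
    have e: "c + \<phi> 0 + prim (\<lambda>z. v z + w z) z = V z + \<phi> z" for z
      using \<phi>p[of z] by (simp add: V_def pa)
    have "loc_integrable (\<lambda>z. 2 * (V z + \<phi> z) * (v z + w z))"
      using cV c\<phi> by (intro loc_integrable_mult_continuous add v lw continuous_intros borel_measurable_add v(2) mw)
    then show ?thesis
      using prim_chain_rule[OF add(1)[OF v(1) lw] sq sqL, of "c + \<phi> 0" a b] \<open>a \<le> b\<close> by (simp add: e)
  qed
  have minus: "(V b - \<phi> b)\<^sup>2 - (V a - \<phi> a)\<^sup>2 = (LINT z:{a..b}|lborel. 2 * (V z - \<phi> z) * (v z - w z))"
  proof -
    have e: "c - \<phi> 0 + prim (\<lambda>z. v z - w z) z = V z - \<phi> z" for z
      using \<phi>p[of z] by (simp add: V_def pa)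
    have "loc_integrable (\<lambda>z. 2 * (V z - \<phi> z) * (v z - w z))"
      using cV c\<phi> by (intro loc_integrable_mult_continuous add v lw continuous_intros borel_measurable_diff v(2) mw)
    then show ?thesis
      using prim_chain_rule[OF add(2)[OF v(1) lw] sq sqL, of "c - \<phi> 0" a b] \<open>a \<le> b\<close> by (simp add: e)
  qed
  have "(LINT z:{a..b}|lborel. 2 * (V z + \<phi> z) * (v z + w z)) - (LINT z:{a..b}|lborel. 2 * (V z - \<phi> z) * (v z - w z))
     = (LINT z:{a..b}|lborel. 2 * (V z + \<phi> z) * (v z + w z) - 2 * (V z - \<phi> z) * (v z - w z))"
    using cV c\<phi>
    by (intro set_integral_diff(2)[symmetric] loc_integrableD loc_integrable_mult_continuous add v lw continuous_intros
        borel_measurable_diff borel_measurable_add v(2) mw)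
  also have "\<dots> = (LINT z:{a..b}|lborel. 4 * (V z * w z) + 4 * (\<phi> z * v z))"
    by (intro set_lebesgue_integral_cong) (auto simp: algebra_simps)
  also have "\<dots> = 4 * (LINT z:{a..b}|lborel. V z * w z) + 4 * (LINT z:{a..b}|lborel. \<phi> z * v z)"
    using loc_integrableD[OF i1, of a b] loc_integrableD[OF i2, of a b] by simp
  finally show ?thesis
    using plus minus \<open>\<phi> a = 0\<close> \<open>\<phi> b = 0\<close> by (simp add: V_def w_def mult.commute)
qed

lemma test_function_integral_restrict:
  fixes g h :: "real \<Rightarrow> real"
  assumes "closure {p. \<phi> p \<noteq> (0::real)} \<subseteq> S" "closure {p. \<phi> p \<noteq> 0} \<subseteq> T"
    and "\<And>x. x \<in> S \<Longrightarrow> x \<in> T \<Longrightarrow> g x = h x"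
  shows "(LINT x:S|lborel. g x * deriv \<phi> x) = (LINT x:T|lborel. h x * deriv \<phi> x)"
    and "(LINT x:S|lborel. g x * \<phi> x) = (LINT x:T|lborel. h x * \<phi> x)"
proof -
  have "indicator S x *\<^sub>R (g x * deriv \<phi> x) = indicator T x *\<^sub>R (h x * deriv \<phi> x)" for x
    by (cases "x \<in> closure {p. \<phi> p \<noteq> 0}") (use assms deriv_off_closure[of x \<phi>] in \<open>auto simp: subset_iff\<close>)
  then show "(LINT x:S|lborel. g x * deriv \<phi> x) = (LINT x:T|lborel. h x * deriv \<phi> x)"
    by (simp only: set_lebesgue_integral_def)
  have "indicator S x *\<^sub>R (g x * \<phi> x) = indicator T x *\<^sub>R (h x * \<phi> x)" for x
    by (cases "x \<in> closure {p. \<phi> p \<noteq> 0}") (use assms vanish_off_closure[of x \<phi>] in \<open>auto simp: subset_iff\<close>)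
  then show "(LINT x:S|lborel. g x * \<phi> x) = (LINT x:T|lborel. h x * \<phi> x)"
    by (simp only: set_lebesgue_integral_def)
qed

lemma compact_real_subset_Icc:
  assumes "compact (K :: real set)"
  obtains B where "0 \<le> B" "K \<subseteq> {-B..B}"
proof -
  obtain B where "\<forall>x\<in>K. norm x \<le> B" using compact_imp_bounded[OF assms] by (auto simp: bounded_iff)
  then have "K \<subseteq> {-\<bar>B\<bar>..\<bar>B\<bar>}" by fastforce
  then show ?thesis using that[of "\<bar>B\<bar>"] by simp
qed

lemma weak_derivative_prim:
  assumes v: "loc_integrable v" "v \<in> borel_measurable borel"
    and g: "\<And>x. x \<in> S \<Longrightarrow> g x = c + prim v x"
  shows "weak_derivative_on S g v"
  unfolding weak_derivative_on_def locally_integrable_on_def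
proof (intro conjI allI ballI impI; (elim conjE)?)
  fix K :: "real set" assume K: "compact K" "K \<subseteq> S"
  obtain B where B: "0 \<le> B" "K \<subseteq> {-B..B}" using compact_real_subset_Icc[OF K(1)] .
  have sK: "K \<in> sets lborel" using K(1) by (simp add: borel_compact)
  have "loc_integrable (\<lambda>x. c + prim v x)"
    by (rule loc_integrable_continuous) (intro continuous_intros v)
  then have "set_integrable lborel K (\<lambda>x. c + prim v x)"
    by (intro set_integrable_subset[OF loc_integrableD[of _ "-B" B]] sK B)
  moreover have "set_integrable lborel K g = set_integrable lborel K (\<lambda>x. c + prim v x)"
    by (rule set_integrable_cong) (use g K(2) in blast)+
  ultimately show "set_integrable lborel K g" by simp
  show "set_integrable lborel K v"
    by (intro set_integrable_subset[OF loc_integrableD[OF v(1), of "-B" B]] sK B)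
next
  fix \<phi> assume "\<phi> \<in> C1c S"
  then have \<phi>: "C1_fun \<phi>" "compact (closure {p. \<phi> p \<noteq> 0})" "closure {p. \<phi> p \<noteq> 0} \<subseteq> S"
    by (auto simp: C1c_def)
  obtain B where B: "0 \<le> B" "closure {p. \<phi> p \<noteq> 0} \<subseteq> {-B..B}"
    using compact_real_subset_Icc[OF \<phi>(2)] .
  \<comment> \<open>Enlarged by 1 because the support may reach the end points of
    \<open>{-B..B}\<close>, and integration by parts needs \<open>\<phi>\<close> to vanish at the
    ends.\<close>
  have T: "closure {p. \<phi> p \<noteq> 0} \<subseteq> {-B-1..B+1}" using B(2) by fastforce
  have z: "\<phi> (-B-1) = 0" "\<phi> (B+1) = 0"
    by (rule vanish_off_closure; use B in fastforce)+
  have "(LINT x:S|lborel. g x * deriv \<phi> x) = (LINT x:{-B-1..B+1}|lborel. (c + prim v x) * deriv \<phi> x)"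
    by (rule test_function_integral_restrict(1)[OF \<phi>(3) T g])
  also have "\<dots> = - (LINT x:{-B-1..B+1}|lborel. v x * \<phi> x)"
    by (rule prim_integral_by_parts[OF v \<phi>(1) z]) (use B in simp)
  also have "(LINT x:{-B-1..B+1}|lborel. v x * \<phi> x) = (LINT x:S|lborel. v x * \<phi> x)"
    by (rule test_function_integral_restrict(2)[OF T \<phi>(3) refl])
  finally show "(LINT x:S|lborel. g x * deriv \<phi> x) = - (LINT x:S|lborel. v x * \<phi> x)" .
qed

section \<open>Sobolev functions as primitives\<close>

text \<open>With \<open>w = g - prim v\<close> and a cutoff \<open>\<kappa>\<close>, testing against the primitive of \<open>(w - c) \<kappa>\<close>, where \<open>c\<close> is the
  \<open>\<kappa>\<close>-mean of \<open>w\<close>, gives \<open>\<integral> (w - c)\<^sup>2 \<kappa> = 0\<close>.\<close>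

lemma weak_derivative_FTC:
  assumes wd: "weak_derivative_on {a<..<b} g v" and cg: "continuous_on {a<..<b} g"
    and xy: "a < x" "x \<le> y" "y < b"
  shows "g y - g x = (LINT z:{x..y}|lborel. v z)"
proof -
  \<comment> \<open>The weak derivative is integrable only on compact subsets of the open interval,
    so the argument runs on an intermediate closed one.\<close>
  define a' where "a' = (a + x) / 2"
  define b' where "b' = (y + b) / 2"
  have ab: "a < a'" "a' < x" "y < b'" "b' < b" using xy by (auto simp: a'_def b'_def)
  then have ab': "a' < b'" "a' \<le> b'" using xy by auto
  have sub: "{a'..b'} \<subseteq> {a<..<b}" using ab by auto
  define v1 where "v1 z = indicator {a'..b'} z *\<^sub>R v z" for z
  have iv1: "integrable lborel v1"
    using wd sub unfolding weak_derivative_on_def locally_integrable_on_def v1_def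
    by (simp add: set_integrable_def)
  have v1: "loc_integrable v1" "v1 \<in> borel_measurable borel"
    using iv1 borel_measurable_integrable[OF iv1] integrable_mult_indicator[OF _ iv1]
    by (auto simp: loc_integrable_def set_integrable_def)
  \<comment> \<open>Clamping to \<open>{a'..b'}\<close> extends \<open>w\<close> to a continuous
    function on the line, as the facts about \<open>prim\<close> require.\<close>
  define cl where "cl z = max a' (min b' z)" for z
  define w where "w z = g (cl z) - prim v1 (cl z)" for z
  have clc: "continuous_on UNIV cl" unfolding cl_def by (intro continuous_intros)
  have clI: "cl z \<in> {a'..b'}" for z using ab' by (auto simp: cl_def)
  have cle: "cl z = z" if "z \<in> {a'..b'}" for z using that by (auto simp: cl_def)
  have cw: "continuous_on UNIV w"
    unfolding w_def
    by (intro continuous_on_diff continuous_on_compose2[OF cg clc] continuous_on_compose2[OF prim_continuous[OF v1(1)] clc])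
       (use clI sub in blast)+
  define \<kappa> where "\<kappa> z = max 0 (z - a') * max 0 (b' - z)" for z
  have c\<kappa>: "continuous_on UNIV \<kappa>" unfolding \<kappa>_def by (intro continuous_intros)
  have \<kappa>0: "0 \<le> \<kappa> z" for z by (simp add: \<kappa>_def)
  have \<kappa>p: "0 < \<kappa> z" if "z \<in> {a'<..<b'}" for z using that by (simp add: \<kappa>_def)
  have \<kappa>out: "\<kappa> z = 0" if "z \<notin> {a'<..<b'}" for z using that by (auto simp: \<kappa>_def)
  have l\<kappa>: "loc_integrable \<kappa>" by (rule loc_integrable_continuous[OF c\<kappa>])
  have cw\<kappa>: "continuous_on UNIV (\<lambda>z. w z * \<kappa> z)" by (intro continuous_intros cw c\<kappa>)
  have lw\<kappa>: "loc_integrable (\<lambda>z. w z * \<kappa> z)" by (rule loc_integrable_continuous[OF cw\<kappa>])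
  define J where "J = (LINT z:{a'..b'}|lborel. \<kappa> z)"
  have J: "J \<noteq> 0"
  proof
    assume "J = 0"
    moreover have "J = integral {a'..b'} \<kappa>"
      unfolding J_def by (rule set_borel_integral_eq_integral(2)[OF loc_integrableD[OF l\<kappa>]])
    ultimately have "\<forall>z\<in>{a'..b'}. \<kappa> z = 0"
      using integral_eq_0_iff[OF continuous_on_subset[OF c\<kappa> subset_UNIV] ab'(1) \<kappa>0] by simp
    moreover have "(a' + b') / 2 \<in> {a'<..<b'}" using ab' by auto
    ultimately show False using \<kappa>p[of "(a' + b') / 2"] by force
  qed
  define c where "c = (LINT z:{a'..b'}|lborel. w z * \<kappa> z) / J"
  define \<psi> where "\<psi> z = (w z - c) * \<kappa> z" for z
  have c\<psi>: "continuous_on UNIV \<psi>" unfolding \<psi>_def by (intro continuous_intros cw c\<kappa>)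
  have l\<psi>: "loc_integrable \<psi>" by (rule loc_integrable_continuous[OF c\<psi>])
  have \<psi>out: "\<psi> z = 0" if "z \<notin> {a'<..<b'}" for z using \<kappa>out[OF that] by (simp add: \<psi>_def)
  have \<psi>0: "(LINT z:{a'..b'}|lborel. \<psi> z) = 0"
  proof -
    have "(LINT z:{a'..b'}|lborel. \<psi> z) = (LINT z:{a'..b'}|lborel. w z * \<kappa> z - c * \<kappa> z)"
      by (simp add: \<psi>_def left_diff_distrib)
    also have "\<dots> = (LINT z:{a'..b'}|lborel. w z * \<kappa> z) - c * J"
      using loc_integrableD[OF lw\<kappa>, of a' b'] loc_integrableD[OF l\<kappa>, of a' b'] by (simp add: J_def)
    finally show ?thesis using J by (simp add: c_def)
  qed
  define \<phi> where "\<phi> z = prim \<psi> z - prim \<psi> a'" for z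
  have \<phi>d: "(\<phi> has_real_derivative \<psi> z) (at z)" for z
    using DERIV_diff[OF prim_has_derivative[OF c\<psi>] DERIV_const[of "prim \<psi> a'"], of z]
    by (simp add: \<phi>_def[abs_def])
  have d\<phi>: "deriv \<phi> = \<psi>" using \<phi>d by (intro ext DERIV_imp_deriv)
  have C1\<phi>: "C1_fun \<phi>" by (rule C1_fun_realI[OF \<phi>d c\<psi>])
  have flat: "prim \<psi> t = prim \<psi> s" if "s \<le> t" "\<And>z. z \<in> {s..t} \<Longrightarrow> \<psi> z = 0" for s t
  proof -
    have "(LINT z:{s..t}|lborel. \<psi> z) = (LINT z:{s..t}|lborel. 0)"
      by (rule set_lebesgue_integral_cong) (use that in auto)
    then show ?thesis using prim_diff[OF l\<psi> that(1)] by simp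
  qed
  have \<phi>b: "\<phi> b' = 0" using prim_diff[OF l\<psi> ab'(2)] \<psi>0 by (simp add: \<phi>_def)
  have \<phi>a: "\<phi> a' = 0" by (simp add: \<phi>_def)
  have \<phi>out: "\<phi> z = 0" if "z \<notin> {a'..b'}" for z
  proof (cases "z < a'")
    case True
    then have "prim \<psi> a' = prim \<psi> z" by (intro flat \<psi>out) auto
    then show ?thesis by (simp add: \<phi>_def)
  next
    case False
    with that have "b' \<le> z" by auto
    then have "prim \<psi> z = prim \<psi> b'" by (intro flat \<psi>out) auto
    then show ?thesis using \<phi>b by (simp add: \<phi>_def)
  qed
  have supp: "closure {p. \<phi> p \<noteq> 0} \<subseteq> {a'..b'}"
    by (rule closure_minimal) (use \<phi>out in \<open>blast, simp\<close>)
  then have "compact (closure {p. \<phi> p \<noteq> 0})"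
    by (meson bounded_closed_interval bounded_subset closed_closure compact_eq_bounded_closed)
  then have "\<phi> \<in> C1c {a<..<b}" using C1\<phi> supp sub by (auto simp: C1c_def)
  then have e: "(LINT z:{a<..<b}|lborel. g z * deriv \<phi> z) = - (LINT z:{a<..<b}|lborel. v z * \<phi> z)"
    using wd by (simp add: weak_derivative_on_def)
  have e1: "(LINT z:{a<..<b}|lborel. g z * deriv \<phi> z) = (LINT z:{a'..b'}|lborel. (w z + prim v1 z) * \<psi> z)"
    using test_function_integral_restrict(1)[of \<phi> "{a<..<b}" "{a'..b'}" g "\<lambda>z. w z + prim v1 z"] supp sub
    by (auto simp: d\<phi> w_def cle)
  have e2: "(LINT z:{a<..<b}|lborel. v z * \<phi> z) = (LINT z:{a'..b'}|lborel. v1 z * \<phi> z)"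
    using test_function_integral_restrict(2)[of \<phi> "{a<..<b}" "{a'..b'}" v v1] supp sub
    by (auto simp: v1_def)
  have e3: "(LINT z:{a'..b'}|lborel. prim v1 z * \<psi> z) = - (LINT z:{a'..b'}|lborel. v1 z * \<phi> z)"
    using prim_integral_by_parts[OF v1 C1\<phi> \<phi>a \<phi>b ab'(2), of 0] by (simp add: d\<phi>)
  have cwp: "continuous_on UNIV (\<lambda>z. w z * \<psi> z)" "continuous_on UNIV (\<lambda>z. prim v1 z * \<psi> z)"
    by (intro continuous_intros cw c\<psi> v1)+
  have lwp: "loc_integrable (\<lambda>z. w z * \<psi> z)" "loc_integrable (\<lambda>z. prim v1 z * \<psi> z)"
    by (intro loc_integrable_continuous cwp)+
  have "(LINT z:{a'..b'}|lborel. (w z + prim v1 z) * \<psi> z)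
     = (LINT z:{a'..b'}|lborel. w z * \<psi> z) + (LINT z:{a'..b'}|lborel. prim v1 z * \<psi> z)"
    using loc_integrableD[OF lwp(1), of a' b'] loc_integrableD[OF lwp(2), of a' b'] by (simp add: distrib_right)
  then have wp0: "(LINT z:{a'..b'}|lborel. w z * \<psi> z) = 0" using e e1 e2 e3 by simp
  define h where "h z = (w z - c)\<^sup>2 * \<kappa> z" for z
  have ch: "continuous_on UNIV h" unfolding h_def by (intro continuous_intros cw c\<kappa>)
  have "(LINT z:{a'..b'}|lborel. h z) = (LINT z:{a'..b'}|lborel. w z * \<psi> z - c * \<psi> z)"
    by (simp add: h_def \<psi>_def power2_eq_square algebra_simps)
  also have "\<dots> = 0"
    using loc_integrableD[OF lwp(1), of a' b'] loc_integrableD[OF l\<psi>, of a' b'] wp0 \<psi>0 by simp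
  finally have "integral {a'..b'} h = 0"
    using set_borel_integral_eq_integral(2)[OF loc_integrableD[OF loc_integrable_continuous[OF ch]], of a' b'] by simp
  moreover have "0 \<le> h z" for z using \<kappa>0 by (simp add: h_def)
  ultimately have h0: "h z = 0" if "z \<in> {a'..b'}" for z
    using integral_eq_0_iff[OF continuous_on_subset[OF ch subset_UNIV] ab'(1)] that by simp
  have "w z = c" if "z \<in> {a'<..<b'}" for z
    using h0[of z] \<kappa>p[OF that] that by (auto simp: h_def)
  then have "w y = w x" using ab xy by auto
  then have "g y - g x = prim v1 y - prim v1 x" using ab xy by (simp add: w_def cle)
  also have "\<dots> = (LINT z:{x..y}|lborel. v1 z)" by (rule prim_diff[OF v1(1) xy(2)])
  also have "\<dots> = (LINT z:{x..y}|lborel. v z)"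
    by (rule set_lebesgue_integral_cong) (use ab xy in \<open>auto simp: v1_def\<close>)
  finally show ?thesis .
qed

lemma powr_ge_self:
  assumes "1 \<le> p" shows "\<bar>x\<bar> \<le> 1 + \<bar>x :: real\<bar> powr p"
proof (cases "\<bar>x\<bar> \<le> 1")
  case False
  then have "\<bar>x\<bar> powr 1 \<le> \<bar>x\<bar> powr p" using assms by (intro powr_mono) auto
  then show ?thesis by simp
next
  case True
  moreover have "0 \<le> \<bar>x\<bar> powr p" by simp
  ultimately show ?thesis by linarith
qed

text \<open>The Sobolev condition yields a separate derivative on each interval. Gluing those of the
  unit intervals between consecutive integers means that no two of them have to be compared on an
  overlap; the integers form a null set. The difference of \<open>g\<close> and
  \<open>prim v\<close> is then constant on each open unit interval, and continuity of
  \<open>g\<close> joins these constants.\<close>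

lemma sobolev_W1_loc_prim:
  assumes p: "1 \<le> p" and g: "sobolev_W1_loc p g"
  obtains v where "v \<in> borel_measurable borel" "loc_integrable v"
    "loc_integrable (\<lambda>x. \<bar>v x\<bar> powr p)" "\<And>x. 0 \<le> x \<Longrightarrow> g x = g 0 + prim v x"
proof -
  have cg: "continuous_on {0..} g" using g by (simp add: sobolev_W1_loc_def)
  have "\<exists>v. Lp_on p {real n<..<real n + 1} v \<and> weak_derivative_on {real n<..<real n + 1} g v" for n :: nat
    using g unfolding sobolev_W1_loc_def sobolev_W1_def by (metis less_add_one of_nat_0_le_iff)
  then obtain V where V: "\<And>n. Lp_on p {real n<..<real n + 1} (V n)"
      "\<And>n. weak_derivative_on {real n<..<real n + 1} g (V n)" by metis
  define V1 where "V1 n x = indicator {real n<..<real n + 1} x *\<^sub>R V n x" for n x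
  have mV1: "V1 n \<in> borel_measurable borel" for n
    using V(1)[of n] by (simp add: Lp_on_def set_borel_measurable_def V1_def[abs_def])
  have iV1p: "integrable lborel (\<lambda>x. \<bar>V1 n x\<bar> powr p)" for n
  proof -
    have "(\<lambda>x. \<bar>V1 n x\<bar> powr p) = (\<lambda>x. indicator {real n<..<real n + 1} x *\<^sub>R \<bar>V n x\<bar> powr p)"
      by (auto simp: V1_def indicator_def)
    then show ?thesis using V(1)[of n] by (simp add: Lp_on_def set_integrable_def)
  qed
  \<comment> \<open>Zero on the negative axis, which lies outside the domain of \<open>g\<close>; so
    \<open>v\<close> is locally integrable on the whole line.\<close>
  define v where "v x = (if x < 0 then 0 else V1 (nat \<lfloor>x\<rfloor>) x)" for x
  have v_eq: "v x = V1 n x" if "x \<in> {real n<..<real n + 1}" for x n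
  proof -
    have "\<lfloor>x\<rfloor> = int n" using that by (intro floor_unique) auto
    then show ?thesis using that by (simp add: v_def)
  qed
  have mv: "v \<in> borel_measurable borel"
  proof -
    have "(\<lambda>x. V1 (nat \<lfloor>x\<rfloor>) x) \<in> borel_measurable borel"
      by (rule measurable_compose_countable[where f=V1]) (use mV1 in measurable)
    then show ?thesis unfolding v_def by measurable
  qed
  have ae: "AE x in lborel. indicator {real n..real n + 1} x *\<^sub>R \<bar>v x\<bar> powr p = \<bar>V1 n x\<bar> powr p" for n
    using AE_lborel_singleton[of "real n"] AE_lborel_singleton[of "real n + 1"]
  proof eventually_elim
    case (elim x)
    show ?case
    proof (cases "x \<in> {real n<..<real n + 1}")
      case True then show ?thesis using v_eq[of x n] by (simp add: indicator_def)
    next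
      case False then show ?thesis using elim by (auto simp: V1_def indicator_def)
    qed
  qed
  have i1: "set_integrable lborel {real n..real n + 1} (\<lambda>x. \<bar>v x\<bar> powr p)" for n
    unfolding set_integrable_def
    by (subst integrable_cong_AE[OF _ _ ae]) (use mv mV1 iV1p in auto)
  have i2: "set_integrable lborel {0..real n} (\<lambda>x. \<bar>v x\<bar> powr p)" for n
  proof (induction n)
    case 0
    have "AE x in lborel. indicator {0..real 0} x *\<^sub>R \<bar>v x\<bar> powr p = 0"
      using AE_lborel_singleton[of 0] by eventually_elim (auto simp: indicator_def)
    then show ?case unfolding set_integrable_def
      by (subst integrable_cong_AE[where g="\<lambda>_. 0"]) (use mv in auto)
  next
    case (Suc n)
    have "{0..real (Suc n)} = {0..real n} \<union> {real n..real n + 1}" by auto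
    then show ?case using set_integrable_Un[OF Suc i1[of n]] by simp
  qed
  have lvp: "loc_integrable (\<lambda>x. \<bar>v x\<bar> powr p)"
    unfolding loc_integrable_def
  proof (intro allI)
    fix a b :: real
    obtain n where n: "b \<le> real n" using real_arch_simple by blast
    have z: "set_integrable lborel {..<0::real} (\<lambda>x. \<bar>v x\<bar> powr p)"
    proof -
      have "(\<lambda>x. indicator {..<0} x *\<^sub>R \<bar>v x\<bar> powr p) = (\<lambda>x. 0)"
        by (auto simp: v_def indicator_def)
      then show ?thesis by (simp add: set_integrable_def)
    qed
    show "set_integrable lborel {a..b} (\<lambda>x. \<bar>v x\<bar> powr p)"
      by (rule set_integrable_subset[OF set_integrable_Un[OF z i2[of n]]]) (use n in auto)
  qed
  have lv: "loc_integrable v"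
  proof (rule loc_integrable_bound[where g="\<lambda>x. 1 + \<bar>v x\<bar> powr p"])
    show "loc_integrable (\<lambda>x. 1 + \<bar>v x\<bar> powr p)"
      using lvp loc_integrable_continuous[of "\<lambda>_. 1"] by (auto simp: loc_integrable_def)
  qed (use mv powr_ge_self[OF p] in auto)
  define d where "d x = g x - prim v x" for x
  have cd: "continuous_on {0..} d"
    unfolding d_def by (intro continuous_on_diff cg continuous_on_subset[OF prim_continuous[OF lv]]) auto
  have step: "d x = d (real n)" if x: "x \<in> {real n..real n + 1}" for x n
  proof -
    define m where "m = real n + 1 / 2"
    have cst: "d y = d m" if "y \<in> {real n<..<real n + 1}" for y
    proof -
      have gg: "g t - g s = prim v t - prim v s" if "real n < s" "s \<le> t" "t < real n + 1" for s t
      proof -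
        have "g t - g s = (LINT z:{s..t}|lborel. V n z)"
          by (rule weak_derivative_FTC[OF V(2) continuous_on_subset[OF cg] that]) auto
        also have "\<dots> = (LINT z:{s..t}|lborel. v z)"
          by (rule set_lebesgue_integral_cong) (use that v_eq[of _ n] in \<open>auto simp: V1_def\<close>)
        finally show ?thesis using prim_diff[OF lv that(2)] by simp
      qed
      show ?thesis
        using gg[of y m] gg[of m y] that by (cases "y \<le> m") (auto simp: d_def m_def)
    qed
    have "closure {real n<..<real n + 1} = {real n..real n + 1}" by simp
    then have cl: "d y = d m" if "y \<in> {real n..real n + 1}" for y
      using continuous_constant_on_closure[of "{real n<..<real n + 1}" d "d m" y] cst that
        continuous_on_subset[OF cd, of "{real n..real n + 1}"] by auto
    show ?thesis using cl[OF x] cl[of "real n"] by simp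
  qed
  have dn: "d (real n) = d 0" for n
  proof (induction n)
    case (Suc n) then show ?case using step[of "real (Suc n)" n] by simp
  qed simp
  have "g x = g 0 + prim v x" if "0 \<le> x" for x
  proof -
    have "x \<in> {real (nat \<lfloor>x\<rfloor>)..real (nat \<lfloor>x\<rfloor>) + 1}" 
      using that floor_correct[of x] by (simp add: less_imp_le)
    from step[OF this] have "d x = d 0" using dn by simp
    then show ?thesis by (simp add: d_def)
  qed
  then show ?thesis using that mv lv lvp by blast
qed

section \<open>Limits and algebra of oriented integrals\<close>

lemma set_integral_tendsto:
  fixes h :: "nat \<Rightarrow> real \<Rightarrow> real"
  assumes mh: "\<And>n. h n \<in> borel_measurable borel" and mh': "h' \<in> borel_measurable borel"
    and lim: "\<And>z. (\<lambda>n. h n z) \<longlonglongrightarrow> h' z" and w: "set_integrable lborel {a..b} w"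
    and b: "\<And>n z. z \<in> {a..b} \<Longrightarrow> \<bar>h n z\<bar> \<le> w z"
  shows "(\<lambda>n. LINT z:{a..b}|lborel. h n z) \<longlonglongrightarrow> (LINT z:{a..b}|lborel. h' z)"
  unfolding set_lebesgue_integral_def
proof (rule integral_dominated_convergence[where w="\<lambda>z. indicator {a..b} z *\<^sub>R w z"])
  show "(\<lambda>z. indicator {a..b} z *\<^sub>R h' z) \<in> borel_measurable lborel" using mh' by measurable
  show "(\<lambda>z. indicator {a..b} z *\<^sub>R h n z) \<in> borel_measurable lborel" for n using mh[of n] by measurable
  show "integrable lborel (\<lambda>z. indicator {a..b} z *\<^sub>R w z)" using w by (simp add: set_integrable_def)
  show "AE z in lborel. (\<lambda>n. indicator {a..b} z *\<^sub>R h n z) \<longlonglongrightarrow> indicator {a..b} z *\<^sub>R h' z"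
    by (intro AE_I2 tendsto_intros lim)
  show "AE z in lborel. norm (indicator {a..b} z *\<^sub>R h n z) \<le> indicator {a..b} z *\<^sub>R w z" for n
    using b[of _ n] by (intro AE_I2) (auto simp: indicator_def)
qed

lemma prim_tendsto:
  fixes h :: "nat \<Rightarrow> real \<Rightarrow> real"
  assumes "\<And>n. h n \<in> borel_measurable borel" "h' \<in> borel_measurable borel"
    and "\<And>z. (\<lambda>n. h n z) \<longlonglongrightarrow> h' z" and w: "loc_integrable w"
    and "\<And>n z. \<bar>h n z\<bar> \<le> w z"
  shows "(\<lambda>n. prim (h n) s) \<longlonglongrightarrow> prim h' s"
  unfolding prim_def
  by (intro tendsto_diff set_integral_tendsto[OF assms(1-3) loc_integrableD[OF w] assms(5)])

lemma prim_sub: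
  assumes "loc_integrable g" "loc_integrable h"
  shows "prim (\<lambda>z. g z - h z) s = prim g s - prim h s"
  using loc_integrableD[OF assms(1)] loc_integrableD[OF assms(2)] by (simp add: prim_def)

lemma prim_scale: "prim (\<lambda>z. c * g z) s = c * prim g s"
  by (simp add: prim_def right_diff_distrib)

lemma loc_integrable_scale: "loc_integrable g \<Longrightarrow> loc_integrable (\<lambda>z. c * g z)"
  by (auto simp: loc_integrable_def)

lemma prim_zero_left:
  assumes h: "loc_integrable h" and "\<And>z. z \<le> 0 \<Longrightarrow> h z = 0" "s \<le> 0"
  shows "prim h s = 0"
proof -
  have "(LINT z:{s..0}|lborel. h z) = (LINT z:{s..0}|lborel. 0)"
    by (rule set_lebesgue_integral_cong) (use assms in auto)
  then show ?thesis using prim_diff[OF h \<open>s \<le> 0\<close>] by simp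
qed

lemma prim_const: "prim (\<lambda>_. c) t = c * t"
proof -
  have l: "loc_integrable (\<lambda>_. c)" by (rule loc_integrable_continuous) (rule continuous_on_const)
  show ?thesis
    using prim_eq_integral[OF l, of 0 t] prim_eq_integral[OF l, of t 0] by (cases "0 \<le> t") auto
qed

section \<open>The characteristic system\<close>

text \<open>\<open>F\<close> and \<open>G\<close> stand for \<open>f'\<close> and \<open>f''\<close>. The label \<open>s\<close> carries the initial length density \<open>p s powr r\<close> and, where
  \<open>p s > 0\<close>, the initial slope \<open>k s / p s\<close>; labels with \<open>p s = 0\<close> carry a singular part of the initial energy. Nonpositive
  labels are an extension of the half-line on which the solution vanishes. They provide the characteristics
  entering through \<open>x = 0\<close>, and make all maps from labels to points surjective onto the real line. Below,
  \<open>mA (A t s) s\<close> is the quantity \<open>M\<close>, with \<open>A t s\<close> the integral of \<open>G (U \<tau> s)\<close> over \<open>\<tau>\<close> from \<open>0\<close> to \<open>t\<close>.\<close>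

locale char_data =
  fixes r C L :: real and F G p k :: "real \<Rightarrow> real"
  assumes r: "2 \<le> r"
    and FG: "\<And>x. (F has_real_derivative G x) (at x)"
    and GC: "\<And>x. \<bar>G x\<bar> \<le> C"
    and GL: "\<And>x y. \<bar>G x - G y\<bar> \<le> L * \<bar>x - y\<bar>"
    and pm [measurable]: "p \<in> borel_measurable borel"
    and km [measurable]: "k \<in> borel_measurable borel"
    and p0: "\<And>s. 0 \<le> p s"
    and pk: "\<And>s. 0 < p s + \<bar>k s\<bar>"
    and neg: "\<And>s. s \<le> 0 \<Longrightarrow> p s = 1" "\<And>s. s \<le> 0 \<Longrightarrow> k s = 0"
    and wint: "loc_integrable (\<lambda>s. (p s + \<bar>k s\<bar>) powr r)"
begin

lemma C0: "0 \<le> C" using GC[of 0] abs_ge_zero[of "G 0"] by linarith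
lemma L0: "0 \<le> L" using GL[of 1 0] abs_ge_zero[of "G 1 - G 0"] by simp

lemma G_cont: "continuous_on S G"
proof -
  have "L-lipschitz_on UNIV G" by (rule lipschitz_onI) (use GL L0 in \<open>auto simp: dist_real_def\<close>)
  then show ?thesis by (rule continuous_on_subset[OF lipschitz_on_continuous_on]) simp
qed

lemma G_borel [measurable]: "G \<in> borel_measurable borel"
  by (rule borel_measurable_continuous_onI[OF G_cont])

text \<open>The common weight: it dominates the energy density |k|^r and, up to the factor
  \<open>cT T\<close>, the length density and the density of U at all times of absolute value at
  most \<open>T\<close>. Increments in the label are measured by its primitive
  \<open>Wp\<close>.\<close>

definition w :: "real \<Rightarrow> real" where "w s = (p s + \<bar>k s\<bar>) powr r"
definition Wp :: "real \<Rightarrow> real" where "Wp = prim w"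
definition cT :: "real \<Rightarrow> real" where "cT T = (1 + C * T) powr r"
definition mA :: "real \<Rightarrow> real \<Rightarrow> real" where "mA A s = p s + k s / r * A"
text \<open>The density dU/ds as a function of the accumulated value \<open>A\<close> of
  \<open>G\<close> along the label.\<close>

definition hA :: "real \<Rightarrow> real \<Rightarrow> real" where "hA A s = k s * spow (r - 1) (mA A s)"

lemma lw: "loc_integrable w" using wint by (simp add: w_def[abs_def])
lemma w0: "0 \<le> w s" by (simp add: w_def)
lemma Wp_mono: "a \<le> b \<Longrightarrow> Wp a \<le> Wp b" unfolding Wp_def by (rule prim_mono[OF lw w0])
lemma Wp_cont: "continuous_on S Wp"
  unfolding Wp_def by (rule continuous_on_subset[OF prim_continuous[OF lw]]) simp
lemma Wp_0 [simp]: "Wp 0 = 0" by (simp add: Wp_def)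
lemma cT1: "0 \<le> T \<Longrightarrow> 1 \<le> cT T" using C0 r unfolding cT_def by (intro ge_one_powr_ge_zero) auto

lemma cT0: "0 \<le> cT T" by (simp add: cT_def)

section \<open>Bounds by the weight\<close>

lemma mA_bound:
  assumes "\<bar>A\<bar> \<le> C * T" "0 \<le> T"
  shows "\<bar>mA A s\<bar> \<le> (1 + C * T) * (p s + \<bar>k s\<bar>)"
proof -
  have "\<bar>k s / r * A\<bar> \<le> \<bar>k s\<bar> * (C * T)"
    unfolding abs_mult
  proof (intro mult_mono assms(1))
    have "\<bar>k s\<bar> * 1 \<le> \<bar>k s\<bar> * r" using r by (intro mult_left_mono) auto
    then show "\<bar>k s / r\<bar> \<le> \<bar>k s\<bar>" using r by (simp add: field_simps)
  qed auto
  moreover have "0 \<le> C * T" using C0 assms(2) by simp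
  ultimately have "\<bar>mA A s\<bar> \<le> p s + \<bar>k s\<bar> * (C * T)"
    using p0[of s] unfolding mA_def by (simp only: abs_le_iff) linarith
  also have "\<dots> \<le> (1 + C * T) * (p s + \<bar>k s\<bar>)"
    using mult_nonneg_nonneg[OF \<open>0 \<le> C * T\<close> p0[of s]] by (simp add: algebra_simps)
  finally show ?thesis .
qed

text \<open>All densities are homogeneous of degree \<open>r\<close> in \<open>p\<close> and
  \<open>k\<close>: the factor \<open>x\<close> accounts for \<open>j\<close> powers and the power
  of the bound on \<open>mA\<close> for the remaining \<open>a\<close>. It is applied with
  \<open>j = 0\<close> to the length density, \<open>j = 1\<close> to the density of U, and
  \<open>j = 2\<close> to the dependence of the latter on \<open>A\<close>.\<close>

lemma base_bound:
  assumes "0 \<le> T" "0 \<le> a" "0 \<le> j" "a + j = r" "x \<le> (p s + \<bar>k s\<bar>) powr j"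
  shows "x * ((1 + C * T) * (p s + \<bar>k s\<bar>)) powr a \<le> cT T * w s"
proof -
  have e: "((1 + C * T) * (p s + \<bar>k s\<bar>)) powr a = (1 + C * T) powr a * (p s + \<bar>k s\<bar>) powr a"
    using C0 assms(1) pk[of s] by (simp add: powr_mult)
  have "x * (p s + \<bar>k s\<bar>) powr a \<le> (p s + \<bar>k s\<bar>) powr j * (p s + \<bar>k s\<bar>) powr a"
    by (intro mult_right_mono assms) simp
  also have "\<dots> = (p s + \<bar>k s\<bar>) powr (a + j)" by (simp add: powr_add)
  also have "\<dots> = w s" by (simp add: w_def assms)
  finally have "x * (p s + \<bar>k s\<bar>) powr a \<le> w s" .
  moreover have "(1 + C * T) powr a \<le> cT T"
    unfolding cT_def by (rule powr_mono) (use assms C0 in auto)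
  ultimately have "(1 + C * T) powr a * (x * (p s + \<bar>k s\<bar>) powr a) \<le> (1 + C * T) powr a * w s"
    and "(1 + C * T) powr a * w s \<le> cT T * w s"
    using w0 by (auto intro: mult_left_mono mult_right_mono)
  then show ?thesis unfolding e by (simp add: mult_ac)
qed

lemma hA_bound:
  assumes "\<bar>A\<bar> \<le> C * T" "0 \<le> T"
  shows "\<bar>hA A s\<bar> \<le> cT T * w s"
proof -
  have "\<bar>mA A s\<bar> powr (r - 1) \<le> ((1 + C * T) * (p s + \<bar>k s\<bar>)) powr (r - 1)"
    using mA_bound[OF assms] r by (intro powr_mono2) auto
  then have "\<bar>hA A s\<bar> \<le> \<bar>k s\<bar> * ((1 + C * T) * (p s + \<bar>k s\<bar>)) powr (r - 1)"
    unfolding hA_def abs_mult abs_spow by (intro mult_left_mono) auto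
  also have "\<dots> \<le> cT T * w s"
    by (rule base_bound[of _ _ 1]) (use assms r p0[of s] in auto)
  finally show ?thesis .
qed

lemma mA_powr_bound:
  assumes "\<bar>A\<bar> \<le> C * T" "0 \<le> T"
  shows "\<bar>mA A s\<bar> powr r \<le> cT T * w s"
proof -
  have "\<bar>mA A s\<bar> powr r \<le> 1 * ((1 + C * T) * (p s + \<bar>k s\<bar>)) powr r"
    using mA_bound[OF assms] r by (auto intro!: powr_mono2)
  also have "\<dots> \<le> cT T * w s"
    by (rule base_bound[of _ _ 0]) (use assms r pk[of s] in auto)
  finally show ?thesis .
qed

text \<open>The left-hand side is the derivative of \<open>hA\<close> with respect to
  \<open>A\<close>; where \<open>mA\<close> is nonzero it also equals (1 - 1/r) k^2 |M|^(r-2), the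
  quadratic term of the pulled-back weak form up to the factors \<open>G\<close> and the test
  function.\<close>

lemma dpow_bound:
  assumes "\<bar>A\<bar> \<le> C * T" "0 \<le> T"
  shows "(k s)\<^sup>2 / r * dpow r (mA A s) \<le> cT T * w s"
proof -
  define M where "M = (1 + C * T) * (p s + \<bar>k s\<bar>)"
  have "0 < 1 + C * T" using C0 assms(2) by (simp add: add_pos_nonneg)
  then have M: "0 < M" using pk[of s] by (simp add: M_def)
  have "(k s)\<^sup>2 / r * dpow r (mA A s) \<le> (k s)\<^sup>2 / r * ((r - 1) * M powr (r - 2))"
    using dpow_le[OF r _ M] mA_bound[OF assms] r by (intro mult_left_mono) (auto simp: M_def)
  also have "\<dots> = (k s)\<^sup>2 * ((r - 1) / r) * M powr (r - 2)" by simp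
  also have "\<dots> \<le> (k s)\<^sup>2 * 1 * M powr (r - 2)"
    using r by (intro mult_right_mono mult_left_mono) auto
  also have "\<dots> = (k s)\<^sup>2 * M powr (r - 2)" by simp
  also have "\<dots> \<le> cT T * w s" unfolding M_def
  proof (rule base_bound[of _ _ 2])
    have "\<bar>k s\<bar>^2 \<le> (p s + \<bar>k s\<bar>)^2" using p0[of s] by (intro power_mono) auto
    then show "(k s)\<^sup>2 \<le> (p s + \<bar>k s\<bar>) powr 2" using pk[of s] by simp
  qed (use assms r in auto)
  finally show ?thesis .
qed

lemma hA_diff:
  assumes "\<bar>A\<bar> \<le> C * T" "\<bar>B\<bar> \<le> C * T" "0 \<le> T"
  shows "\<bar>hA A s - hA B s\<bar> \<le> cT T * w s * \<bar>A - B\<bar>"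
proof -
  define M where "M = (1 + C * T) * (p s + \<bar>k s\<bar>)"
  have "0 < 1 + C * T" using C0 assms(3) by (simp add: add_pos_nonneg)
  then have M: "0 < M" using pk[of s] by (simp add: M_def)
  have "\<bar>spow (r - 1) (mA A s) - spow (r - 1) (mA B s)\<bar> \<le> (r - 1) * M powr (r - 2) * \<bar>mA A s - mA B s\<bar>"
    using mA_bound[OF assms(1,3)] mA_bound[OF assms(2,3)] M
    by (intro spow_Lipschitz r) (auto simp: M_def)
  also have "\<bar>mA A s - mA B s\<bar> = \<bar>k s\<bar> / r * \<bar>A - B\<bar>"
  proof -
    have "mA A s - mA B s = k s / r * (A - B)" by (simp add: mA_def right_diff_distrib)
    then show ?thesis using r by (simp add: abs_mult)
  qed
  finally have "\<bar>k s\<bar> * \<bar>spow (r - 1) (mA A s) - spow (r - 1) (mA B s)\<bar>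
    \<le> \<bar>k s\<bar> * ((r - 1) * M powr (r - 2) * (\<bar>k s\<bar> / r * \<bar>A - B\<bar>))"
    by (intro mult_left_mono) auto
  also have "\<dots> = (k s)\<^sup>2 * ((r - 1) / r) * M powr (r - 2) * \<bar>A - B\<bar>"
    by (simp add: power2_eq_square abs_mult_self_eq[of "k s", symmetric] del: abs_mult_self_eq)
  also have "\<dots> \<le> (k s)\<^sup>2 * 1 * M powr (r - 2) * \<bar>A - B\<bar>"
    using r by (intro mult_right_mono mult_left_mono) auto
  also have "\<dots> = (k s)\<^sup>2 * M powr (r - 2) * \<bar>A - B\<bar>" by simp
  also have "\<dots> \<le> cT T * w s * \<bar>A - B\<bar>" unfolding M_def
  proof (intro mult_right_mono base_bound[of _ _ 2])
    have "\<bar>k s\<bar>^2 \<le> (p s + \<bar>k s\<bar>)^2" using p0[of s] by (intro power_mono) auto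
    then show "(k s)\<^sup>2 \<le> (p s + \<bar>k s\<bar>) powr 2" using pk[of s] by simp
  qed (use assms r in auto)
  also have "\<bar>k s\<bar> * \<bar>spow (r - 1) (mA A s) - spow (r - 1) (mA B s)\<bar> = \<bar>hA A s - hA B s\<bar>"
    by (simp add: hA_def abs_mult[symmetric] right_diff_distrib)
  finally show ?thesis .
qed

section \<open>Picard iteration\<close>

definition reg :: "(real \<Rightarrow> real \<Rightarrow> real) \<Rightarrow> bool" where
  "reg V \<longleftrightarrow> (\<forall>s. continuous_on UNIV (\<lambda>t. V t s)) \<and>
    (\<forall>T t a b. \<bar>t\<bar> \<le> T \<longrightarrow> a \<le> b \<longrightarrow> \<bar>V t b - V t a\<bar> \<le> cT T * (Wp b - Wp a))"

lemma regD1: "reg V \<Longrightarrow> continuous_on UNIV (\<lambda>t. V t s)" by (simp add: reg_def)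
lemma regD2: "reg V \<Longrightarrow> \<bar>t\<bar> \<le> T \<Longrightarrow> a \<le> b \<Longrightarrow> \<bar>V t b - V t a\<bar> \<le> cT T * (Wp b - Wp a)"
  by (simp add: reg_def)

definition Aop :: "(real \<Rightarrow> real \<Rightarrow> real) \<Rightarrow> real \<Rightarrow> real \<Rightarrow> real" where
  "Aop V t s = prim (\<lambda>\<tau>. G (V \<tau> s)) t"
definition Uop :: "(real \<Rightarrow> real \<Rightarrow> real) \<Rightarrow> real \<Rightarrow> real \<Rightarrow> real" where
  "Uop V t s = prim (\<lambda>z. hA (Aop V t z) z) s"

lemma GV_cont: "reg V \<Longrightarrow> continuous_on UNIV (\<lambda>\<tau>. G (V \<tau> s))"
  by (rule continuous_on_compose2[OF G_cont regD1]) auto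

lemma prim_abs_le_const:
  assumes h: "loc_integrable h" and b: "\<And>\<tau>. \<bar>\<tau>\<bar> \<le> \<bar>t\<bar> \<Longrightarrow> \<bar>h \<tau>\<bar> \<le> c"
  shows "\<bar>prim h t\<bar> \<le> c * \<bar>t\<bar>"
proof (cases "0 \<le> t")
  case True
  have "\<bar>prim h t - prim h 0\<bar> \<le> prim (\<lambda>_. c) t - prim (\<lambda>_. c) 0"
    by (rule prim_abs_diff_le[OF h loc_integrable_continuous[OF continuous_on_const] _ True])
       (use b True in auto)
  then show ?thesis using True by (simp add: prim_const)
next
  case False
  then have t: "t \<le> 0" by simp
  have "\<bar>prim h 0 - prim h t\<bar> \<le> prim (\<lambda>_. c) 0 - prim (\<lambda>_. c) t"
    by (rule prim_abs_diff_le[OF h loc_integrable_continuous[OF continuous_on_const] _ t])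
       (use b False in auto)
  then show ?thesis using False by (simp add: prim_const)
qed

lemma Aop_deriv: "reg V \<Longrightarrow> ((\<lambda>t. Aop V t s) has_real_derivative G (V t s)) (at t)"
  unfolding Aop_def by (rule prim_has_derivative[OF GV_cont])

lemma Aop_Lip_t:
  assumes V: "reg V" shows "\<bar>Aop V t s - Aop V t' s\<bar> \<le> C * \<bar>t - t'\<bar>"
proof -
  have "norm (Aop V t s - Aop V t' s) \<le> C * norm (t - t')"
    by (rule field_differentiable_bound[of UNIV _ "\<lambda>t. G (V t s)"])
      (use Aop_deriv[OF V] GC in \<open>auto intro: has_field_derivative_at_within\<close>)
  then show ?thesis by simp
qed

lemma Aop_bound: "reg V \<Longrightarrow> \<bar>t\<bar> \<le> T \<Longrightarrow> \<bar>Aop V t s\<bar> \<le> C * T"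
  using Aop_Lip_t[of V t s 0] mult_left_mono[OF _ C0, of "\<bar>t\<bar>" T] by (simp add: Aop_def)

text \<open>Besides continuity in the label, this bound later limits the variation of
  \<open>A\<close> across a single cell or part of a fan.\<close>

lemma Aop_inc:
  assumes V: "reg V" and t: "\<bar>t\<bar> \<le> T" and ab: "a \<le> b"
  shows "\<bar>Aop V t b - Aop V t a\<bar> \<le> L * cT T * (Wp b - Wp a) * T"
proof -
  have "Aop V t b - Aop V t a = prim (\<lambda>\<tau>. G (V \<tau> b) - G (V \<tau> a)) t"
    unfolding Aop_def by (rule prim_sub[symmetric]) (intro loc_integrable_continuous GV_cont V)+
  also have "\<bar>\<dots>\<bar> \<le> L * (cT T * (Wp b - Wp a)) * \<bar>t\<bar>"
  proof (rule prim_abs_le_const)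
    show "loc_integrable (\<lambda>\<tau>. G (V \<tau> b) - G (V \<tau> a))"
      by (intro loc_integrable_continuous continuous_on_diff GV_cont V)
    fix \<tau> assume "\<bar>\<tau>\<bar> \<le> \<bar>t\<bar>"
    then have "\<bar>V \<tau> b - V \<tau> a\<bar> \<le> cT T * (Wp b - Wp a)" by (intro regD2[OF V _ ab]) (use t in simp)
    then have "L * \<bar>V \<tau> b - V \<tau> a\<bar> \<le> L * (cT T * (Wp b - Wp a))" by (rule mult_left_mono[OF _ L0])
    then show "\<bar>G (V \<tau> b) - G (V \<tau> a)\<bar> \<le> L * (cT T * (Wp b - Wp a))"
      using GL[of "V \<tau> b" "V \<tau> a"] by linarith
  qed
  also have "\<dots> \<le> L * (cT T * (Wp b - Wp a)) * T"
    using t L0 cT0[of T] Wp_mono[OF ab] by (intro mult_left_mono mult_nonneg_nonneg) auto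
  finally show ?thesis by (simp add: mult_ac)
qed

lemma Aop_cont_s:
  assumes V: "reg V" shows "continuous_on UNIV (Aop V t)"
proof -
  have "isCont (Aop V t) x" for x
  proof -
    have W: "isCont Wp x" using Wp_cont[of UNIV] by (simp add: continuous_on_eq_continuous_at)
    have "((\<lambda>y. L * cT \<bar>t\<bar> * \<bar>t\<bar> * \<bar>Wp y - Wp x\<bar>) \<longlongrightarrow> L * cT \<bar>t\<bar> * \<bar>t\<bar> * \<bar>Wp x - Wp x\<bar>) (at x)"
      by (intro tendsto_intros isContD[OF W])
    then have z: "((\<lambda>y. L * cT \<bar>t\<bar> * \<bar>t\<bar> * \<bar>Wp y - Wp x\<bar>) \<longlongrightarrow> 0) (at x)" by simp
    have "norm (Aop V t y - Aop V t x) \<le> L * cT \<bar>t\<bar> * \<bar>t\<bar> * \<bar>Wp y - Wp x\<bar>" for y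
      using Aop_inc[OF V order_refl, of x y t] Aop_inc[OF V order_refl, of y x t] Wp_mono[of x y] Wp_mono[of y x]
      by (cases "x \<le> y") (auto simp: abs_minus_commute mult_ac)
    then have "((\<lambda>y. Aop V t y - Aop V t x) \<longlongrightarrow> 0) (at x)"
      by (intro Lim_null_comparison[OF _ z] always_eventually) simp
    then show ?thesis unfolding isCont_def by (rule LIM_zero_cancel)
  qed
  then show ?thesis by (simp add: continuous_at_imp_continuous_on)
qed

lemma hA_borel: "reg V \<Longrightarrow> (\<lambda>z. hA (Aop V t z) z) \<in> borel_measurable borel"
proof -
  assume V: "reg V"
  have [measurable]: "Aop V t \<in> borel_measurable borel"
    by (rule borel_measurable_continuous_onI[OF Aop_cont_s[OF V]])
  show ?thesis unfolding hA_def mA_def by measurable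
qed

lemma hA_loc: "reg V \<Longrightarrow> loc_integrable (\<lambda>z. hA (Aop V t z) z)"
  by (rule loc_integrable_bound[OF loc_integrable_scale[OF lw, of "cT \<bar>t\<bar>"] hA_borel])
     (auto intro!: hA_bound Aop_bound)

text \<open>The right-hand side does not involve \<open>V\<close>, since \<open>Aop V\<close> is
  bounded by \<open>C * T\<close> for every regular \<open>V\<close>. Hence \<open>reg\<close> is
  invariant under the iteration with fixed constants.\<close>

lemma Uop_inc:
  assumes V: "reg V" and t: "\<bar>t\<bar> \<le> T" and ab: "a \<le> b"
  shows "\<bar>Uop V t b - Uop V t a\<bar> \<le> cT T * (Wp b - Wp a)"
proof -
  have "\<bar>Uop V t b - Uop V t a\<bar> \<le> prim (\<lambda>z. cT T * w z) b - prim (\<lambda>z. cT T * w z) a"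
    unfolding Uop_def using t
    by (intro prim_abs_diff_le hA_loc V loc_integrable_scale lw hA_bound Aop_bound ab) auto
  then show ?thesis by (simp add: prim_scale Wp_def right_diff_distrib)
qed

lemma hA_neg: "z \<le> 0 \<Longrightarrow> hA A z = 0" by (simp add: hA_def neg)

lemma Uop_neg: "reg V \<Longrightarrow> s \<le> 0 \<Longrightarrow> Uop V t s = 0"
  unfolding Uop_def by (intro prim_zero_left hA_loc hA_neg)

text \<open>One estimate with two applications: the same function at two times, which gives the
  Lipschitz bound in \<open>t\<close>, and two successive iterates at the same time.\<close>

lemma Uop_diff:
  assumes V: "reg V" "reg V'" and T: "\<bar>t\<bar> \<le> T" "\<bar>t'\<bar> \<le> T" and s: "s \<le> S" "0 \<le> S"
    and d: "\<And>z. z \<le> S \<Longrightarrow> \<bar>Aop V t z - Aop V' t' z\<bar> \<le> \<delta>"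
  shows "\<bar>Uop V t s - Uop V' t' s\<bar> \<le> cT T * Wp S * \<delta>"
proof (cases "s \<le> 0")
  case True
  have "0 \<le> \<delta>" using d[of 0] s(2) abs_ge_zero[of "Aop V t 0 - Aop V' t' 0"] by linarith
  moreover have "0 \<le> cT T" by (rule cT0)
  moreover have "0 \<le> Wp S" using Wp_mono[OF s(2)] by simp
  ultimately show ?thesis using Uop_neg[OF V(1) True] Uop_neg[OF V(2) True] by simp
next
  case False
  then have s0: "0 \<le> s" by simp
  have T0: "0 \<le> T" using T(1) by simp
  have d0: "0 \<le> \<delta>" using d[of 0] s(2) abs_ge_zero[of "Aop V t 0 - Aop V' t' 0"] by linarith
  define h where "h z = hA (Aop V t z) z - hA (Aop V' t' z) z" for z
  have lh: "loc_integrable h"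
    unfolding h_def using hA_loc[OF V(1), of t] hA_loc[OF V(2), of t']
    by (auto simp: loc_integrable_def)
  have "\<bar>prim h s - prim h 0\<bar> \<le> prim (\<lambda>z. (cT T * \<delta>) * w z) s - prim (\<lambda>z. (cT T * \<delta>) * w z) 0"
  proof (rule prim_abs_diff_le[OF lh loc_integrable_scale[OF lw] _ s0])
    fix z assume "z \<in> {0..s}"
    then have z: "z \<le> S" using s by simp
    have "\<bar>h z\<bar> \<le> cT T * w z * \<bar>Aop V t z - Aop V' t' z\<bar>"
      unfolding h_def by (intro hA_diff Aop_bound V T T0)
    also have "\<dots> \<le> cT T * w z * \<delta>"
      using cT1[OF T0] w0[of z] by (intro mult_left_mono d z) auto
    finally show "\<bar>h z\<bar> \<le> (cT T * \<delta>) * w z" by (simp add: mult_ac)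
  qed
  then have "\<bar>prim h s\<bar> \<le> cT T * \<delta> * Wp s" by (simp add: prim_scale Wp_def)
  also have "\<dots> \<le> cT T * \<delta> * Wp S"
    using cT1[OF T0] d0 by (intro mult_left_mono Wp_mono s) auto
  finally have "\<bar>prim h s\<bar> \<le> cT T * Wp S * \<delta>" by (simp add: mult_ac)
  moreover have "prim h s = Uop V t s - Uop V' t' s"
    unfolding h_def Uop_def by (intro prim_sub hA_loc V)
  ultimately show ?thesis by simp
qed

lemma Uop_Lip_t:
  assumes V: "reg V" and T: "\<bar>t\<bar> \<le> T" "\<bar>t'\<bar> \<le> T" and s: "s \<le> S" "0 \<le> S"
  shows "\<bar>Uop V t s - Uop V t' s\<bar> \<le> cT T * Wp S * (C * \<bar>t - t'\<bar>)"
  by (rule Uop_diff[OF V V T s Aop_Lip_t[OF V]])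

lemma Lipschitz_imp_cont:
  fixes f :: "real \<Rightarrow> real"
  assumes "\<And>T t t'. \<bar>t\<bar> \<le> T \<Longrightarrow> \<bar>t'\<bar> \<le> T \<Longrightarrow> \<bar>f t - f t'\<bar> \<le> c T * \<bar>t - t'\<bar>"
  shows "continuous_on UNIV f"
proof -
  have "isCont f x" for x
  proof -
    have "((\<lambda>y. c (\<bar>x\<bar> + 1) * \<bar>y - x\<bar>) \<longlongrightarrow> c (\<bar>x\<bar> + 1) * \<bar>x - x\<bar>) (at x)"
      by (intro tendsto_intros)
    then have z: "((\<lambda>y. c (\<bar>x\<bar> + 1) * \<bar>y - x\<bar>) \<longlongrightarrow> 0) (at x)" by simp
    have "\<forall>\<^sub>F y in at x. norm (f y - f x) \<le> c (\<bar>x\<bar> + 1) * \<bar>y - x\<bar>"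
      unfolding eventually_at
    proof (intro exI[of _ 1] conjI ballI impI)
      fix y assume "y \<noteq> x \<and> dist y x < 1"
      then have "\<bar>y - x\<bar> < 1" by (simp add: dist_real_def)
      then have "\<bar>y\<bar> \<le> \<bar>x\<bar> + 1" by linarith
      then show "norm (f y - f x) \<le> c (\<bar>x\<bar> + 1) * \<bar>y - x\<bar>" using assms[of y "\<bar>x\<bar> + 1" x] by simp
    qed simp
    then have "((\<lambda>y. f y - f x) \<longlongrightarrow> 0) (at x)" by (rule Lim_null_comparison[OF _ z])
    then show ?thesis unfolding isCont_def by (rule LIM_zero_cancel)
  qed
  then show ?thesis by (simp add: continuous_at_imp_continuous_on)
qed

lemma reg_Uop: assumes V: "reg V" shows "reg (Uop V)"
  unfolding reg_def
proof (intro conjI allI impI)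
  fix s show "continuous_on UNIV (\<lambda>t. Uop V t s)"
    by (rule Lipschitz_imp_cont[where c="\<lambda>T. cT T * Wp \<bar>s\<bar> * C"])
       (use Uop_Lip_t[OF V, of _ _ _ s "\<bar>s\<bar>"] in \<open>simp add: mult_ac\<close>)
qed (rule Uop_inc[OF V])

fun Pic :: "nat \<Rightarrow> real \<Rightarrow> real \<Rightarrow> real" where
  "Pic 0 = (\<lambda>t s. 0)"
| "Pic (Suc n) = Uop (Pic n)"

lemma reg_Pic: "reg (Pic n)"
proof (induction n)
  case 0
  have "0 \<le> cT T * (Wp b - Wp a)" if "\<bar>t\<bar> \<le> T" "a \<le> b" for t T a b
    using cT0[of T] Wp_mono[OF that(2)] by (intro mult_nonneg_nonneg) auto
  then show ?case by (simp add: reg_def)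
next
  case (Suc n) then show ?case by (simp add: reg_Uop)
qed

text \<open>Contraction in the norm weighted by \<open>exp (K * \<bar>t\<bar>)\<close>: a step
  multiplies the bound by \<open>K0 * L / K\<close>, and \<open>K\<close> is chosen to make this at
  most 1/2, with the \<open>+ 1\<close> keeping it positive. The estimate closes on the labels up to
  \<open>S\<close>, because the value at a positive label involves only labels between 0 and that
  label.\<close>

lemma Pic_step:
  assumes "0 \<le> S" "0 \<le> T"
  defines "K0 \<equiv> cT T * Wp S" and "K \<equiv> 2 * (cT T * Wp S) * L + 1"
  assumes "\<bar>t\<bar> \<le> T" "s \<le> S"
  shows "\<bar>Pic (Suc n) t s - Pic n t s\<bar> \<le> K0 / 2 ^ n * exp (K * \<bar>t\<bar>)"
  using assms(5,6)
proof (induction n arbitrary: t s)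
  have K0: "0 \<le> K0" unfolding K0_def using cT1[OF assms(2)] Wp_mono[OF assms(1)] by simp
  have K: "1 \<le> K" unfolding K_def using K0 L0 by (simp add: K0_def)
  {
    case 0
    have "\<bar>Uop (Pic 0) t s\<bar> \<le> K0"
    proof (cases "s \<le> 0")
      case True then show ?thesis using Uop_neg[OF reg_Pic[of 0] True, of t] K0 by (simp del: Pic.simps)
    next
      case False
      then have "\<bar>Uop (Pic 0) t s - Uop (Pic 0) t 0\<bar> \<le> cT T * (Wp s - Wp 0)"
        by (intro Uop_inc reg_Pic 0) simp
      also have "\<dots> \<le> K0" unfolding K0_def using Wp_mono[OF 0(2)] cT1[OF assms(2)]
        by (intro mult_left_mono) auto
      finally show ?thesis using Uop_neg[OF reg_Pic[of 0], of 0 t] by (simp del: Pic.simps)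
    qed
    also have "K0 \<le> K0 * exp (K * \<bar>t\<bar>)" 
      using mult_left_mono[OF _ K0, of 1 "exp (K * \<bar>t\<bar>)"] K by simp
    finally show ?case by simp
  next
    case (Suc n)
    define c where "c = L * (K0 / 2 ^ n)"
    have c0: "0 \<le> c" using L0 K0 by (simp add: c_def)
    have "\<bar>Uop (Pic (Suc n)) t s - Uop (Pic n) t s\<bar> \<le> cT T * Wp S * (c / K * exp (K * \<bar>t\<bar>))"
    proof (rule Uop_diff[OF reg_Pic reg_Pic Suc.prems(1) Suc.prems(1) Suc.prems(2) assms(1)])
      fix z assume z: "z \<le> S"
      have "Aop (Pic (Suc n)) t z - Aop (Pic n) t z = prim (\<lambda>\<tau>. G (Pic (Suc n) \<tau> z) - G (Pic n \<tau> z)) t"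
        unfolding Aop_def by (rule prim_sub[symmetric]) (intro loc_integrable_continuous GV_cont reg_Pic)+
      also have "\<bar>\<dots>\<bar> \<le> c / K * exp (K * \<bar>t\<bar>)"
      proof (rule prim_exp_bound)
        show "loc_integrable (\<lambda>\<tau>. G (Pic (Suc n) \<tau> z) - G (Pic n \<tau> z))"
          by (intro loc_integrable_continuous continuous_on_diff GV_cont reg_Pic)
        show "0 < K" using K by simp
        show "0 \<le> c" by (rule c0)
        fix \<tau> assume "\<bar>\<tau>\<bar> \<le> \<bar>t\<bar>"
        then have "\<bar>Pic (Suc n) \<tau> z - Pic n \<tau> z\<bar> \<le> K0 / 2 ^ n * exp (K * \<bar>\<tau>\<bar>)"
          by (intro Suc.IH z) (use Suc.prems(1) in simp)
        then have "L * \<bar>Pic (Suc n) \<tau> z - Pic n \<tau> z\<bar> \<le> L * (K0 / 2 ^ n * exp (K * \<bar>\<tau>\<bar>))"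
          by (rule mult_left_mono[OF _ L0])
        then show "\<bar>G (Pic (Suc n) \<tau> z) - G (Pic n \<tau> z)\<bar> \<le> c * exp (K * \<bar>\<tau>\<bar>)"
          using GL[of "Pic (Suc n) \<tau> z" "Pic n \<tau> z"] by (simp add: c_def mult_ac)
      qed
      finally show "\<bar>Aop (Pic (Suc n)) t z - Aop (Pic n) t z\<bar> \<le> c / K * exp (K * \<bar>t\<bar>)" .
    qed
    also have "\<dots> = (K0 * L / K) * (K0 / 2 ^ n * exp (K * \<bar>t\<bar>))"
      by (simp add: c_def K0_def mult_ac)
    also have "\<dots> \<le> (1 / 2) * (K0 / 2 ^ n * exp (K * \<bar>t\<bar>))"
    proof (rule mult_right_mono)
      have "2 * (K0 * L) \<le> K" by (simp add: K_def K0_def)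
      then show "K0 * L / K \<le> 1 / 2" using K by (simp add: field_simps)
      show "0 \<le> K0 / 2 ^ n * exp (K * \<bar>t\<bar>)" using K0 by simp
    qed
    finally show ?case by simp
  }
qed

definition U :: "real \<Rightarrow> real \<Rightarrow> real" where "U t s = lim (\<lambda>n. Pic n t s)"

lemma Pic_tendsto: "(\<lambda>n. Pic n t s) \<longlonglongrightarrow> U t s"
proof -
  define B where "B = cT \<bar>t\<bar> * Wp \<bar>s\<bar>"
  define E where "E = exp ((2 * B * L + 1) * \<bar>t\<bar>)"
  have b: "norm (Pic (Suc n) t s - Pic n t s) \<le> (B * E) * (1 / 2) ^ n" for n
    using Pic_step[of "\<bar>s\<bar>" "\<bar>t\<bar>" t s n] by (simp add: B_def E_def power_one_over field_simps)
  have "summable (\<lambda>n. (B * E) * (1 / 2 :: real) ^ n)"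
    by (intro summable_mult summable_geometric) simp
  then have "summable (\<lambda>n. Pic (Suc n) t s - Pic n t s)"
    by (rule summable_comparison_test'[where N=0]) (rule b)
  then have "convergent (\<lambda>n. \<Sum>i<n. Pic (Suc i) t s - Pic i t s)" by (simp add: summable_iff_convergent)
  then have "convergent (\<lambda>n. Pic n t s)"
    unfolding sum_lessThan_telescope[of "\<lambda>i. Pic i t s"] by simp
  then show ?thesis unfolding U_def by (simp add: convergent_LIMSEQ_iff)
qed

lemma U_reg: "reg U"
  unfolding reg_def
proof (intro conjI allI impI)
  fix s show "continuous_on UNIV (\<lambda>t. U t s)"
  proof (rule Lipschitz_imp_cont[where c="\<lambda>T. cT T * Wp \<bar>s\<bar> * C"])
    fix T t t' :: real assume T: "\<bar>t\<bar> \<le> T" "\<bar>t'\<bar> \<le> T"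
    \<comment> \<open>The Lipschitz bound in time is available for values of \<open>Uop\<close>
      only, hence the shifted sequence.\<close>
    have "(\<lambda>n. \<bar>Pic (Suc n) t s - Pic (Suc n) t' s\<bar>) \<longlonglongrightarrow> \<bar>U t s - U t' s\<bar>"
      by (intro tendsto_intros LIMSEQ_Suc[OF Pic_tendsto])
    then show "\<bar>U t s - U t' s\<bar> \<le> cT T * Wp \<bar>s\<bar> * C * \<bar>t - t'\<bar>"
      by (rule LIMSEQ_le_const2)
        (use Uop_Lip_t[OF reg_Pic T, of s "\<bar>s\<bar>"] in \<open>auto simp: mult_ac\<close>)
  qed
next
  fix T t a b :: real assume h: "\<bar>t\<bar> \<le> T" "a \<le> b"
  have "(\<lambda>n. \<bar>Pic n t b - Pic n t a\<bar>) \<longlonglongrightarrow> \<bar>U t b - U t a\<bar>"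
    by (intro tendsto_intros Pic_tendsto)
  then show "\<bar>U t b - U t a\<bar> \<le> cT T * (Wp b - Wp a)"
    by (rule LIMSEQ_le_const2) (use regD2[OF reg_Pic h] in auto)
qed

text \<open>Dominated convergence twice: in time with the constant \<open>C\<close>, then in the
  label with the weight.\<close>

lemma U_fix: "U t s = Uop U t s"
proof -
  have A: "(\<lambda>n. Aop (Pic n) t z) \<longlonglongrightarrow> Aop U t z" for z
    unfolding Aop_def
  proof (rule prim_tendsto[where w="\<lambda>_. C"])
    show "(\<lambda>\<tau>. G (Pic n \<tau> z)) \<in> borel_measurable borel" for n
      by (rule borel_measurable_continuous_onI[OF GV_cont[OF reg_Pic]])
    show "(\<lambda>\<tau>. G (U \<tau> z)) \<in> borel_measurable borel"
      by (rule borel_measurable_continuous_onI[OF GV_cont[OF U_reg]])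
    show "(\<lambda>n. G (Pic n \<tau> z)) \<longlonglongrightarrow> G (U \<tau> z)" for \<tau>
      by (rule continuous_on_tendsto_compose[OF G_cont[of UNIV] Pic_tendsto]) auto
  qed (use GC in \<open>auto intro: loc_integrable_continuous\<close>)
  have "(\<lambda>n. Uop (Pic n) t s) \<longlonglongrightarrow> Uop U t s"
    unfolding Uop_def
  proof (rule prim_tendsto[where w="\<lambda>z. cT \<bar>t\<bar> * w z"])
    show "(\<lambda>z. hA (Aop (Pic n) t z) z) \<in> borel_measurable borel" for n
      by (rule hA_borel[OF reg_Pic])
    show "(\<lambda>z. hA (Aop U t z) z) \<in> borel_measurable borel"
      by (rule hA_borel[OF U_reg])
    show "(\<lambda>n. hA (Aop (Pic n) t z) z) \<longlonglongrightarrow> hA (Aop U t z) z" for z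
      unfolding hA_def mA_def
      by (intro tendsto_intros continuous_on_tendsto_compose[OF spow_continuous[OF r, of UNIV]] A) auto
    show "loc_integrable (\<lambda>z. cT \<bar>t\<bar> * w z)" by (rule loc_integrable_scale[OF lw])
    show "\<bar>hA (Aop (Pic n) t z) z\<bar> \<le> cT \<bar>t\<bar> * w z" for n z
      by (intro hA_bound Aop_bound reg_Pic) auto
  qed
  moreover have "(\<lambda>n. Uop (Pic n) t s) \<longlonglongrightarrow> U t s"
    using LIMSEQ_Suc[OF Pic_tendsto[of t s]] by simp
  ultimately show ?thesis by (rule LIMSEQ_unique[symmetric])
qed

end

section \<open>Characteristics\<close>

lemma joint_continuous:
  fixes f :: "real \<Rightarrow> real \<Rightarrow> real"
  assumes Lt: "\<And>R t t' s. \<bar>t\<bar> \<le> R \<Longrightarrow> \<bar>t'\<bar> \<le> R \<Longrightarrow> \<bar>s\<bar> \<le> R \<Longrightarrow> \<bar>f t s - f t' s\<bar> \<le> c R * \<bar>t - t'\<bar>"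
    and cs: "\<And>t. continuous_on UNIV (f t)"
  shows "continuous_on UNIV (\<lambda>z. f (fst z) (snd z))"
proof -
  have "isCont (\<lambda>z. f (fst z) (snd z)) (t, s)" for t s
  proof -
    define R where "R = max \<bar>t\<bar> \<bar>s\<bar> + 1"
    have it: "isCont (f t) s" using cs[of t] by (simp add: continuous_on_eq_continuous_at)
    have fs: "((\<lambda>z. f t (snd z)) \<longlongrightarrow> f t s) (at (t, s))"
      by (rule isCont_tendsto_compose[OF it]) (auto intro!: tendsto_eq_intros)
    have "((\<lambda>z. c R * \<bar>fst z - t\<bar> + \<bar>f t (snd z) - f t s\<bar>) \<longlongrightarrow> c R * \<bar>t - t\<bar> + \<bar>f t s - f t s\<bar>) (at (t, s))"
      by (intro tendsto_intros fs) (auto intro!: tendsto_eq_intros)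
    then have z: "((\<lambda>z. c R * \<bar>fst z - t\<bar> + \<bar>f t (snd z) - f t s\<bar>) \<longlongrightarrow> 0) (at (t, s))" by simp
    have ev: "\<forall>\<^sub>F z in at (t, s). norm (f (fst z) (snd z) - f t s) \<le> c R * \<bar>fst z - t\<bar> + \<bar>f t (snd z) - f t s\<bar>"
      unfolding eventually_at
    proof (intro exI[of _ 1] conjI ballI impI)
      fix z assume "z \<noteq> (t, s) \<and> dist z (t, s) < 1"
      then have d: "dist (fst z) t < 1" "dist (snd z) s < 1"
        using dist_fst_le[of z "(t, s)"] dist_snd_le[of z "(t, s)"] by auto
      then have "\<bar>fst z\<bar> \<le> R" "\<bar>t\<bar> \<le> R" "\<bar>snd z\<bar> \<le> R"
        by (auto simp: dist_real_def R_def)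
      from Lt[OF this] show "norm (f (fst z) (snd z) - f t s) \<le> c R * \<bar>fst z - t\<bar> + \<bar>f t (snd z) - f t s\<bar>"
        by simp
    qed simp
    have "((\<lambda>z. f (fst z) (snd z) - f t s) \<longlongrightarrow> 0) (at (t, s))"
      by (rule Lim_null_comparison[OF ev z])
    then show ?thesis unfolding isCont_def by (simp add: LIM_zero_iff)
  qed
  then show ?thesis by (simp add: continuous_at_imp_continuous_on split_paired_all)
qed

text \<open>Near such a zero the difference quotient stays away from 0, so the zero is isolated.
  \<open>Z n\<close> collects the zeros of isolation radius 1 / (n + 1); two of its points are never
  closer than that, so it has no limit point.\<close>

lemma countable_transversal_zeros:
  fixes f :: "real \<Rightarrow> real"
  assumes "\<And>t. (f has_real_derivative f' t) (at t)"
  shows "countable {t. f t = 0 \<and> f' t \<noteq> 0}"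
proof -
  define Z where "Z n = {t. f t = 0 \<and> (\<forall>y. 0 < \<bar>y - t\<bar> \<and> \<bar>y - t\<bar> < 1 / real (Suc n) \<longrightarrow> f y \<noteq> 0)}" for n
  have "countable (Z n)" for n
  proof (rule no_limpt_imp_countable)
    fix z show "\<not> z islimpt Z n"
    proof
      assume z: "z islimpt Z n"
      define e where "e = 1 / (2 * real (Suc n))"
      have e: "0 < e" by (simp add: e_def)
      obtain y where y: "y \<in> Z n" "y \<noteq> z" "dist y z < e"
        using z e unfolding islimpt_approachable by blast
      then have "0 < dist y z" by simp
      then obtain y' where y': "y' \<in> Z n" "y' \<noteq> z" "dist y' z < dist y z"
        using z unfolding islimpt_approachable by blast
      have "\<bar>y' - y\<bar> < 2 * e" "0 < \<bar>y' - y\<bar>" using y y' by (auto simp: dist_real_def)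
      moreover have "2 * e = 1 / real (Suc n)" by (simp add: e_def field_simps)
      ultimately show False using y(1) y'(1) by (auto simp: Z_def)
    qed
  qed
  then have "countable (\<Union>n. Z n)" by simp
  moreover have "{t. f t = 0 \<and> f' t \<noteq> 0} \<subseteq> (\<Union>n. Z n)"
  proof
    fix t assume "t \<in> {t. f t = 0 \<and> f' t \<noteq> 0}"
    then have t: "f t = 0" "f' t \<noteq> 0" by auto
    have "((\<lambda>y. (f y - f t) / (y - t)) \<longlongrightarrow> f' t) (at t)"
      using assms[of t] by (simp add: has_field_derivative_iff)
    then have "\<forall>\<^sub>F y in at t. (f y - f t) / (y - t) \<noteq> 0"
      by (rule tendsto_imp_eventually_ne) (rule t(2))
    then obtain d where d: "0 < d" "\<And>y. y \<noteq> t \<Longrightarrow> dist y t < d \<Longrightarrow> (f y - f t) / (y - t) \<noteq> 0"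
      unfolding eventually_at by blast
    obtain n where n: "1 / real (Suc n) < d" using nat_approx_posE[OF d(1)] by auto
    have "t \<in> Z n"
      unfolding Z_def
    proof (intro CollectI conjI allI impI t(1))
      fix y assume "0 < \<bar>y - t\<bar> \<and> \<bar>y - t\<bar> < 1 / real (Suc n)"
      then have "y \<noteq> t" "dist y t < d" using n by (auto simp: dist_real_def)
      from d(2)[OF this] show "f y \<noteq> 0" using t(1) by auto
    qed
    then show "t \<in> (\<Union>n. Z n)" by blast
  qed
  ultimately show ?thesis by (rule countable_subset[rotated])
qed

section \<open>Motion of the labels\<close>

context char_data
begin

definition A :: "real \<Rightarrow> real \<Rightarrow> real" where "A = Aop U"
definition M :: "real \<Rightarrow> real \<Rightarrow> real" where "M t s = mA (A t s) s"
definition H :: "real \<Rightarrow> real \<Rightarrow> real" where "H t s = hA (A t s) s"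
text \<open>The label 0 carries the value 0 and so moves with speed \<open>F 0\<close>; the other
  positions follow by adding up lengths. That each label then moves with its own speed is proved in
  \<open>X_time\<close> and \<open>X_deriv\<close>.\<close>

definition X :: "real \<Rightarrow> real \<Rightarrow> real" where "X t s = F 0 * t + prim (\<lambda>z. \<bar>M t z\<bar> powr r) s"

lemma A_bound: "\<bar>t\<bar> \<le> T \<Longrightarrow> \<bar>A t s\<bar> \<le> C * T"
  unfolding A_def by (rule Aop_bound[OF U_reg])

lemma A_cont: "continuous_on UNIV (\<lambda>z. A (fst z) (snd z))"
  by (rule joint_continuous[where c="\<lambda>_. C"])
     (simp_all add: A_def Aop_Lip_t[OF U_reg] Aop_cont_s[OF U_reg])

lemma U_prim: "U t s = prim (H t) s"
  using U_fix[of t s] by (simp add: Uop_def H_def[abs_def] A_def)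

lemma H_loc: "loc_integrable (H t)"
  using hA_loc[OF U_reg] by (simp add: H_def[abs_def] A_def)

lemma U_cont_s: "continuous_on UNIV (U t)"
  unfolding U_prim[abs_def] by (rule prim_continuous[OF H_loc])

lemma U_Lip_t:
  assumes "\<bar>t\<bar> \<le> T" "\<bar>t'\<bar> \<le> T" "s \<le> S" "0 \<le> S"
  shows "\<bar>U t s - U t' s\<bar> \<le> cT T * Wp S * C * \<bar>t - t'\<bar>"
  using Uop_Lip_t[OF U_reg assms] by (simp add: U_fix[symmetric] mult.assoc)

lemma U_cont: "continuous_on UNIV (\<lambda>z. U (fst z) (snd z))"
proof (rule joint_continuous[where c="\<lambda>R. cT R * Wp R * C"])
  fix R t t' s :: real assume "\<bar>t\<bar> \<le> R" "\<bar>t'\<bar> \<le> R" "\<bar>s\<bar> \<le> R"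
  then show "\<bar>U t s - U t' s\<bar> \<le> cT R * Wp R * C * \<bar>t - t'\<bar>" by (intro U_Lip_t) auto
qed (rule U_cont_s)

lemma U_neg: "s \<le> 0 \<Longrightarrow> U t s = 0"
  using Uop_neg[OF U_reg] by (simp add: U_fix[symmetric])

lemma A_borel [measurable]: "(\<lambda>z. A (fst z) (snd z)) \<in> borel_measurable borel"
  by (rule borel_measurable_continuous_onI[OF A_cont])
lemma U_borel [measurable]: "(\<lambda>z. U (fst z) (snd z)) \<in> borel_measurable borel"
  by (rule borel_measurable_continuous_onI[OF U_cont])

lemma M_borel [measurable]: "(\<lambda>z. M (fst z) (snd z)) \<in> borel_measurable borel"
proof -
  have 1: "(\<lambda>z::real\<times>real. p (snd z)) \<in> borel_measurable borel" "(\<lambda>z::real\<times>real. k (snd z)) \<in> borel_measurable borel"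
    by (rule measurable_compose[OF _ pm] measurable_compose[OF _ km], simp add: borel_prod[symmetric])+
  show ?thesis unfolding M_def mA_def
    by (intro borel_measurable_add borel_measurable_times borel_measurable_divide 1 A_borel borel_measurable_const)
qed

lemma H_borel [measurable]: "(\<lambda>z. H (fst z) (snd z)) \<in> borel_measurable borel"
proof -
  have 1: "(\<lambda>z::real\<times>real. k (snd z)) \<in> borel_measurable borel"
    by (rule measurable_compose[OF _ km], simp add: borel_prod[symmetric])
  have "(\<lambda>z. k (snd z) * spow (r - 1) (M (fst z) (snd z))) \<in> borel_measurable borel"
    by (intro borel_measurable_times 1 measurable_compose[OF M_borel spow_borel])
  then show ?thesis by (simp add: H_def hA_def M_def)
qed

lemma slice_borel:
  fixes g :: "real \<Rightarrow> real \<Rightarrow> real"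
  assumes "(\<lambda>z. g (fst z) (snd z)) \<in> borel_measurable borel"
  shows "g t \<in> borel_measurable borel" "(\<lambda>t. g t s) \<in> borel_measurable borel"
  using measurable_compose[OF measurable_Pair1' assms[folded borel_prod], of t]
    measurable_compose[OF measurable_Pair2' assms[folded borel_prod], of s] by simp_all

lemma M_deriv: "((\<lambda>t. M t s) has_real_derivative k s / r * G (U t s)) (at t)"
  using DERIV_add[OF DERIV_const[of "p s"] DERIV_cmult[OF Aop_deriv[OF U_reg], of "k s / r" s t]]
  by (simp add: M_def mA_def A_def)

text \<open>The factor \<open>1 / r\<close> in the equation for \<open>M\<close> cancels the
  exponent. The resulting rate is the derivative of \<open>F (U t s)\<close> in the label,
  \<open>H\<close> being the density of \<open>U\<close>.\<close>

lemma M_powr_deriv: "((\<lambda>t. \<bar>M t s\<bar> powr r) has_real_derivative G (U t s) * H t s) (at t)"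
proof -
  have "((\<lambda>t. \<bar>M t s\<bar> powr r) has_real_derivative r * spow (r - 1) (M t s) * (k s / r * G (U t s))) (at t)"
    by (rule DERIV_chain2[OF abs_powr_has_derivative[OF r] M_deriv])
  then show ?thesis using r by (simp add: H_def hA_def M_def mult_ac)
qed

lemma H_deriv: "((\<lambda>t. H t s) has_real_derivative k s * (dpow r (M t s) * (k s / r * G (U t s)))) (at t)"
  unfolding H_def hA_def M_def[symmetric]
  by (rule DERIV_cmult[OF DERIV_chain2[OF spow_has_derivative[OF r] M_deriv]])

lemma Mr_bound: "\<bar>t\<bar> \<le> T \<Longrightarrow> \<bar>M t s\<bar> powr r \<le> cT T * w s"
  unfolding M_def by (intro mA_powr_bound A_bound) auto

lemma H_bound: "\<bar>t\<bar> \<le> T \<Longrightarrow> \<bar>H t s\<bar> \<le> cT T * w s"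
  unfolding H_def by (intro hA_bound A_bound) auto

lemma M_slice [measurable]: "M t \<in> borel_measurable borel" by (rule slice_borel(1)[OF M_borel])
lemma H_slice [measurable]: "H t \<in> borel_measurable borel" by (rule slice_borel(1)[OF H_borel])

lemma Mr_loc: "loc_integrable (\<lambda>z. \<bar>M t z\<bar> powr r)"
proof (rule loc_integrable_bound[OF loc_integrable_scale[OF lw, of "cT \<bar>t\<bar>"]])
  show "(\<lambda>z. \<bar>M t z\<bar> powr r) \<in> borel_measurable borel" by measurable
qed (use Mr_bound[OF order_refl] in simp)

lemma M_neg: "s \<le> 0 \<Longrightarrow> M t s = 1" by (simp add: M_def mA_def neg)

lemma X_inc: "a \<le> b \<Longrightarrow> X t b - X t a = (LINT z:{a..b}|lborel. \<bar>M t z\<bar> powr r)"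
  using prim_diff[OF Mr_loc] by (simp add: X_def)

lemma X_mono: "a \<le> b \<Longrightarrow> X t a \<le> X t b"
  using prim_mono[OF Mr_loc] by (simp add: X_def)

lemma X_cont_s: "continuous_on UNIV (X t)"
  unfolding X_def by (intro continuous_intros Mr_loc)

lemma X_neg: assumes "s \<le> 0" shows "X t s = F 0 * t + s"
proof -
  have "X t 0 - X t s = (LINT z:{s..0}|lborel. 1)"
    unfolding X_inc[OF assms] by (rule set_lebesgue_integral_cong) (auto simp: M_neg)
  also have "\<dots> = - s" using assms by (simp add: set_lebesgue_integral_def)
  finally show ?thesis by (simp add: X_def)
qed

lemma GH_loc: "loc_integrable (\<lambda>z. G (U t z) * H t z)"
  by (rule loc_integrable_mult_continuous[OF continuous_on_compose2[OF G_cont U_cont_s] H_loc]) auto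

lemma F_chain: "F (U t s) - F 0 = prim (\<lambda>z. G (U t z) * H t z) s"
proof -
  have e: "0 + prim (H t) z = U t z" for z by (simp add: U_prim)
  have *: "F (U t b) - F (U t a) = (LINT z:{a..b}|lborel. G (U t z) * H t z)" if "a \<le> b" for a b
    using prim_chain_rule[OF H_loc FG GL, of 0 t a b] GH_loc that unfolding e by blast
  have U0: "U t 0 = 0" by (simp add: U_neg)
  show ?thesis
  proof (cases "0 \<le> s")
    case True
    then show ?thesis using *[OF True] prim_diff[OF GH_loc[of t] True] by (simp add: U0)
  next
    case False
    then have s: "s \<le> 0" by simp
    show ?thesis using *[OF s] prim_diff[OF GH_loc[of t] s] by (simp add: U0)
  qed
qed

lemma F_cont: "continuous_on S F"
  by (rule DERIV_continuous_on[OF has_field_derivative_at_within[OF FG]])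

lemma FU_cont_t: "continuous_on UNIV (\<lambda>t. F (U t s))"
  by (rule continuous_on_compose2[OF F_cont regD1[OF U_reg]]) auto

text \<open>Instead of differentiating under the label integral, the change of the length density is
  written as a time integral and the order is exchanged; by \<open>F_chain\<close> the inner label
  integral is then \<open>F (U \<tau> s) - F 0\<close>.\<close>

lemma X_time: "X t s = X 0 s + prim (\<lambda>\<tau>. F (U \<tau> s)) t"
proof -
  have Hc: "continuous_on UNIV (\<lambda>t. H t z)" for z
    by (rule DERIV_continuous_on[OF has_field_derivative_at_within[OF H_deriv]])
  have gc: "continuous_on UNIV (\<lambda>\<tau>. G (U \<tau> z) * H \<tau> z)" for z
    by (intro continuous_on_mult GV_cont[OF U_reg] Hc)
  have inner: "\<bar>M t z\<bar> powr r - \<bar>M 0 z\<bar> powr r = prim (\<lambda>\<tau>. G (U \<tau> z) * H \<tau> z) t" for z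
  proof -
    have "((\<lambda>y. \<bar>M y z\<bar> powr r - prim (\<lambda>\<tau>. G (U \<tau> z) * H \<tau> z) y) has_real_derivative
        G (U y z) * H y z - G (U y z) * H y z) (at y)" for y
      by (rule DERIV_diff[OF M_powr_deriv prim_has_derivative[OF gc]])
    then have "\<forall>y. ((\<lambda>y. \<bar>M y z\<bar> powr r - prim (\<lambda>\<tau>. G (U \<tau> z) * H \<tau> z) y) has_real_derivative 0) (at y)"
      by simp
    from DERIV_isconst_all[OF this, of t 0] show ?thesis by simp
  qed
  have "prim (\<lambda>z. \<bar>M t z\<bar> powr r) s - prim (\<lambda>z. \<bar>M 0 z\<bar> powr r) s
     = prim (\<lambda>z. \<bar>M t z\<bar> powr r - \<bar>M 0 z\<bar> powr r) s"
    by (rule prim_sub[symmetric]) (rule Mr_loc)+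
  also have "\<dots> = prim (\<lambda>z. prim (\<lambda>\<tau>. G (U \<tau> z) * H \<tau> z) t) s" by (simp only: inner)
  also have "\<dots> = prim (\<lambda>\<tau>. prim (\<lambda>z. G (U \<tau> z) * H \<tau> z) s) t"
  proof (rule prim_Fubini[where T="\<bar>t\<bar>"])
    show "(\<lambda>z. G (U (fst z) (snd z)) * H (fst z) (snd z)) \<in> borel_measurable borel"
      by (intro borel_measurable_times H_borel measurable_compose[OF U_borel G_borel])
    show "loc_integrable (\<lambda>s. C * (cT \<bar>t\<bar> * w s))" by (intro loc_integrable_scale lw)
    show "\<bar>G (U \<tau> z) * H \<tau> z\<bar> \<le> C * (cT \<bar>t\<bar> * w z)" if "\<bar>\<tau>\<bar> \<le> \<bar>t\<bar>" for \<tau> z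
      unfolding abs_mult using H_bound[OF that] by (intro mult_mono GC C0) auto
  qed simp
  also have "\<dots> = prim (\<lambda>\<tau>. F (U \<tau> s) - F 0) t" by (simp only: F_chain)
  also have "\<dots> = prim (\<lambda>\<tau>. F (U \<tau> s)) t - F 0 * t"
    using prim_sub[OF loc_integrable_continuous[OF FU_cont_t] loc_integrable_continuous[OF continuous_on_const], of s "F 0" t]
    by (simp add: prim_const)
  finally show ?thesis by (simp add: X_def)
qed

lemma X_deriv: "((\<lambda>t. X t s) has_real_derivative F (U t s)) (at t)"
proof -
  have "((\<lambda>t. X 0 s + prim (\<lambda>\<tau>. F (U \<tau> s)) t) has_real_derivative 0 + F (U t s)) (at t)"
    by (rule DERIV_add[OF DERIV_const prim_has_derivative[OF FU_cont_t]])
  then show ?thesis by (simp add: X_time[symmetric])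
qed

text \<open>The speed \<open>F\<close> may be unbounded, but on a compact box of times and labels
  \<open>F (U t s)\<close> is bounded by continuity.\<close>

lemma X_Lip_t:
  assumes "0 \<le> T" "0 \<le> S"
  obtains B where "0 \<le> B" "\<And>t t' s. \<bar>t\<bar> \<le> T \<Longrightarrow> \<bar>t'\<bar> \<le> T \<Longrightarrow> \<bar>s\<bar> \<le> S \<Longrightarrow> \<bar>X t s - X t' s\<bar> \<le> B * \<bar>t - t'\<bar>"
proof -
  have c: "continuous_on ({-T..T} \<times> {-S..S}) (\<lambda>z. F (U (fst z) (snd z)))"
    by (rule continuous_on_subset[OF continuous_on_compose2[OF F_cont U_cont]]) auto
  have "compact ((\<lambda>z. F (U (fst z) (snd z))) ` ({-T..T} \<times> {-S..S}))"
    by (intro compact_continuous_image c compact_Times) auto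
  then obtain B where B: "\<And>y. y \<in> (\<lambda>z. F (U (fst z) (snd z))) ` ({-T..T} \<times> {-S..S}) \<Longrightarrow> norm y \<le> B"
    by (meson bounded_iff compact_imp_bounded)
  have Bt: "\<bar>F (U t s)\<bar> \<le> \<bar>B\<bar>" if "\<bar>t\<bar> \<le> T" "\<bar>s\<bar> \<le> S" for t s
  proof -
    have "(t, s) \<in> {-T..T} \<times> {-S..S}" using that by auto
    then have "norm (F (U t s)) \<le> B" by (intro B image_eqI[of _ _ "(t, s)"]) auto
    then show ?thesis by simp
  qed
  show ?thesis
  proof (rule that[of "\<bar>B\<bar>"])
    fix t t' s assume h: "\<bar>t\<bar> \<le> T" "\<bar>t'\<bar> \<le> T" "\<bar>s\<bar> \<le> S"
    have "norm (X t s - X t' s) \<le> \<bar>B\<bar> * norm (t - t')"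
    proof (rule field_differentiable_bound[where S="{-T..T}" and f'="\<lambda>t. F (U t s)"])
      show "\<And>z. z \<in> {-T..T} \<Longrightarrow> ((\<lambda>t. X t s) has_field_derivative F (U z s)) (at z within {-T..T})"
        by (rule has_field_derivative_at_within[OF X_deriv])
      show "\<And>z. z \<in> {-T..T} \<Longrightarrow> norm (F (U z s)) \<le> \<bar>B\<bar>" using Bt h(3) by (simp add: abs_le_iff)
    qed (use h in \<open>auto simp: abs_le_iff\<close>)
    then show "\<bar>X t s - X t' s\<bar> \<le> \<bar>B\<bar> * \<bar>t - t'\<bar>" by simp
  qed simp
qed

lemma X_cont: "continuous_on UNIV (\<lambda>z. X (fst z) (snd z))"
proof -
  have "\<exists>B. \<forall>t t' s. \<bar>t\<bar> \<le> \<bar>R\<bar> \<longrightarrow> \<bar>t'\<bar> \<le> \<bar>R\<bar> \<longrightarrow> \<bar>s\<bar> \<le> \<bar>R\<bar> \<longrightarrow> \<bar>X t s - X t' s\<bar> \<le> B * \<bar>t - t'\<bar>" for R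
    by (rule X_Lip_t[of "\<bar>R\<bar>" "\<bar>R\<bar>"]) auto
  then obtain c where c: "\<And>R t t' s. \<bar>t\<bar> \<le> \<bar>R\<bar> \<Longrightarrow> \<bar>t'\<bar> \<le> \<bar>R\<bar> \<Longrightarrow> \<bar>s\<bar> \<le> \<bar>R\<bar> \<Longrightarrow> \<bar>X t s - X t' s\<bar> \<le> c R * \<bar>t - t'\<bar>"
    by metis
  show ?thesis
    by (rule joint_continuous[where c=c]) (auto intro!: c X_cont_s)
qed

text \<open>The energy |k|^r per label does not change in time, so the constant is uniform in
  \<open>t\<close>. Holder's inequality leaves the length of the interval to the power 1 - 1/r = 1 -
  lam.\<close>

lemma U_Holder:
  assumes ab: "a \<le> b" and E: "Wp b - Wp a \<le> E" "0 < E"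
  shows "\<bar>U t b - U t a\<bar> \<le> E powr (1 / r) * (X t b - X t a) powr (1 - 1 / r)"
proof -
  have kw: "\<bar>k z\<bar> powr r \<le> w z" for z unfolding w_def using r p0[of z] by (intro powr_mono2) auto
  have mk: "(\<lambda>z. \<bar>k z\<bar> powr r) \<in> borel_measurable borel" by measurable
  have lk: "loc_integrable (\<lambda>z. \<bar>k z\<bar> powr r)"
    by (rule loc_integrable_bound[OF lw mk]) (simp add: kw)
  have absH: "\<bar>H t z\<bar> = \<bar>k z\<bar> * \<bar>M t z\<bar> powr (r - 1)" for z
    by (simp add: H_def hA_def M_def abs_mult abs_spow)
  have iH: "set_integrable lborel {a..b} (\<lambda>z. \<bar>k z\<bar> * \<bar>M t z\<bar> powr (r - 1))"
    using set_integrable_abs[OF loc_integrableD[OF H_loc, of a b t]] by (simp add: absH)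
  have "\<bar>U t b - U t a\<bar> = \<bar>LINT z:{a..b}|lborel. H t z\<bar>"
    using prim_diff[OF H_loc ab] by (simp add: U_prim)
  also have "\<dots> \<le> (LINT z:{a..b}|lborel. \<bar>k z\<bar> * \<bar>M t z\<bar> powr (r - 1))"
    by (rule set_integral_abs_bound[OF iH]) (simp add: absH)
  also have "\<dots> \<le> E powr (1 / r) * (LINT z:{a..b}|lborel. \<bar>M t z\<bar> powr r) powr (1 - 1 / r)"
  proof (rule Holder_spow[OF r _ _ _ loc_integrableD[OF lk] loc_integrableD[OF Mr_loc] _ E(2) iH])
    have "(LINT z:{a..b}|lborel. \<bar>k z\<bar> powr r) \<le> (LINT z:{a..b}|lborel. w z)"
      by (rule set_integral_mono[OF loc_integrableD[OF lk] loc_integrableD[OF lw] kw])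
    then show "(LINT z:{a..b}|lborel. \<bar>k z\<bar> powr r) \<le> E"
      using E(1) prim_diff[OF lw ab] by (simp add: Wp_def)
  qed measurable
  also have "(LINT z:{a..b}|lborel. \<bar>M t z\<bar> powr r) = X t b - X t a" by (rule X_inc[OF ab, symmetric])
  finally show ?thesis .
qed

end

section \<open>The solution in Eulerian coordinates\<close>

text \<open>\<open>esc\<close> is the covering property that the fans will provide: bounded sets of
  points have bounded sets of labels, uniformly for bounded times. It is isolated here so that the
  passage to the variables x and t does not depend on how the labels were chosen.\<close>

locale char_sol = char_data +
  assumes F0: "0 \<le> F 0"
    and esc: "\<And>T B. \<exists>S. \<forall>t. \<bar>t\<bar> \<le> T \<longrightarrow> B \<le> X t S"
begin

section \<open>The leftmost label of a point\<close>

lemma X_low: "\<exists>s. X t s \<le> B"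
proof -
  have "X t (min 0 (B - F 0 * t)) = F 0 * t + min 0 (B - F 0 * t)" by (rule X_neg) simp
  also have "\<dots> \<le> B" by linarith
  finally show ?thesis by blast
qed

lemma X_surj: "\<exists>s. X t s = x"
proof -
  obtain a where a: "X t a \<le> x" using X_low by blast
  obtain b where b: "x \<le> X t b" using esc[of "\<bar>t\<bar>" x] by auto
  show ?thesis
  proof (cases "a \<le> b")
    case True
    have "\<exists>s\<ge>a. s \<le> b \<and> X t s = x"
      by (rule IVT'[OF a b True continuous_on_subset[OF X_cont_s]]) simp
    then show ?thesis by blast
  next
    case False
    then have "X t b \<le> X t a" by (intro X_mono) simp
    then show ?thesis using a b by (intro exI[of _ a]) simp
  qed
qed

text \<open>A plateau of \<open>X t\<close> carries many labels of one point, and the infimum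
  selects the first. This makes \<open>S\<close> adjoint to \<open>X t\<close> in the sense of
  \<open>S_le_iff\<close>, from which monotonicity and joint measurability follow.\<close>

definition S :: "real \<Rightarrow> real \<Rightarrow> real" where "S x t = Inf {s. x \<le> X t s}"

lemma S_set: "closed {s. x \<le> X t s}" "bdd_below {s. x \<le> X t s}" "{s. x \<le> X t s} \<noteq> {}"
proof -
  show "closed {s. x \<le> X t s}" by (rule closed_Collect_le[OF continuous_on_const X_cont_s])
  obtain a where a: "X t a = x - 1" using X_surj by blast
  show "bdd_below {s. x \<le> X t s}"
  proof (rule bdd_belowI[of _ a])
    fix s assume "s \<in> {s. x \<le> X t s}"
    then show "a \<le> s" using X_mono[of s a t] a by (cases "a \<le> s") auto
  qed
  obtain b where "X t b = x" using X_surj by blast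
  then show "{s. x \<le> X t s} \<noteq> {}" by force
qed

lemma S_le_iff: "S x t \<le> c \<longleftrightarrow> x \<le> X t c"
proof
  assume "S x t \<le> c"
  moreover have "S x t \<in> {s. x \<le> X t s}"
    unfolding S_def by (rule closed_contains_Inf) (fact S_set)+
  ultimately show "x \<le> X t c" using X_mono[of "S x t" c t] by simp
next
  assume "x \<le> X t c"
  then show "S x t \<le> c" unfolding S_def by (intro cInf_lower S_set) simp
qed

lemma X_S: "X t (S x t) = x"
proof -
  obtain b where b: "X t b = x" using X_surj by blast
  have "x \<le> X t (S x t)" using S_le_iff[of x t "S x t"] by simp
  moreover have "S x t \<le> b" using b by (simp add: S_le_iff)
  ultimately show ?thesis using X_mono[of "S x t" b t] b by simp
qed

lemma S_X_le: "S (X t s) t \<le> s" by (simp add: S_le_iff)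

lemma S_mono: "x \<le> y \<Longrightarrow> S x t \<le> S y t"
  unfolding S_le_iff by (simp add: X_S)

lemma S_borel: "(\<lambda>z. S (fst z) (snd z)) \<in> borel_measurable borel"
proof (rule borel_measurableI_le)
  fix c
  have "continuous_on UNIV (\<lambda>z::real\<times>real. (\<lambda>y. X (fst y) (snd y)) (snd z, c))"
    by (rule continuous_on_compose2[OF X_cont]) (auto intro!: continuous_intros)
  then have "closed {z::real\<times>real. fst z \<le> X (snd z) c}"
    by (intro closed_Collect_le continuous_intros) simp
  then show "{z \<in> space borel. S (fst z) (snd z) \<le> c} \<in> sets borel"
    by (simp add: S_le_iff borel_closed)
qed

section \<open>The solution, its slope and its boundary values\<close>

definition u :: "real \<times> real \<Rightarrow> real" where "u z = U (snd z) (S (fst z) (snd z))"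
text \<open>Where \<open>M\<close> vanishes the quotient is 0 by convention. Such labels have length
  density 0, so on each time slice the points concerned form a null set.\<close>

definition ux :: "real \<times> real \<Rightarrow> real" where
  "ux z = k (S (fst z) (snd z)) / M (snd z) (S (fst z) (snd z))"

text \<open>Labels of the same point carry the same value, by \<open>U_Holder\<close> with length 0;
  the \<open>+ 1\<close> only keeps its constant positive.\<close>

lemma u_X: "u (X t s, t) = U t s"
proof -
  have "\<bar>U t s - U t (S (X t s) t)\<bar> \<le>
      (Wp s - Wp (S (X t s) t) + 1) powr (1 / r) * (X t s - X t (S (X t s) t)) powr (1 - 1 / r)"
    by (rule U_Holder) (use S_X_le Wp_mono[OF S_X_le] in \<open>auto simp: add_nonneg_pos\<close>)
  then show ?thesis by (simp add: u_def X_S)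
qed

lemma ux_borel [measurable]: "ux \<in> borel_measurable borel"
proof -
  have 1: "(\<lambda>z. (snd z, S (fst z) (snd z))) \<in> borel_measurable (borel :: (real \<times> real) measure)"
    unfolding borel_prod[symmetric]
    by (rule measurable_Pair[OF _ S_borel[folded borel_prod]]) simp
  have "(\<lambda>z. M (snd z) (S (fst z) (snd z))) \<in> borel_measurable borel"
    using measurable_compose[OF 1 M_borel] by simp
  moreover have "(\<lambda>z. k (S (fst z) (snd z))) \<in> borel_measurable borel"
    by (rule measurable_compose[OF S_borel km])
  ultimately show ?thesis unfolding ux_def by (intro borel_measurable_divide)
qed

lemma ux_slice [measurable]: "(\<lambda>x. ux (x, t)) \<in> borel_measurable borel"
  using measurable_compose[OF measurable_Pair2' ux_borel[folded borel_prod], of t] by simp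

lemma plateau_AE:
  assumes "a \<le> b" "X t a = X t b"
  shows "AE s in lborel. s \<in> {a..b} \<longrightarrow> M t s = 0"
proof -
  have "(LINT z|lborel. indicator {a..b} z *\<^sub>R \<bar>M t z\<bar> powr r) = 0"
    using X_inc[OF assms(1), of t] assms(2) by (simp add: set_lebesgue_integral_def)
  moreover have "integrable lborel (\<lambda>z. indicator {a..b} z *\<^sub>R \<bar>M t z\<bar> powr r)"
    using loc_integrableD[OF Mr_loc, of a b t] by (simp add: set_integrable_def)
  ultimately have "AE z in lborel. indicator {a..b} z *\<^sub>R \<bar>M t z\<bar> powr r = 0"
    by (subst (asm) integral_nonneg_eq_0_iff_AE) (auto intro!: AE_I2)
  then show ?thesis by eventually_elim (auto simp: indicator_def split: if_splits)
qed

text \<open>If \<open>s\<close> is not the leftmost label of its point, some rational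
  \<open>q\<close> lies between the two labels, and \<open>s\<close> belongs to the plateau of
  \<open>q\<close>, on which \<open>M\<close> vanishes almost everywhere. Countably many exceptional
  sets arise in this way.\<close>

lemma S_X_AE: "AE s in lborel. M t s \<noteq> 0 \<longrightarrow> S (X t s) t = s"
proof -
  have "AE s in lborel. q \<le> s \<longrightarrow> X t s = X t q \<longrightarrow> M t s = 0" for q
  proof -
    obtain b where b: "X t b = X t q + 1" using X_surj by blast
    define Z where "Z = {s. X t s = X t q}"
    have cZ: "closed Z" unfolding Z_def by (rule closed_Collect_eq[OF X_cont_s continuous_on_const])
    have bd: "bdd_above Z"
    proof (rule bdd_aboveI[of _ b])
      fix s assume "s \<in> Z"
      then show "s \<le> b" using X_mono[of b s t] b by (cases "s \<le> b") (auto simp: Z_def)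
    qed
    have qZ: "q \<in> Z" by (simp add: Z_def)
    have "Sup Z \<in> Z" by (rule closed_contains_Sup[OF _ bd cZ]) (use qZ in blast)
    then have "X t q = X t (Sup Z)" by (simp add: Z_def)
    from plateau_AE[OF cSup_upper[OF qZ bd] this]
    have "AE s in lborel. s \<in> {q..Sup Z} \<longrightarrow> M t s = 0" .
    then show ?thesis
    proof eventually_elim
      case (elim s)
      show ?case using elim cSup_upper[OF _ bd, of s] by (auto simp: Z_def)
    qed
  qed
  then have "AE s in lborel. \<forall>q::rat. of_rat q \<le> s \<longrightarrow> X t s = X t (of_rat q) \<longrightarrow> M t s = 0"
    unfolding AE_all_countable by blast
  then show ?thesis
  proof eventually_elim
    case (elim s)
    show ?case
    proof (intro impI)
      assume M: "M t s \<noteq> 0"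
      show "S (X t s) t = s"
      proof (rule ccontr)
        assume "S (X t s) t \<noteq> s"
        then have "S (X t s) t < s" using S_X_le[of t s] by simp
        then obtain q where q: "S (X t s) t < of_rat q" "of_rat q < s" using of_rat_dense by blast
        have "X t s = X t (of_rat q)"
          using X_mono[of "S (X t s) t" "of_rat q" t] X_mono[of "of_rat q" s t] q by (simp add: X_S)
        with spec[OF elim, of q] q M show False by simp
      qed
    qed
  qed
qed

text \<open>Pull-backs to label coordinates of the slope, its energy and its square. At labels with
  \<open>M t s = 0\<close> the energy sits on a null set of points, where \<open>ux\<close> does not
  see it; hence the case distinctions.\<close>

lemma ux_AE:
  "AE s in lborel. \<bar>M t s\<bar> powr r * ux (X t s, t) = H t s"
  "AE s in lborel. \<bar>M t s\<bar> powr r * \<bar>ux (X t s, t)\<bar> powr r = (if M t s = 0 then 0 else \<bar>k s\<bar> powr r)"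
  "AE s in lborel. \<bar>M t s\<bar> powr r * (ux (X t s, t))\<^sup>2 = (if M t s = 0 then 0 else (k s)\<^sup>2 * \<bar>M t s\<bar> powr (r - 2))"
proof -
  show "AE s in lborel. \<bar>M t s\<bar> powr r * ux (X t s, t) = H t s"
    using S_X_AE[of t] by eventually_elim (auto simp: ux_def H_def hA_def M_def[symmetric] abs_powr_eq_spow)
  show "AE s in lborel. \<bar>M t s\<bar> powr r * \<bar>ux (X t s, t)\<bar> powr r = (if M t s = 0 then 0 else \<bar>k s\<bar> powr r)"
    using S_X_AE[of t] by eventually_elim (auto simp: ux_def abs_divide powr_divide)
  have b: "\<bar>m\<bar> powr r = m\<^sup>2 * \<bar>m\<bar> powr (r - 2)" if "m \<noteq> 0" for m :: real
    using powr_add[of "\<bar>m\<bar>" 2 "r - 2"] that by simp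
  show "AE s in lborel. \<bar>M t s\<bar> powr r * (ux (X t s, t))\<^sup>2 = (if M t s = 0 then 0 else (k s)\<^sup>2 * \<bar>M t s\<bar> powr (r - 2))"
    using S_X_AE[of t] by eventually_elim (auto simp: ux_def b power_divide)
qed

lemma X_slice_borel [measurable]: "X t \<in> borel_measurable borel"
  by (rule borel_measurable_continuous_onI[OF X_cont_s])

lemma push: "distr (density lborel (\<lambda>s. ennreal (\<bar>M t s\<bar> powr r))) borel (X t) = lborel"
proof -
  have "(\<lambda>s. \<bar>M t s\<bar> powr r) \<in> borel_measurable borel" by measurable
  from prim_pushforward[OF Mr_loc this _ X_inc X_cont_s X_surj] show ?thesis by simp
qed

lemma push_integrable_iff:
  fixes h :: "real \<Rightarrow> real"
  assumes "h \<in> borel_measurable borel"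
  shows "integrable lborel h \<longleftrightarrow> integrable lborel (\<lambda>s. \<bar>M t s\<bar> powr r * h (X t s))"
  using density_pushforward_integral(1)[OF _ _ _ push assms] by simp

lemma X_range_bounded:
  "\<exists>c d. c \<le> d \<and> (\<forall>s. X t s \<in> {a..b} \<longrightarrow> s \<in> {c..d})"
proof -
  obtain c where c: "X t c = a - 1" using X_surj by blast
  obtain d where d: "X t d = max a b + 1" using X_surj by blast
  have "c \<le> d" using X_mono[of d c t] c d by (cases "c \<le> d") auto
  moreover have "s \<in> {c..d}" if "X t s \<in> {a..b}" for s
    using X_mono[of s c t] X_mono[of d s t] c d that by (cases "c \<le> s"; cases "s \<le> d") auto
  ultimately show ?thesis by blast
qed

text \<open>Local integrability is checked in label coordinates, where it is enough to dominate the
  pull-back: the points of a bounded interval have labels in a bounded interval.\<close>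

lemma push_loc:
  fixes h g :: "real \<Rightarrow> real"
  assumes h: "h \<in> borel_measurable borel" and g: "loc_integrable g" "g \<in> borel_measurable borel"
    and le: "AE s in lborel. \<bar>\<bar>M t s\<bar> powr r * h (X t s)\<bar> \<le> g s"
  shows "loc_integrable h"
  unfolding loc_integrable_def
proof (intro allI)
  fix a b
  obtain c d where cd: "c \<le> d" "\<And>s. X t s \<in> {a..b} \<Longrightarrow> s \<in> {c..d}" using X_range_bounded[of t a b] by blast
  have m: "(\<lambda>x. indicator {a..b} x *\<^sub>R h x) \<in> borel_measurable borel" using h by measurable
  have "integrable lborel (\<lambda>s. \<bar>M t s\<bar> powr r * (indicator {a..b} (X t s) *\<^sub>R h (X t s)))"
  proof (rule Bochner_Integration.integrable_bound)
    show "integrable lborel (\<lambda>s. indicator {c..d} s *\<^sub>R g s)"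
      using loc_integrableD[OF g(1), of c d] by (simp add: set_integrable_def)
    show "(\<lambda>s. \<bar>M t s\<bar> powr r * (indicator {a..b} (X t s) *\<^sub>R h (X t s))) \<in> borel_measurable lborel"
      using h by measurable
    show "AE s in lborel. norm (\<bar>M t s\<bar> powr r * (indicator {a..b} (X t s) *\<^sub>R h (X t s))) \<le> norm (indicator {c..d} s *\<^sub>R g s)"
      using le
    proof eventually_elim
      case (elim s)
      show ?case using elim cd(2)[of s] by (cases "X t s \<in> {a..b}") auto
    qed
  qed
  then show "set_integrable lborel {a..b} h"
    unfolding set_integrable_def by (simp only: push_integrable_iff[OF m, of t])
qed

lemma ux_loc: "loc_integrable (\<lambda>x. ux (x, t))"
proof (rule push_loc[where t=t and g="\<lambda>s. cT \<bar>t\<bar> * w s"])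
  show "AE s in lborel. \<bar>\<bar>M t s\<bar> powr r * ux (X t s, t)\<bar> \<le> cT \<bar>t\<bar> * w s"
    using ux_AE(1)[of t] by eventually_elim (simp add: H_bound)
  show "(\<lambda>s. cT \<bar>t\<bar> * w s) \<in> borel_measurable borel" unfolding w_def by measurable
qed (intro ux_slice loc_integrable_scale lw)+

lemma ux_powr_loc: "loc_integrable (\<lambda>x. \<bar>ux (x, t)\<bar> powr r)"
proof (rule push_loc[where t=t and g=w])
  have kw: "\<bar>k z\<bar> powr r \<le> w z" for z unfolding w_def using r p0[of z] by (intro powr_mono2) auto
  show "AE s in lborel. \<bar>\<bar>M t s\<bar> powr r * \<bar>ux (X t s, t)\<bar> powr r\<bar> \<le> w s"
    using ux_AE(2)[of t] by eventually_elim (simp add: kw w0)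
  show "w \<in> borel_measurable borel" unfolding w_def by measurable
  show "(\<lambda>x. \<bar>ux (x, t)\<bar> powr r) \<in> borel_measurable borel" by measurable
qed (rule lw)

text \<open>Pulled back to labels, the slope becomes the density \<open>H\<close> of
  \<open>U\<close>, so the change of variables turns its integral into an increment of
  \<open>U\<close>.\<close>

lemma u_prim: "u (x, t) = u (0, t) + prim (\<lambda>x. ux (x, t)) x"
proof -
  have inc: "u (b, t) - u (a, t) = (LINT x:{a..b}|lborel. ux (x, t))" if ab: "a \<le> b" for a b
  proof -
    have "(LINT x:{a..b}|lborel. ux (x, t)) = (LINT s:{S a t..S b t}|lborel. \<bar>M t s\<bar> powr r * ux (X t s, t))"
      using prim_change_of_variables(2)[OF Mr_loc _ _ X_inc X_cont_s X_surj ux_loc[of t] ux_slice S_mono[OF ab]]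
      by (simp add: X_S)
    also have "\<dots> = (LINT s:{S a t..S b t}|lborel. H t s)"
      unfolding set_lebesgue_integral_def
    proof (rule integral_cong_AE)
      show "AE s in lborel. indicator {S a t..S b t} s *\<^sub>R (\<bar>M t s\<bar> powr r * ux (X t s, t)) = indicator {S a t..S b t} s *\<^sub>R H t s"
        using ux_AE(1)[of t] by eventually_elim simp
    qed measurable
    also have "\<dots> = U t (S b t) - U t (S a t)"
      using prim_diff[OF H_loc S_mono[OF ab], of t t] by (simp add: U_prim)
    finally show ?thesis by (simp add: u_def)
  qed
  show ?thesis
  proof (cases "0 \<le> x")
    case True
    then show ?thesis using inc[OF True] prim_diff[OF ux_loc[of t] True] by simp
  next
    case False
    then have x: "x \<le> 0" by simp
    show ?thesis using inc[OF x] prim_diff[OF ux_loc[of t] x] by simp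
  qed
qed

text \<open>The label \<open>- F 0 * t\<close> is at x = 0 at time \<open>t\<close>; it is
  nonpositive by \<open>F0\<close>, and \<open>U\<close> vanishes on such labels.\<close>

lemma u_boundary: assumes "0 \<le> t" shows "u (0, t) = 0"
proof -
  have le: "- F 0 * t \<le> 0" using assms F0 by simp
  have "X t (- F 0 * t) = 0" using X_neg[OF le, of t] by simp
  then have "u (0, t) = U t (- F 0 * t)" using u_X[of t "- F 0 * t"] by simp
  then show ?thesis using U_neg[OF le] by simp
qed

lemma u_initial: "u (X 0 s, 0) = prim (\<lambda>z. k z * spow (r - 1) (p z)) s"
proof -
  have "A 0 z = 0" for z using A_bound[of 0 0 z] by simp
  then have "H 0 = (\<lambda>z. k z * spow (r - 1) (p z))" by (simp add: fun_eq_iff H_def hA_def mA_def)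
  then show ?thesis by (simp add: u_X U_prim)
qed

lemma u_cont_x: "continuous_on UNIV (\<lambda>x. u (x, t))"
proof -
  have "continuous_on UNIV (\<lambda>x. u (0, t) + prim (\<lambda>x. ux (x, t)) x)" by (intro continuous_intros ux_loc)
  then show ?thesis by (rule continuous_on_eq) (rule u_prim[symmetric])
qed

lemma u_weak_derivative: "weak_derivative_on Y (\<lambda>x. u (x, t)) (\<lambda>x. ux (x, t))"
  by (rule weak_derivative_prim[OF ux_loc ux_slice u_prim])

lemma u_sobolev: "sobolev_W1_loc r (\<lambda>x. u (x, t))"
  unfolding sobolev_W1_loc_def
proof (intro conjI allI impI)
  show "continuous_on {0..} (\<lambda>x. u (x, t))" by (rule continuous_on_subset[OF u_cont_x]) simp
  fix a b :: real assume "0 \<le> a \<and> a < b"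
  have Lp: "Lp_on r {a<..<b} h" if "h \<in> borel_measurable borel" "loc_integrable (\<lambda>x. \<bar>h x\<bar> powr r)" for h
    unfolding Lp_on_def
  proof
    show "set_borel_measurable lborel {a<..<b} h"
      unfolding set_borel_measurable_def using that(1) by measurable
    show "set_integrable lborel {a<..<b} (\<lambda>x. \<bar>h x\<bar> powr r)"
      by (rule set_integrable_subset[OF loc_integrableD[OF that(2), of a b]]) auto
  qed
  show "sobolev_W1 r {a<..<b} (\<lambda>x. u (x, t))"
    unfolding sobolev_W1_def
  proof (intro conjI exI[of _ "\<lambda>x. ux (x, t)"] u_weak_derivative Lp ux_slice ux_powr_loc)
    show "(\<lambda>x. u (x, t)) \<in> borel_measurable borel" by (rule borel_measurable_continuous_onI[OF u_cont_x])
    have "continuous_on UNIV (\<lambda>x. \<bar>u (x, t)\<bar> powr r)"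
      using r by (intro continuous_on_powr' continuous_intros u_cont_x) auto
    then show "loc_integrable (\<lambda>x. \<bar>u (x, t)\<bar> powr r)" by (rule loc_integrable_continuous)
  qed
qed

text \<open>In space this is \<open>U_Holder\<close>. In time, the label at (x', t) is followed to
  time t': its value changes at a Lipschitz rate, and its position misses x' by at most a multiple
  of |t - t'|, an error in space to which \<open>U_Holder\<close> applies again.\<close>

lemma u_locally_Holder: "locally_holder_on (1 - 1 / r) ({0..} \<times> {0..}) u"
  unfolding locally_holder_on_def
proof (intro allI impI, elim conjE)
  fix K :: "(real \<times> real) set" assume K: "compact K" "K \<subseteq> {0..} \<times> {0..}"
  define \<alpha> where "\<alpha> = 1 - 1 / r"
  have \<alpha>: "0 < \<alpha>" "\<alpha> \<le> 1" using r by (auto simp: \<alpha>_def field_simps)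
  obtain R where R: "\<And>z. z \<in> K \<Longrightarrow> norm z \<le> R" using compact_imp_bounded[OF K(1)] by (auto simp: bounded_iff)
  define R1 where "R1 = \<bar>R\<bar> + 1"
  have R1: "1 \<le> R1" by (simp add: R1_def)
  have Kb: "0 \<le> x" "x \<le> R1" "0 \<le> t" "t \<le> R1" if "(x, t) \<in> K" for x t
    using R[OF that] K(2) that norm_fst_le[of x t] norm_snd_le[of t x] by (auto simp: R1_def)
  obtain S1 where S1: "\<And>t. \<bar>t\<bar> \<le> R1 \<Longrightarrow> R1 \<le> X t S1" using esc by blast
  \<comment> \<open>A bound for all labels of the compact set: from above by \<open>esc\<close>,
    from below because nonpositive labels sit at \<open>F 0 * t + s\<close>.\<close>
  define B where "B = max \<bar>S1\<bar> (F 0 * R1)"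
  have B0: "0 \<le> B" by (simp add: B_def)
  have SB: "\<bar>S x t\<bar> \<le> B" if "0 \<le> x" "x \<le> R1" "\<bar>t\<bar> \<le> R1" for x t
  proof -
    have "S x t \<le> S1" unfolding S_le_iff using S1[OF that(3)] that(2) by simp
    moreover have "- B \<le> S x t"
    proof (cases "0 \<le> S x t")
      case True then show ?thesis using B0 by linarith
    next
      case False
      then have "x = F 0 * t + S x t" using X_neg[of "S x t" t] X_S[of t x] by simp
      then have "- (F 0 * t) \<le> S x t" using that(1) by linarith
      moreover have "F 0 * t \<le> F 0 * R1" using that(3) F0 by (intro mult_left_mono) auto
      ultimately show ?thesis by (simp add: B_def)
    qed
    ultimately show ?thesis by (auto simp: B_def)
  qed
  obtain BX where BX: "0 \<le> BX" "\<And>t t' s. \<bar>t\<bar> \<le> R1 \<Longrightarrow> \<bar>t'\<bar> \<le> R1 \<Longrightarrow> \<bar>s\<bar> \<le> B \<Longrightarrow> \<bar>X t s - X t' s\<bar> \<le> BX * \<bar>t - t'\<bar>"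
    using X_Lip_t[of R1 B] R1 B0 by auto
  define E where "E = Wp B - Wp (- B) + 1"
  have E: "0 < E" using Wp_mono[of "-B" B] B0 by (simp add: E_def)
  define e where "e = E powr (1 / r)"
  have e0: "0 \<le> e" by (simp add: e_def)
  have UH: "\<bar>U t b - U t a\<bar> \<le> e * \<bar>X t b - X t a\<bar> powr \<alpha>" if ab: "\<bar>a\<bar> \<le> B" "\<bar>b\<bar> \<le> B" for t a b
  proof -
    have *: "\<bar>U t b - U t a\<bar> \<le> e * \<bar>X t b - X t a\<bar> powr \<alpha>" if "\<bar>a\<bar> \<le> B" "\<bar>b\<bar> \<le> B" "a \<le> b" for a b
    proof -
      have "Wp b - Wp a \<le> E"
        using Wp_mono[of b B] Wp_mono[of "-B" a] that by (simp add: E_def abs_le_iff)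
      from U_Holder[OF that(3) this E, of t] show ?thesis
        using X_mono[OF that(3), of t] by (simp add: e_def \<alpha>_def)
    qed
    show ?thesis
    proof (cases "a \<le> b")
      case True then show ?thesis by (intro * ab)
    next
      case False
      then have "b \<le> a" by simp
      from *[OF ab(2) ab(1) this] show ?thesis by (simp add: abs_minus_commute)
    qed
  qed
  define D where "D = cT R1 * Wp B * C"
  have D0: "0 \<le> D" using cT0 C0 Wp_mono[OF B0] by (simp add: D_def)
  define Q where "Q = e + (D * R1 powr (1 - \<alpha>) + e * BX powr \<alpha>)"
  show "\<exists>Q. \<forall>p\<in>K. \<forall>q\<in>K. \<bar>u p - u q\<bar> \<le> Q * dist p q powr (1 - 1 / r)"
  proof (intro exI ballI)
    fix z z' assume z: "z \<in> K" "z' \<in> K"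
    obtain x t x' t' where zz: "z = (x, t)" "z' = (x', t')" by (cases z, cases z')
    note b = Kb[OF z(1)[unfolded zz]] Kb[OF z(2)[unfolded zz]]
    have tt: "\<bar>t\<bar> \<le> R1" "\<bar>t'\<bar> \<le> R1" "\<bar>t - t'\<bar> \<le> R1" using b by auto
    define d where "d = dist z z'"
    have d: "\<bar>x - x'\<bar> \<le> d" "\<bar>t - t'\<bar> \<le> d"
      using dist_fst_le[of z z'] dist_snd_le[of z z'] by (simp_all add: d_def zz dist_real_def)
    have d0: "0 \<le> d" by (simp add: d_def)
    have 1: "\<bar>u (x, t) - u (x', t)\<bar> \<le> e * d powr \<alpha>"
    proof -
      have "\<bar>u (x, t) - u (x', t)\<bar> \<le> e * \<bar>x - x'\<bar> powr \<alpha>"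
        using UH[OF SB SB, of x' t x t t] b tt by (simp add: u_def X_S)
      also have "\<dots> \<le> e * d powr \<alpha>" using \<alpha> d by (intro mult_left_mono e0 powr_mono2) auto
      finally show ?thesis .
    qed
    define s where "s = S x' t"
    define s' where "s' = S x' t'"
    have ss: "\<bar>s\<bar> \<le> B" "\<bar>s'\<bar> \<le> B" unfolding s_def s'_def using b tt by (auto intro!: SB)
    have 2: "\<bar>U t s - U t' s\<bar> \<le> D * R1 powr (1 - \<alpha>) * d powr \<alpha>"
    proof -
      have "\<bar>U t s - U t' s\<bar> \<le> D * \<bar>t - t'\<bar>"
        unfolding D_def using ss by (intro U_Lip_t tt) (auto simp: B0)
      also have "\<bar>t - t'\<bar> \<le> R1 powr (1 - \<alpha>) * d powr \<alpha>"
      proof (cases "t = t'")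
        case False
        then have "\<bar>t - t'\<bar> = \<bar>t - t'\<bar> powr (1 - \<alpha>) * \<bar>t - t'\<bar> powr \<alpha>"
          by (simp add: powr_add[symmetric])
        also have "\<dots> \<le> R1 powr (1 - \<alpha>) * d powr \<alpha>"
          using \<alpha> d tt by (intro mult_mono powr_mono2) auto
        finally show ?thesis .
      qed simp
      then have "D * \<bar>t - t'\<bar> \<le> D * (R1 powr (1 - \<alpha>) * d powr \<alpha>)" by (rule mult_left_mono[OF _ D0])
      finally show ?thesis by (simp add: mult.assoc)
    qed
    have 3: "\<bar>U t' s - U t' s'\<bar> \<le> e * BX powr \<alpha> * d powr \<alpha>"
    proof -
      have "X t' s' = X t s" by (simp add: s_def s'_def X_S)
      then have "\<bar>U t' s - U t' s'\<bar> \<le> e * \<bar>X t' s - X t s\<bar> powr \<alpha>"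
        using UH[OF ss(2) ss(1), of t'] by simp
      also have "\<dots> \<le> e * (BX * d) powr \<alpha>"
      proof (intro mult_left_mono e0 powr_mono2)
        have "\<bar>X t' s - X t s\<bar> \<le> BX * \<bar>t' - t\<bar>" by (rule BX(2)[OF tt(2,1) ss(1)])
        also have "\<dots> \<le> BX * d" using d(2) by (intro mult_left_mono BX) (simp add: abs_minus_commute)
        finally show "\<bar>X t' s - X t s\<bar> \<le> BX * d" .
      qed (use \<alpha> in auto)
      also have "\<dots> = e * BX powr \<alpha> * d powr \<alpha>" using BX d0 by (simp add: powr_mult)
      finally show ?thesis .
    qed
    have "u (x', t) = U t s" "u (x', t') = U t' s'" by (simp_all add: u_def s_def s'_def)
    then have "\<bar>u (x, t) - u (x', t')\<bar> \<le> e * d powr \<alpha> + (D * R1 powr (1 - \<alpha>) * d powr \<alpha> + e * BX powr \<alpha> * d powr \<alpha>)"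
      using 1 2 3 by linarith
    also have "\<dots> = Q * d powr \<alpha>" by (simp add: Q_def algebra_simps)
    finally show "\<bar>u z - u z'\<bar> \<le> Q * dist z z' powr (1 - 1 / r)"
      by (simp add: zz d_def \<alpha>_def)
  qed
qed

end

section \<open>The weak form\<close>

lemma C1_fun_pairD:
  fixes \<phi> :: "real \<times> real \<Rightarrow> real"
  assumes "C1_fun \<phi>"
  shows "continuous_on UNIV \<phi>" "continuous_on UNIV (partial_x \<phi>)" "continuous_on UNIV (partial_t \<phi>)"
    and "(\<xi> has_real_derivative c) (at t) \<Longrightarrow>
      ((\<lambda>t. \<phi> (\<xi> t, t)) has_real_derivative partial_t \<phi> (\<xi> t, t) + c * partial_x \<phi> (\<xi> t, t)) (at t)"
proof -
  obtain D where D: "\<And>p. (\<phi> has_derivative blinfun_apply (D p)) (at p)" and c: "continuous_on UNIV D"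
    using assms unfolding C1_fun_def by blast
  have lin: "blinfun_apply (D p) (a, b) = a * blinfun_apply (D p) (1, 0) + b * blinfun_apply (D p) (0, 1)" for p a b
  proof -
    have "(a, b) = a *\<^sub>R (1, 0) + b *\<^sub>R (0, 1 :: real)" by simp
    then show ?thesis by (simp only: blinfun.add_right blinfun.scaleR_right) simp
  qed
  have px: "partial_x \<phi> = (\<lambda>p. blinfun_apply (D p) (1, 0))"
  proof
    fix p :: "real \<times> real"
    obtain x t where p: "p = (x, t)" by (cases p)
    have "((\<lambda>y. (y, t)) has_derivative (\<lambda>h. (h, 0))) (at x)"
      by (intro has_derivative_Pair has_derivative_ident has_derivative_const)
    from has_derivative_compose[OF this D] have "((\<lambda>y. \<phi> (y, t)) has_derivative (\<lambda>h. blinfun_apply (D (x, t)) (h, 0))) (at x)" .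
    also have "(\<lambda>h. blinfun_apply (D (x, t)) (h, 0)) = (*) (blinfun_apply (D (x, t)) (1, 0))"
    proof
      fix h show "blinfun_apply (D (x, t)) (h, 0) = blinfun_apply (D (x, t)) (1, 0) * h"
        using lin[of "(x, t)" h 0] by (simp add: mult.commute)
    qed
    finally have "((\<lambda>y. \<phi> (y, t)) has_real_derivative blinfun_apply (D (x, t)) (1, 0)) (at x)"
      by (simp only: has_field_derivative_def)
    then show "partial_x \<phi> p = blinfun_apply (D p) (1, 0)"
      by (simp add: p partial_x_def DERIV_imp_deriv)
  qed
  have pt: "partial_t \<phi> = (\<lambda>p. blinfun_apply (D p) (0, 1))"
  proof
    fix p :: "real \<times> real"
    obtain x t where p: "p = (x, t)" by (cases p)
    have "((\<lambda>y. (x, y)) has_derivative (\<lambda>h. (0, h))) (at t)"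
      by (intro has_derivative_Pair has_derivative_ident has_derivative_const)
    from has_derivative_compose[OF this D] have "((\<lambda>y. \<phi> (x, y)) has_derivative (\<lambda>h. blinfun_apply (D (x, t)) (0, h))) (at t)" .
    also have "(\<lambda>h. blinfun_apply (D (x, t)) (0, h)) = (*) (blinfun_apply (D (x, t)) (0, 1))"
    proof
      fix h show "blinfun_apply (D (x, t)) (0, h) = blinfun_apply (D (x, t)) (0, 1) * h"
        using lin[of "(x, t)" 0 h] by (simp add: mult.commute)
    qed
    finally have "((\<lambda>y. \<phi> (x, y)) has_real_derivative blinfun_apply (D (x, t)) (0, 1)) (at t)"
      by (simp only: has_field_derivative_def)
    then show "partial_t \<phi> p = blinfun_apply (D p) (0, 1)"
      by (simp add: p partial_t_def DERIV_imp_deriv)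
  qed
  show "continuous_on UNIV (partial_x \<phi>)" unfolding px by (intro continuous_intros c)
  show "continuous_on UNIV (partial_t \<phi>)" unfolding pt by (intro continuous_intros c)
  show "continuous_on UNIV \<phi>"
    by (rule has_derivative_continuous_on) (rule has_derivative_at_withinI[OF D])
  show "((\<lambda>t. \<phi> (\<xi> t, t)) has_real_derivative partial_t \<phi> (\<xi> t, t) + c * partial_x \<phi> (\<xi> t, t)) (at t)"
    if "(\<xi> has_real_derivative c) (at t)"
  proof -
    have "((\<lambda>t. (\<xi> t, t)) has_derivative (\<lambda>h. (c * h, h))) (at t)"
      using that by (intro has_derivative_Pair has_derivative_ident) (simp add: has_field_derivative_def)
    from has_derivative_compose[OF this D]
    have "((\<lambda>t. \<phi> (\<xi> t, t)) has_derivative (\<lambda>h. blinfun_apply (D (\<xi> t, t)) (c * h, h))) (at t)" .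
    also have "(\<lambda>h. blinfun_apply (D (\<xi> t, t)) (c * h, h)) = (*) (partial_t \<phi> (\<xi> t, t) + c * partial_x \<phi> (\<xi> t, t))"
    proof
      fix h
      show "blinfun_apply (D (\<xi> t, t)) (c * h, h) = (partial_t \<phi> (\<xi> t, t) + c * partial_x \<phi> (\<xi> t, t)) * h"
        using lin[of "(\<xi> t, t)" "c * h" h] by (simp add: px pt algebra_simps)
    qed
    finally show ?thesis by (simp only: has_field_derivative_def)
  qed
qed

lemma partial_off_closure:
  fixes \<phi> :: "real \<times> real \<Rightarrow> real"
  assumes z: "z \<notin> closure {p. \<phi> p \<noteq> 0}"
  shows "partial_x \<phi> z = 0" "partial_t \<phi> z = 0"
proof -
  obtain x t where p: "z = (x, t)" by (cases z)
  define K where "K = closure {p. \<phi> p \<noteq> 0}"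
  have oK: "open (- K)" unfolding K_def by (rule open_Compl[OF closed_closure])
  have ox: "open ((\<lambda>y. (y, t)) -` (- K))" by (rule open_vimage[OF oK]) (intro continuous_intros)
  have ot: "open ((\<lambda>y. (x, y)) -` (- K))" by (rule open_vimage[OF oK]) (intro continuous_intros)
  have v: "0 = \<phi> q" if "q \<in> - K" for q using vanish_off_closure[of q \<phi>] that by (simp add: K_def)
  have zK: "(x, t) \<in> - K" using z by (simp add: K_def p)
  have "((\<lambda>y. \<phi> (y, t)) has_real_derivative 0) (at x)"
  proof (rule has_field_derivative_transform_within_open[OF DERIV_const ox])
    show "x \<in> (\<lambda>y. (y, t)) -` (- K)" using zK by (rule vimageI2)
    show "0 = \<phi> (y, t)" if "y \<in> (\<lambda>y. (y, t)) -` (- K)" for y using that by (intro v) (rule vimageD)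
  qed
  then show "partial_x \<phi> z = 0" by (simp add: p partial_x_def DERIV_imp_deriv)
  have "((\<lambda>y. \<phi> (x, y)) has_real_derivative 0) (at t)"
  proof (rule has_field_derivative_transform_within_open[OF DERIV_const ot])
    show "t \<in> (\<lambda>y. (x, y)) -` (- K)" using zK by (rule vimageI2)
    show "0 = \<phi> (x, y)" if "y \<in> (\<lambda>y. (x, y)) -` (- K)" for y using that by (intro v) (rule vimageD)
  qed
  then show "partial_t \<phi> z = 0" by (simp add: p partial_t_def DERIV_imp_deriv)
qed

lemma integral_derivative_compact_support:
  fixes y y' :: "real \<Rightarrow> real"
  assumes d: "\<And>t. (y has_real_derivative y' t) (at t)" and c: "continuous_on UNIV y'"
    and z: "\<And>t. T < \<bar>t\<bar> \<Longrightarrow> y t = 0" "\<And>t. T < \<bar>t\<bar> \<Longrightarrow> y' t = 0" and "0 \<le> T"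
  shows "(LINT t|lborel. y' t) = 0"
proof -
  have l: "loc_integrable y'" by (rule loc_integrable_continuous[OF c])
  have "\<forall>x. ((\<lambda>x. y x - prim y' x) has_real_derivative 0) (at x)"
  proof
    fix x show "((\<lambda>x. y x - prim y' x) has_real_derivative 0) (at x)"
      using DERIV_diff[OF d prim_has_derivative[OF c], of x] by simp
  qed
  from DERIV_isconst_all[OF this, of "T + 1" "-(T + 1)"]
  have "prim y' (T + 1) - prim y' (-(T + 1)) = 0"
    using z(1)[of "T + 1"] z(1)[of "-(T + 1)"] \<open>0 \<le> T\<close> by simp
  then have "(LINT t:{-(T + 1)..T + 1}|lborel. y' t) = 0"
    using prim_diff[OF l, of "-(T+1)" "T+1"] \<open>0 \<le> T\<close> by simp
  moreover have e: "indicator {-(T + 1)..T + 1} t *\<^sub>R y' t = y' t" for t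
  proof (cases "t \<in> {-(T + 1)..T + 1}")
    case False
    then have "T < \<bar>t\<bar>" by auto
    from z(2)[OF this] show ?thesis by simp
  qed simp
  ultimately show ?thesis by (simp only: set_lebesgue_integral_def e)
qed

section \<open>Pull-back of the weak form to label coordinates\<close>

context char_sol
begin

text \<open>Label coordinates are ordered as (t, s), points as (x, t).\<close>

definition \<Psi> :: "real \<times> real \<Rightarrow> real \<times> real" where "\<Psi> z = (X (fst z) (snd z), fst z)"

lemma \<Psi>_cont: "continuous_on UNIV \<Psi>"
  unfolding \<Psi>_def by (intro continuous_on_Pair X_cont continuous_on_fst continuous_on_id)

lemma \<Psi>_borel: "\<Psi> \<in> borel_measurable borel"
  by (rule borel_measurable_continuous_onI[OF \<Psi>_cont])

text \<open>By Tonelli this reduces to \<open>push\<close> on each time slice, which takes the place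
  of a Jacobian of the map of the plane.\<close>

lemma push2: "distr (density (lborel \<Otimes>\<^sub>M lborel) (\<lambda>z. ennreal (\<bar>M (fst z) (snd z)\<bar> powr r))) borel \<Psi> = lborel"
proof (rule measure_eqI)
  fix B assume "B \<in> sets (distr (density (lborel \<Otimes>\<^sub>M lborel) (\<lambda>z. ennreal (\<bar>M (fst z) (snd z)\<bar> powr r))) borel \<Psi>)"
  then have B: "B \<in> sets borel" by simp
  then have B2: "B \<in> sets (lborel \<Otimes>\<^sub>M lborel)" by (simp only: lborel_prod sets_lborel)
  have mM: "(\<lambda>z. ennreal (\<bar>M (fst z) (snd z)\<bar> powr r)) \<in> borel_measurable (lborel \<Otimes>\<^sub>M lborel)"
    unfolding lborel_prod using M_borel by measurable
  have m\<Psi>: "\<Psi> \<in> measurable (density (lborel \<Otimes>\<^sub>M lborel) (\<lambda>z. ennreal (\<bar>M (fst z) (snd z)\<bar> powr r))) borel"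
    using \<Psi>_borel by (simp add: lborel_prod)
  have mB: "\<Psi> -` B \<in> sets (lborel \<Otimes>\<^sub>M lborel)"
    using measurable_sets[OF \<Psi>_borel B] by (simp only: space_borel Int_UNIV_right lborel_prod sets_lborel)
  have "emeasure (distr (density (lborel \<Otimes>\<^sub>M lborel) (\<lambda>z. ennreal (\<bar>M (fst z) (snd z)\<bar> powr r))) borel \<Psi>) B
     = emeasure (density (lborel \<Otimes>\<^sub>M lborel) (\<lambda>z. ennreal (\<bar>M (fst z) (snd z)\<bar> powr r))) (\<Psi> -` B)"
    using emeasure_distr[OF m\<Psi> B] by (simp add: space_pair_measure)
  also have "\<dots> = (\<integral>\<^sup>+ z. ennreal (\<bar>M (fst z) (snd z)\<bar> powr r) * indicator (\<Psi> -` B) z \<partial>(lborel \<Otimes>\<^sub>M lborel))"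
    by (rule emeasure_density[OF mM mB])
  also have "\<dots> = (\<integral>\<^sup>+ t. \<integral>\<^sup>+ s. ennreal (\<bar>M t s\<bar> powr r) * indicator (\<Psi> -` B) (t, s) \<partial>lborel \<partial>lborel)"
    using lborel.nn_integral_fst[OF borel_measurable_times_ennreal[OF mM borel_measurable_indicator[OF mB]]] by simp
  also have "\<dots> = (\<integral>\<^sup>+ t. \<integral>\<^sup>+ x. indicator B (x, t) \<partial>lborel \<partial>lborel)"
  proof (rule nn_integral_cong)
    fix t :: real
    have mt: "(\<lambda>x. indicator B (x, t) :: ennreal) \<in> borel_measurable borel"
    proof -
      have "B \<in> sets (borel \<Otimes>\<^sub>M borel)" using B by (simp only: borel_prod)
      from measurable_compose[OF measurable_Pair2' borel_measurable_indicator[OF this], of t]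
      show ?thesis by simp
    qed
    have mM1: "(\<lambda>s. ennreal (\<bar>M t s\<bar> powr r)) \<in> borel_measurable lborel" by measurable
    have "(\<integral>\<^sup>+ x. indicator B (x, t) \<partial>lborel)
        = (\<integral>\<^sup>+ x. indicator B (x, t) \<partial>distr (density lborel (\<lambda>s. ennreal (\<bar>M t s\<bar> powr r))) borel (X t))"
      by (simp only: push)
    also have "\<dots> = (\<integral>\<^sup>+ s. indicator B (X t s, t) \<partial>density lborel (\<lambda>s. ennreal (\<bar>M t s\<bar> powr r)))"
      by (rule nn_integral_distr) (use mt in simp_all)
    also have "\<dots> = (\<integral>\<^sup>+ s. ennreal (\<bar>M t s\<bar> powr r) * indicator B (X t s, t) \<partial>lborel)"
      by (rule nn_integral_density[OF mM1]) (use measurable_compose[OF X_slice_borel mt] in simp)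
    finally show "(\<integral>\<^sup>+ s. ennreal (\<bar>M t s\<bar> powr r) * indicator (\<Psi> -` B) (t, s) \<partial>lborel) = (\<integral>\<^sup>+ x. indicator B (x, t) \<partial>lborel)"
      by (simp add: \<Psi>_def indicator_def)
  qed
  also have "\<dots> = (\<integral>\<^sup>+ z. indicator B z \<partial>(lborel \<Otimes>\<^sub>M lborel))"
    by (rule lborel_pair.nn_integral_snd) (rule borel_measurable_indicator[OF B2])
  also have "\<dots> = emeasure lborel B" using B by (simp add: lborel_prod)
  finally show "emeasure (distr (density (lborel \<Otimes>\<^sub>M lborel) (\<lambda>z. ennreal (\<bar>M (fst z) (snd z)\<bar> powr r))) borel \<Psi>) B = emeasure lborel B" .
qed simp

lemma push2_integral:
  fixes h :: "real \<times> real \<Rightarrow> real"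
  assumes h: "h \<in> borel_measurable borel"
  shows "integrable lborel h \<longleftrightarrow> integrable (lborel \<Otimes>\<^sub>M lborel) (\<lambda>z. \<bar>M (fst z) (snd z)\<bar> powr r * h (\<Psi> z))"
    and "(LINT z|lborel. h z) = (LINT z|(lborel \<Otimes>\<^sub>M lborel). \<bar>M (fst z) (snd z)\<bar> powr r * h (\<Psi> z))"
proof -
  have m\<Psi>: "\<Psi> \<in> measurable (lborel \<Otimes>\<^sub>M lborel) borel" using \<Psi>_borel by (simp add: lborel_prod)
  have mM: "(\<lambda>z. \<bar>M (fst z) (snd z)\<bar> powr r) \<in> borel_measurable (lborel \<Otimes>\<^sub>M lborel)"
    unfolding lborel_prod using M_borel by measurable
  note P = density_pushforward_integral[OF m\<Psi> mM _ push2 h]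
  show "integrable lborel h \<longleftrightarrow> integrable (lborel \<Otimes>\<^sub>M lborel) (\<lambda>z. \<bar>M (fst z) (snd z)\<bar> powr r * h (\<Psi> z))"
    by (rule P(1)) simp
  show "(LINT z|lborel. h z) = (LINT z|(lborel \<Otimes>\<^sub>M lborel). \<bar>M (fst z) (snd z)\<bar> powr r * h (\<Psi> z))"
    by (rule P(2)) simp
qed

lemma u_borel [measurable]: "u \<in> borel_measurable borel"
proof -
  have 1: "(\<lambda>z. (snd z, S (fst z) (snd z))) \<in> borel_measurable (borel :: (real \<times> real) measure)"
    unfolding borel_prod[symmetric]
    by (rule measurable_Pair[OF _ S_borel[folded borel_prod]]) simp
  show ?thesis using measurable_compose[OF 1 U_borel] by (simp add: u_def[abs_def])
qed

definition weak_integrand :: "(real \<times> real \<Rightarrow> real) \<Rightarrow> real \<times> real \<Rightarrow> real" where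
  "weak_integrand \<phi> z = - ux z * (partial_t \<phi> z + F (u z) * partial_x \<phi> z) + (1 / r - 1) * G (u z) * (ux z)\<^sup>2 * \<phi> z"

lemma F_borel [measurable]: "F \<in> borel_measurable borel"
  by (rule borel_measurable_continuous_onI[OF F_cont])

text \<open>Stated on the whole plane, to which labels and times have been extended, so that no
  boundary terms arise. The pulled-back integrand is almost everywhere \<open>\<Theta>\<close>, and
  for a fixed label \<open>\<Theta>\<close> is for almost all times minus the derivative of
  \<open>H t s * \<phi> (X t s, t)\<close>, a function of compact support in
  \<open>t\<close>.\<close>

lemma weak_integrand_integral:
  assumes C1: "C1_fun \<phi>" and K: "compact (closure {p. \<phi> p \<noteq> 0})"
  shows "integrable lborel (weak_integrand \<phi>)" "(LINT z|lborel. weak_integrand \<phi> z) = 0"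
proof -
  note \<phi>D = C1_fun_pairD[OF C1]
  have [measurable]: "\<phi> \<in> borel_measurable borel" "partial_x \<phi> \<in> borel_measurable borel"
      "partial_t \<phi> \<in> borel_measurable borel"
    by (intro borel_measurable_continuous_onI \<phi>D)+
  have mwi: "weak_integrand \<phi> \<in> borel_measurable borel" unfolding weak_integrand_def by measurable
  \<comment> \<open>The derivative of \<open>\<phi>\<close> along the characteristic of a
    label.\<close>
  define J where "J z = partial_t \<phi> (\<Psi> z) + F (U (fst z) (snd z)) * partial_x \<phi> (\<Psi> z)" for z
  define q where "q z = (if M (fst z) (snd z) = 0 then 0 else (k (snd z))\<^sup>2 * \<bar>M (fst z) (snd z)\<bar> powr (r - 2))" for z
  \<comment> \<open>For \<open>r = 2\<close> the pull-back \<open>\<Theta>\<close> misses the energy of the labels with \<open>M t s = 0\<close>. If \<open>G (U t s) \<noteq> 0\<close> as well, then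
    \<open>t\<close> is an isolated zero of \<open>M\<close> at \<open>s\<close>, so for each label only countably many times are concerned.\<close>
  define \<Theta> where "\<Theta> z = - H (fst z) (snd z) * J z + (1 / r - 1) * G (U (fst z) (snd z)) * q z * \<phi> (\<Psi> z)" for z
  have cJ: "continuous_on UNIV J"
    unfolding J_def
    by (intro continuous_on_add continuous_on_mult continuous_on_compose2[OF \<phi>D(3) \<Psi>_cont]
        continuous_on_compose2[OF \<phi>D(2) \<Psi>_cont] continuous_on_compose2[OF F_cont U_cont]) auto
  have c\<phi>: "continuous_on UNIV (\<lambda>z. \<phi> (\<Psi> z))" by (intro continuous_on_compose2[OF \<phi>D(1) \<Psi>_cont]) auto
  have mJ [measurable]: "J \<in> borel_measurable borel" by (rule borel_measurable_continuous_onI[OF cJ])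
  have m\<phi> [measurable]: "(\<lambda>z. \<phi> (\<Psi> z)) \<in> borel_measurable borel" by (rule borel_measurable_continuous_onI[OF c\<phi>])
  have mG [measurable]: "(\<lambda>z. G (U (fst z) (snd z))) \<in> borel_measurable borel"
    by (rule measurable_compose[OF U_borel G_borel])
  have mk [measurable]: "(\<lambda>z::real\<times>real. k (snd z)) \<in> borel_measurable borel"
    by (rule measurable_compose[OF _ km], simp add: borel_prod[symmetric])
  have mq [measurable]: "q \<in> borel_measurable borel"
    unfolding q_def using M_borel by measurable
  have m\<Theta> [measurable]: "\<Theta> \<in> borel_measurable borel" unfolding \<Theta>_def using H_borel by measurable
  have m\<Theta>2: "\<Theta> \<in> borel_measurable (lborel \<Otimes>\<^sub>M lborel)" using m\<Theta> by (simp add: lborel_prod)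
  have mL: "(\<lambda>z. \<bar>M (fst z) (snd z)\<bar> powr r * weak_integrand \<phi> (\<Psi> z)) \<in> borel_measurable borel"
    using M_borel measurable_compose[OF \<Psi>_borel mwi] by measurable
  have ae: "AE z in lborel \<Otimes>\<^sub>M lborel. \<bar>M (fst z) (snd z)\<bar> powr r * weak_integrand \<phi> (\<Psi> z) = \<Theta> z"
  proof (rule lborel_pair.AE_pair_measure)
    show "{z \<in> space (lborel \<Otimes>\<^sub>M lborel). \<bar>M (fst z) (snd z)\<bar> powr r * weak_integrand \<phi> (\<Psi> z) = \<Theta> z} \<in> sets (lborel \<Otimes>\<^sub>M lborel)"
      unfolding lborel_prod using mL m\<Theta> by (intro borel_measurable_eq) simp_all
    show "AE t in lborel. AE s in lborel. \<bar>M (fst (t, s)) (snd (t, s))\<bar> powr r * weak_integrand \<phi> (\<Psi> (t, s)) = \<Theta> (t, s)"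
    proof (rule AE_I2)
      fix t :: real
      show "AE s in lborel. \<bar>M (fst (t, s)) (snd (t, s))\<bar> powr r * weak_integrand \<phi> (\<Psi> (t, s)) = \<Theta> (t, s)"
        using ux_AE(1)[of t] ux_AE(3)[of t]
      proof eventually_elim
        case (elim s)
        have "\<bar>M t s\<bar> powr r * weak_integrand \<phi> (X t s, t) =
            - (\<bar>M t s\<bar> powr r * ux (X t s, t)) * (partial_t \<phi> (X t s, t) + F (U t s) * partial_x \<phi> (X t s, t))
            + (1 / r - 1) * G (U t s) * (\<bar>M t s\<bar> powr r * (ux (X t s, t))\<^sup>2) * \<phi> (X t s, t)"
          by (simp add: weak_integrand_def u_X algebra_simps)
        then show ?case unfolding elim by (simp add: \<Theta>_def J_def q_def \<Psi>_def)
      qed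
    qed
  qed
  define Ks where "Ks = closure {p. \<phi> p \<noteq> 0}"
  obtain R where R: "\<And>z. z \<in> Ks \<Longrightarrow> norm z \<le> R"
    using compact_imp_bounded[OF K] by (auto simp: bounded_iff Ks_def)
  define T where "T = \<bar>R\<bar>"
  have T0: "0 \<le> T" by (simp add: T_def)
  have off: "J (t, s) = 0 \<and> \<phi> (\<Psi> (t, s)) = 0" if "\<Psi> (t, s) \<notin> Ks" for t s
    using that partial_off_closure[of "\<Psi> (t, s)" \<phi>] vanish_off_closure[of "\<Psi> (t, s)" \<phi>]
    by (simp add: J_def Ks_def)
  have inK: "\<bar>t\<bar> \<le> T" "\<bar>X t s\<bar> \<le> T" if "\<Psi> (t, s) \<in> Ks" for t s
    using R[OF that] norm_fst_le[of "X t s" t] norm_snd_le[of t "X t s"] by (auto simp: \<Psi>_def T_def)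
  have offT: "J (t, s) = 0 \<and> \<phi> (\<Psi> (t, s)) = 0" if "T < \<bar>t\<bar>" for t s
    using off[of t s] inK(1)[of t s] that by linarith
  obtain S1 where S1: "\<And>t. \<bar>t\<bar> \<le> T \<Longrightarrow> T + 1 \<le> X t S1" using esc by blast
  \<comment> \<open>Labels are bounded above on the support by \<open>esc\<close>; from below they
    are cut off at 0 because \<open>k\<close> vanishes on nonpositive labels.\<close>
  have box: "(t, s) \<in> {-T..T} \<times> {0..S1}" if "\<Theta> (t, s) \<noteq> 0" for t s
  proof -
    have "\<Psi> (t, s) \<in> Ks"
    proof (rule ccontr)
      assume "\<Psi> (t, s) \<notin> Ks"
      from off[OF this] have "\<Theta> (t, s) = 0" by (simp add: \<Theta>_def)
      then show False using that by simp
    qed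
    note i = inK[OF this]
    have "s \<le> S1"
    proof (rule ccontr)
      assume "\<not> s \<le> S1"
      then have "X t S1 \<le> X t s" by (intro X_mono) simp
      then show False using S1[OF i(1)] i(2) by linarith
    qed
    moreover have "0 \<le> s"
    proof (rule ccontr)
      assume "\<not> 0 \<le> s"
      then have "k s = 0" by (intro neg) simp
      then have "\<Theta> (t, s) = 0" by (simp add: \<Theta>_def H_def hA_def q_def)
      then show False using that by simp
    qed
    ultimately show ?thesis using i(1) by auto
  qed
  have "compact ((\<lambda>z. \<bar>J z\<bar> + \<bar>\<phi> (\<Psi> z)\<bar>) ` ({-T..T} \<times> {0..S1}))"
    by (intro compact_continuous_image compact_Times compact_Icc continuous_on_add continuous_on_rabs
        continuous_on_subset[OF cJ] continuous_on_subset[OF c\<phi>]) auto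
  then obtain B0 where B0: "\<And>y. y \<in> (\<lambda>z. \<bar>J z\<bar> + \<bar>\<phi> (\<Psi> z)\<bar>) ` ({-T..T} \<times> {0..S1}) \<Longrightarrow> norm y \<le> B0"
    by (meson bounded_iff compact_imp_bounded)
  define B where "B = \<bar>B0\<bar>"
  have B: "\<bar>J z\<bar> \<le> B" "\<bar>\<phi> (\<Psi> z)\<bar> \<le> B" if "z \<in> {-T..T} \<times> {0..S1}" for z
    using B0[OF imageI[OF that]] by (auto simp: B_def)
  have B00: "0 \<le> B" by (simp add: B_def)
  \<comment> \<open>Away from \<open>M t s = 0\<close> this is the quantity of
    \<open>dpow_bound\<close>.\<close>
  have qb: "(1 - 1 / r) * q (t, s) \<le> cT T * w s" and q0: "0 \<le> (1 - 1 / r) * q (t, s)" if t: "\<bar>t\<bar> \<le> T" for t s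
  proof -
    have e: "(1 - 1 / r) * q (t, s) = (if M t s = 0 then 0 else (k s)\<^sup>2 / r * dpow r (M t s))"
      using r by (auto simp: q_def dpow_nonzero field_simps)
    have "(k s)\<^sup>2 / r * dpow r (M t s) \<le> cT T * w s"
      unfolding M_def by (rule dpow_bound[OF A_bound[OF t] T0])
    moreover have "0 \<le> cT T * w s" using cT0 w0 by simp
    moreover have "0 \<le> (k s)\<^sup>2 / r * dpow r (M t s)" using r dpow_nonneg[OF r] by simp
    ultimately show "(1 - 1 / r) * q (t, s) \<le> cT T * w s" "0 \<le> (1 - 1 / r) * q (t, s)" unfolding e by auto
  qed
  have \<Theta>b: "\<bar>\<Theta> (t, s)\<bar> \<le> indicator {-T..T} t * (indicator {0..S1} s * ((B + C * B) * cT T * w s))" for t s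
  proof (cases "\<Theta> (t, s) = 0")
    case True then show ?thesis using B00 C0 cT0 w0 by simp
  next
    case False
    note bx = box[OF False]
    then have t: "\<bar>t\<bar> \<le> T" by auto
    have "\<bar>\<Theta> (t, s)\<bar> \<le> \<bar>H t s * J (t, s)\<bar> + \<bar>((1 - 1 / r) * q (t, s)) * (G (U t s) * \<phi> (\<Psi> (t, s)))\<bar>"
      by (simp add: \<Theta>_def algebra_simps)
    also have "\<dots> \<le> (cT T * w s) * B + (cT T * w s) * (C * B)"
    proof (rule add_mono)
      show "\<bar>H t s * J (t, s)\<bar> \<le> (cT T * w s) * B"
        unfolding abs_mult using cT0 w0 by (intro mult_mono H_bound[OF t] B[OF bx]) auto
      have "\<bar>G (U t s) * \<phi> (\<Psi> (t, s))\<bar> \<le> C * B"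
        unfolding abs_mult using C0 by (intro mult_mono GC B[OF bx]) auto
      then show "\<bar>((1 - 1 / r) * q (t, s)) * (G (U t s) * \<phi> (\<Psi> (t, s)))\<bar> \<le> (cT T * w s) * (C * B)"
        unfolding abs_mult[of "(1 - 1 / r) * q (t, s)"] using qb[OF t, of s] q0[OF t, of s] cT0 w0
        by (intro mult_mono) auto
    qed
    also have "\<dots> = (B + C * B) * cT T * w s" by (simp add: algebra_simps)
    finally show ?thesis using bx by simp
  qed
  have i\<Theta>: "integrable (lborel \<Otimes>\<^sub>M lborel) \<Theta>"
  proof (rule Bochner_Integration.integrable_bound[OF integrable_pair_times m\<Theta>2])
    show "integrable lborel (\<lambda>t. indicator {-T..T} t :: real)"
      by (rule integrable_real_indicator) (auto simp: emeasure_lborel_Icc_eq)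
    show "integrable lborel (\<lambda>s. indicator {0..S1} s * ((B + C * B) * cT T * w s))"
      using loc_integrableD[OF loc_integrable_scale[OF lw], of 0 S1 "(B + C * B) * cT T"] by (simp add: set_integrable_def)
    show "AE z in lborel \<Otimes>\<^sub>M lborel. norm (\<Theta> z) \<le> norm (indicator {-T..T} (fst z) * (indicator {0..S1} (snd z) * ((B + C * B) * cT T * w (snd z))))"
    proof (rule AE_I2)
      fix z :: "real \<times> real"
      have "\<bar>\<Theta> (fst z, snd z)\<bar> \<le> indicator {-T..T} (fst z) * (indicator {0..S1} (snd z) * ((B + C * B) * cT T * w (snd z)))"
        by (rule \<Theta>b)
      then show "norm (\<Theta> z) \<le> norm (indicator {-T..T} (fst z) * (indicator {0..S1} (snd z) * ((B + C * B) * cT T * w (snd z))))"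
        by simp
    qed
  qed
  have mL2: "(\<lambda>z. \<bar>M (fst z) (snd z)\<bar> powr r * weak_integrand \<phi> (\<Psi> z)) \<in> borel_measurable (lborel \<Otimes>\<^sub>M lborel)"
    using mL by (simp add: lborel_prod)
  show "integrable lborel (weak_integrand \<phi>)"
    unfolding push2_integral(1)[OF mwi] by (subst integrable_cong_AE[OF mL2 m\<Theta>2 ae]) (rule i\<Theta>)
  have inner: "(LINT t|lborel. \<Theta> (t, s)) = 0" for s
  proof -
    \<comment> \<open>The rate of \<open>H\<close> in \<open>y'\<close> produces the quadratic term
      of the weak form with its coefficient lam - 1, and the rate of \<open>\<phi>\<close> along the
      characteristic produces the transport term.\<close>
    define y where "y t = H t s * \<phi> (X t s, t)" for t
    define y' where "y' t = k s * (dpow r (M t s) * (k s / r * G (U t s))) * \<phi> (X t s, t) + J (t, s) * H t s" for t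
    have yd: "(y has_real_derivative y' t) (at t)" for t
      unfolding y_def y'_def J_def \<Psi>_def fst_conv snd_conv
      by (rule DERIV_mult[OF H_deriv \<phi>D(4)[OF X_deriv]])
    have cM: "continuous_on UNIV (\<lambda>t. M t s)" by (rule DERIV_continuous_on[OF has_field_derivative_at_within[OF M_deriv]])
    have cH: "continuous_on UNIV (\<lambda>t. H t s)" by (rule DERIV_continuous_on[OF has_field_derivative_at_within[OF H_deriv]])
    have cp: "continuous_on UNIV (\<lambda>t::real. (t, s))" by (intro continuous_intros)
    have c1: "continuous_on UNIV (\<lambda>t. J (t, s))" by (rule continuous_on_compose2[OF cJ cp]) simp
    have c2: "continuous_on UNIV (\<lambda>t. \<phi> (X t s, t))"
      using continuous_on_compose2[OF c\<phi> cp] by (simp add: \<Psi>_def)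
    have c3: "continuous_on UNIV (\<lambda>t. dpow r (M t s))"
      by (rule continuous_on_compose2[OF dpow_continuous[OF r] cM]) auto
    have cy': "continuous_on UNIV y'"
      unfolding y'_def
      by (intro continuous_on_add continuous_on_mult continuous_on_const c1 c2 c3 cH GV_cont[OF U_reg])
    have "(LINT t|lborel. y' t) = 0"
    proof (rule integral_derivative_compact_support[OF yd cy' _ _ T0])
      show "y t = 0" "y' t = 0" if "T < \<bar>t\<bar>" for t
        using offT[OF that, of s] by (simp_all add: y_def y'_def \<Psi>_def)
    qed
    moreover have "(LINT t|lborel. \<Theta> (t, s)) = (LINT t|lborel. - y' t)"
    proof (rule integral_cong_AE)
      have m\<Theta>': "(\<lambda>z. (\<lambda>t s. \<Theta> (t, s)) (fst z) (snd z)) \<in> borel_measurable borel" using m\<Theta> by simp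
      show "(\<lambda>t. \<Theta> (t, s)) \<in> borel_measurable lborel"
        using slice_borel(2)[OF m\<Theta>', of s] by simp
      show "(\<lambda>t. - y' t) \<in> borel_measurable lborel"
        using borel_measurable_continuous_onI[OF cy'] by simp
      have "countable {t. M t s = 0 \<and> k s / r * G (U t s) \<noteq> 0}"
        by (rule countable_transversal_zeros[OF M_deriv])
      then have "AE t in lborel. t \<notin> {t. M t s = 0 \<and> k s / r * G (U t s) \<noteq> 0}"
        by (intro AE_not_in countable_imp_null_set_lborel)
      then show "AE t in lborel. \<Theta> (t, s) = - y' t"
      proof eventually_elim
        case (elim t)
        show ?case
        proof (cases "M t s = 0")
          \<comment> \<open>Here \<open>H\<close> and \<open>q\<close> vanish, and so does
            \<open>y'\<close>, since at the times considered \<open>k s * G (U t s)\<close> is 0 as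
            well.\<close>
          case True
          then have "k s / r * G (U t s) = 0" using elim by simp
          then show ?thesis using True by (auto simp: \<Theta>_def y'_def q_def)
        next
          case False
          have qe: "(1 / r - 1) * q (t, s) = - (k s * (dpow r (M t s) * (k s / r)))"
            using False r by (simp add: q_def dpow_nonzero field_simps power2_eq_square)
          have "(1 / r - 1) * G (U t s) * q (t, s) = ((1 / r - 1) * q (t, s)) * G (U t s)"
            by (simp only: mult_ac)
          also have "\<dots> = - (k s * (dpow r (M t s) * (k s / r * G (U t s))))"
            unfolding qe by simp
          finally have "(1 / r - 1) * G (U t s) * q (t, s) = - (k s * (dpow r (M t s) * (k s / r * G (U t s))))" .
          then show ?thesis by (simp add: \<Theta>_def y'_def \<Psi>_def)
        qed
      qed
    qed
    ultimately show ?thesis by simp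
  qed
  have "(LINT z|lborel. weak_integrand \<phi> z) = (LINT z|(lborel \<Otimes>\<^sub>M lborel). \<Theta> z)"
    unfolding push2_integral(2)[OF mwi] by (rule integral_cong_AE[OF mL2 m\<Theta>2 ae])
  also have "\<dots> = (LINT s|lborel. LINT t|lborel. \<Theta> (t, s))"
    using lborel_pair.integral_snd[of "\<lambda>t s. \<Theta> (t, s)"] i\<Theta> by simp
  also have "\<dots> = 0" by (simp add: inner)
  finally show "(LINT z|lborel. weak_integrand \<phi> z) = 0" .
qed

lemma u_weak_solution:
  assumes "deriv f = F" "deriv (deriv f) = G"
    and init: "\<And>x. 0 \<le> x \<Longrightarrow> u (x, 0) = u0 x"
  shows "weak_solution (1 / r) f u0 u"
  unfolding weak_solution_def
proof (intro conjI allI impI exI[of _ ux] ballI)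
  show "u (x, 0) = u0 x" if "0 \<le> x" for x by (rule init[OF that])
  show "u (0, t) = 0" if "0 \<le> t" for t by (rule u_boundary[OF that])
  show "set_borel_measurable lborel ({0<..} \<times> {0<..}) ux"
  proof -
    have "{0<..} \<times> {0<..} \<in> sets (borel :: (real \<times> real) measure)"
      by (intro borel_open open_Times) auto
    then show ?thesis unfolding set_borel_measurable_def using ux_borel by measurable
  qed
  show "weak_derivative_on {0<..} (\<lambda>x. u (x, t)) (\<lambda>x. ux (x, t))" for t by (rule u_weak_derivative)
  show "sobolev_W1_loc (1 / (1 / r)) (\<lambda>x. u (x, t))" for t using u_sobolev by simp
  fix \<phi> :: "real \<times> real \<Rightarrow> real" assume "\<phi> \<in> C1c ({0<..} \<times> {0<..})"
  then have \<phi>: "C1_fun \<phi>" "compact (closure {p. \<phi> p \<noteq> 0})" "closure {p. \<phi> p \<noteq> 0} \<subseteq> {0<..} \<times> {0<..}"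
    by (auto simp: C1c_def)
  have e: "indicator ({0<..} \<times> {0<..}) z *\<^sub>R weak_form (1 / r) f u ux \<phi> z = weak_integrand \<phi> z" for z
  proof (cases "z \<in> {0<..} \<times> {0<..}")
    case True
    have dF: "deriv F = G" using assms(2) unfolding assms(1) .
    show ?thesis using True unfolding weak_form_def weak_integrand_def assms(1) dF by simp
  next
    case False
    then have "z \<notin> closure {p. \<phi> p \<noteq> 0}" using \<phi>(3) by blast
    then have "weak_integrand \<phi> z = 0" using partial_off_closure[of z \<phi>] vanish_off_closure[of z \<phi>] by (simp add: weak_integrand_def)
    then show ?thesis using False by simp
  qed
  show "set_integrable lborel ({0<..} \<times> {0<..}) (weak_form (1 / r) f u ux \<phi>)"
    unfolding set_integrable_def e by (rule weak_integrand_integral(1)[OF \<phi>(1,2)])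
  show "(LINT z:{0<..} \<times> {0<..}|lborel. weak_form (1 / r) f u ux \<phi> z) = 0"
    unfolding set_lebesgue_integral_def e by (rule weak_integrand_integral(2)[OF \<phi>(1,2)])
qed

end

section \<open>Fans\<close>

text \<open>The formulas for the densities on cells and fans are used strictly between the break
  points only.\<close>

lemma set_integral_interior_cong:
  fixes f g :: "real \<Rightarrow> real"
  assumes "f \<in> borel_measurable borel" "g \<in> borel_measurable borel" "\<And>z. a < z \<Longrightarrow> z < b \<Longrightarrow> f z = g z"
  shows "(LINT z:{a..b}|lborel. f z) = (LINT z:{a..b}|lborel. g z)"
  unfolding set_lebesgue_integral_def
proof (rule integral_cong_AE)
  show "AE z in lborel. indicator {a..b} z *\<^sub>R f z = indicator {a..b} z *\<^sub>R g z"
    using AE_lborel_singleton[of a] AE_lborel_singleton[of b]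
    by eventually_elim (use assms(3) in \<open>auto simp: indicator_def\<close>)
qed (use assms(1,2) in measurable)

lemma set_integral_interior_mono:
  fixes f g :: "real \<Rightarrow> real"
  assumes "set_integrable lborel {a..b} f" "set_integrable lborel {a..b} g" "\<And>z. a < z \<Longrightarrow> z < b \<Longrightarrow> f z \<le> g z"
  shows "(LINT z:{a..b}|lborel. f z) \<le> (LINT z:{a..b}|lborel. g z)"
  unfolding set_lebesgue_integral_def
proof (rule integral_mono_AE)
  show "AE z in lborel. indicator {a..b} z *\<^sub>R f z \<le> indicator {a..b} z *\<^sub>R g z"
    using AE_lborel_singleton[of a] AE_lborel_singleton[of b]
    by eventually_elim (use assms(3) in \<open>auto simp: indicator_def\<close>)
qed (use assms in \<open>simp_all add: set_integrable_def\<close>)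

lemma set_integral_Icc_const:
  "a \<le> b \<Longrightarrow> (LINT z:{a..b}|lborel. (c::real)) = c * (b - a)"
  by (simp add: set_lebesgue_integral_def mult.commute)

lemma loc_integrable_one_plus_powr:
  assumes r: "0 \<le> r" and mv: "v \<in> borel_measurable borel" and lvr: "loc_integrable (\<lambda>x. \<bar>v x\<bar> powr r)"
  shows "loc_integrable (\<lambda>x. (1 + \<bar>v x\<bar>) powr r)"
proof (rule loc_integrable_bound)
  show "loc_integrable (\<lambda>x. 2 powr r * (1 + \<bar>v x\<bar> powr r))"
    using lvr loc_integrable_continuous[OF continuous_on_const[of UNIV "1::real"]]
    by (intro loc_integrable_scale) (auto simp: loc_integrable_def)
  show "(\<lambda>x. (1 + \<bar>v x\<bar>) powr r) \<in> borel_measurable borel" using mv by measurable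
  fix x
  have "(1 + \<bar>v x\<bar>) powr r \<le> (2 * max 1 \<bar>v x\<bar>) powr r" using r by (intro powr_mono2) auto
  also have "\<dots> = 2 powr r * (max 1 \<bar>v x\<bar>) powr r" by (simp add: powr_mult)
  also have "(max 1 \<bar>v x\<bar>) powr r \<le> 1 + \<bar>v x\<bar> powr r" by (auto simp: max_def)
  finally show "\<bar>(1 + \<bar>v x\<bar>) powr r\<bar> \<le> 2 powr r * (1 + \<bar>v x\<bar> powr r)" by simp
qed

text \<open>The labels in \<open>[2 j, 2 j + 1)\<close> parametrize affinely an interval of length \<open>l j\<close>, on which the slope is the given \<open>v\<close>; those in
  \<open>[2 j + 1, 2 j + 2)\<close> form a fan of unit energy at its right end. \<open>fan_rho\<close> is the initial length density.\<close>

definition fan_rho :: "(nat \<Rightarrow> real) \<Rightarrow> real \<Rightarrow> real" where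
  "fan_rho l s = (if s \<le> 0 then 1 else if s - 2 * real (nat \<lfloor>s / 2\<rfloor>) < 1 then l (nat \<lfloor>s / 2\<rfloor>) else 0)"

definition fan_x :: "(nat \<Rightarrow> real) \<Rightarrow> real \<Rightarrow> real" where
  "fan_x l = prim (fan_rho l)"

definition fan_p :: "real \<Rightarrow> (nat \<Rightarrow> real) \<Rightarrow> real \<Rightarrow> real" where
  "fan_p r l s = fan_rho l s powr (1 / r)"

definition fan_k :: "real \<Rightarrow> (nat \<Rightarrow> real) \<Rightarrow> (real \<Rightarrow> real) \<Rightarrow> real \<Rightarrow> real" where
  "fan_k r l v s = (if s \<le> 0 then 0 else if s - 2 * real (nat \<lfloor>s / 2\<rfloor>) < 1 then fan_p r l s * v (fan_x l s) else 1)"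

text \<open>Conditions for the dichotomy in \<open>cell_width\<close>; \<open>K\<close> separates
  moderate slopes from the steep ones, which \<open>g\<close> must not count. The integral of the
  weight over the cell is so small that \<open>A\<close> varies by at most r / (4 K) across it. The
  length is at most 4^r times the width that an open fan provides: the \<open>min\<close> is the
  length of a stretch of fan labels, and (1 / (4 K))^r a lower bound for |M|^r there.\<close>

definition fine_cell ::
    "real \<Rightarrow> real \<Rightarrow> real \<Rightarrow> (real \<Rightarrow> real) \<Rightarrow> (real \<Rightarrow> real) \<Rightarrow> real \<Rightarrow> real \<Rightarrow> real \<Rightarrow> real \<Rightarrow> bool" where
  "fine_cell r C L v g T K a d \<longleftrightarrow> 0 < K \<and> (\<forall>x\<in>{a..d}. K < \<bar>v x\<bar> \<longrightarrow> g x \<le> 0) \<and>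
     L * (1 + C * T) powr r * T * (LINT x:{a..d}|lborel. (1 + \<bar>v x\<bar>) powr r) \<le> r / (4 * K) \<and>
     d - a \<le> 4 powr r * (min 1 (r / (4 * K) / (L * (1 + C * T) powr r * T + 1)) * (1 / (4 * K)) powr r)"

locale fan_labels =
  fixes r :: real and l :: "nat \<Rightarrow> real" and v :: "real \<Rightarrow> real"
  assumes r: "2 \<le> r" and l: "\<And>j. 0 < l j" "\<And>j. l j \<le> 1"
    and lsum: "\<And>B. \<exists>n. B \<le> sum l {..<n}"
    and mv: "v \<in> borel_measurable borel"
    and lvr: "loc_integrable (\<lambda>x. \<bar>v x\<bar> powr r)"
begin

abbreviation "\<rho> \<equiv> fan_rho l"
abbreviation "x0 \<equiv> fan_x l"
definition node :: "nat \<Rightarrow> real" where "node j = sum l {..<j}"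

lemma index_eq: "2 * real j < s \<Longrightarrow> s < 2 * real j + 2 \<Longrightarrow> nat \<lfloor>s / 2\<rfloor> = j"
  by (rule nat_eq_iff[THEN iffD2]) (auto intro!: floor_unique)

lemma rho_cell: "2 * real j < s \<Longrightarrow> s < 2 * real j + 1 \<Longrightarrow> \<rho> s = l j"
  using index_eq[of j s] by (simp add: fan_rho_def)

lemma rho_fan: "2 * real j + 1 < s \<Longrightarrow> s < 2 * real j + 2 \<Longrightarrow> \<rho> s = 0"
  using index_eq[of j s] by (simp add: fan_rho_def)

lemma k_cell: "2 * real j < s \<Longrightarrow> s < 2 * real j + 1 \<Longrightarrow> fan_k r l v s = fan_p r l s * v (x0 s)"
  using index_eq[of j s] by (simp add: fan_k_def)

lemma k_fan: "2 * real j + 1 < s \<Longrightarrow> s < 2 * real j + 2 \<Longrightarrow> fan_k r l v s = 1"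
  using index_eq[of j s] by (simp add: fan_k_def)

lemma rho_borel [measurable]: "\<rho> \<in> borel_measurable borel"
proof -
  have "(\<lambda>s::real. l (nat \<lfloor>s / 2\<rfloor>)) \<in> borel_measurable borel"
    by (rule measurable_compose_countable[where f="\<lambda>i _. l i"]) measurable
  moreover have "(\<lambda>s::real. real (nat \<lfloor>s / 2\<rfloor>)) \<in> borel_measurable borel"
    by (rule measurable_compose_countable[where f="\<lambda>i _. real i"]) measurable
  ultimately show ?thesis unfolding fan_rho_def by measurable
qed

lemma rho_nonneg: "0 \<le> \<rho> s" and rho_le: "\<rho> s \<le> 1"
  using l less_imp_le[OF l(1)] by (simp_all add: fan_rho_def)

lemma rho_loc: "loc_integrable \<rho>"
  by (rule loc_integrable_bound[OF loc_integrable_continuous[OF continuous_on_const[of _ 1]] rho_borel])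
     (simp add: rho_nonneg rho_le)

lemma p_powr: "fan_p r l s powr r = \<rho> s"
  using r rho_nonneg[of s] by (simp add: fan_p_def powr_powr)

lemma x0_inc: "s \<le> t \<Longrightarrow> x0 t - x0 s = (LINT z:{s..t}|lborel. \<rho> z)"
  unfolding fan_x_def by (rule prim_diff[OF rho_loc])

lemma x0_cont: "continuous_on UNIV x0"
  unfolding fan_x_def by (rule prim_continuous[OF rho_loc])

lemma x0_mono: "s \<le> t \<Longrightarrow> x0 s \<le> x0 t"
  unfolding fan_x_def by (rule prim_mono[OF rho_loc rho_nonneg])

lemma x0_neg: assumes "s \<le> 0" shows "x0 s = s"
proof -
  have "x0 0 - x0 s = (LINT z:{s..0}|lborel. 1)"
    unfolding x0_inc[OF assms] by (rule set_lebesgue_integral_cong) (auto simp: fan_rho_def)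
  then show ?thesis using set_integral_Icc_const[OF assms, of 1] by (simp add: fan_x_def)
qed

lemma x0_half_step: "x0 (2 * real j + 1) - x0 (2 * real j) = l j" "x0 (2 * real j + 2) - x0 (2 * real j + 1) = 0"
proof -
  have "(LINT z:{2 * real j..2 * real j + 1}|lborel. \<rho> z) = (LINT z:{2 * real j..2 * real j + 1}|lborel. l j)"
    by (rule set_integral_interior_cong) (auto simp: rho_cell)
  then show "x0 (2 * real j + 1) - x0 (2 * real j) = l j"
    using x0_inc[of "2 * real j" "2 * real j + 1"] by (simp add: set_integral_Icc_const)
  have "(LINT z:{2 * real j + 1..2 * real j + 2}|lborel. \<rho> z) = (LINT z:{2 * real j + 1..2 * real j + 2}|lborel. 0)"
    by (rule set_integral_interior_cong) (auto simp: rho_fan)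
  then show "x0 (2 * real j + 2) - x0 (2 * real j + 1) = 0"
    using x0_inc[of "2 * real j + 1" "2 * real j + 2"] by simp
qed

lemma x0_node: "x0 (2 * real j) = node j"
proof (induction j)
  case 0 then show ?case by (simp add: fan_x_def node_def)
next
  case (Suc j)
  have "x0 (2 * real (Suc j)) = node j + l j"
    using x0_half_step[of j] Suc by (simp add: algebra_simps)
  then show ?case by (simp add: node_def)
qed

lemma x0_node': "x0 (2 * real j + 1) = node (Suc j)"
  using x0_half_step(1)[of j] by (simp add: x0_node node_def)

lemma x0_surj: "\<exists>s. x0 s = x"
proof (cases "x \<le> 0")
  case True then show ?thesis using x0_neg by blast
next
  case False
  obtain n where "x \<le> node n" using lsum by (auto simp: node_def)
  then have n: "x \<le> x0 (2 * real n)" by (simp add: x0_node)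
  have "\<exists>s\<ge>0. s \<le> 2 * real n \<and> x0 s = x"
    by (rule IVT'[OF _ n _ continuous_on_subset[OF x0_cont]]) (use False in \<open>auto simp: fan_x_def\<close>)
  then show ?thesis by blast
qed

lemma x0_change:
  assumes h: "loc_integrable h" "h \<in> borel_measurable borel"
  shows "loc_integrable (\<lambda>s. \<rho> s * h (x0 s))"
    and "s \<le> t \<Longrightarrow> (LINT z:{s..t}|lborel. \<rho> z * h (x0 z)) = (LINT x:{x0 s..x0 t}|lborel. h x)"
proof -
  show "loc_integrable (\<lambda>s. \<rho> s * h (x0 s))"
    by (rule prim_change_of_variables(1)[OF rho_loc rho_borel rho_nonneg x0_inc x0_cont x0_surj h])
  show "(LINT z:{s..t}|lborel. \<rho> z * h (x0 z)) = (LINT x:{x0 s..x0 t}|lborel. h x)" if "s \<le> t"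
    by (rule prim_change_of_variables(2)[OF rho_loc rho_borel rho_nonneg x0_inc x0_cont x0_surj h that])
qed

lemma x0_borel [measurable]: "x0 \<in> borel_measurable borel"
  by (rule borel_measurable_continuous_onI[OF x0_cont])

lemma p_borel: "fan_p r l \<in> borel_measurable borel"
  unfolding fan_p_def by measurable

lemma k_borel: "fan_k r l v \<in> borel_measurable borel"
proof -
  have [measurable]: "(\<lambda>s::real. real (nat \<lfloor>s / 2\<rfloor>)) \<in> borel_measurable borel"
    by (rule measurable_compose_countable[where f="\<lambda>i _. real i"]) measurable
  have [measurable]: "(\<lambda>s. v (x0 s)) \<in> borel_measurable borel" by (rule measurable_compose[OF x0_borel mv])
  note p_borel [measurable]
  show ?thesis unfolding fan_k_def by measurable
qed

lemma p_nonneg: "0 \<le> fan_p r l s" by (simp add: fan_p_def)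

lemma pk_pos: "0 < fan_p r l s + \<bar>fan_k r l v s\<bar>"
proof (cases "s \<le> 0")
  case True then show ?thesis by (simp add: fan_p_def fan_rho_def add_pos_nonneg)
next
  case False
  show ?thesis
  proof (cases "s - 2 * real (nat \<lfloor>s / 2\<rfloor>) < 1")
    case True
    then have "0 < fan_p r l s" using False l(1)[of "nat \<lfloor>s / 2\<rfloor>"] by (simp add: fan_p_def fan_rho_def)
    then show ?thesis by (simp add: add_pos_nonneg)
  next
    case 2: False
    then have "fan_k r l v s = 1" using False by (simp add: fan_k_def)
    then show ?thesis using p_nonneg[of s] by simp
  qed
qed

lemma vw_loc: "loc_integrable (\<lambda>x. (1 + \<bar>v x\<bar>) powr r)"
  by (rule loc_integrable_one_plus_powr[OF _ mv lvr]) (use r in simp)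

lemma vw_borel: "(\<lambda>x. (1 + \<bar>v x\<bar>) powr r) \<in> borel_measurable borel"
  using mv by measurable

lemma weight_cell:
  "2 * real j < s \<Longrightarrow> s < 2 * real j + 1 \<Longrightarrow>
    (fan_p r l s + \<bar>fan_k r l v s\<bar>) powr r = \<rho> s * (1 + \<bar>v (x0 s)\<bar>) powr r"
proof -
  assume s: "2 * real j < s" "s < 2 * real j + 1"
  have "fan_p r l s + \<bar>fan_k r l v s\<bar> = fan_p r l s * (1 + \<bar>v (x0 s)\<bar>)"
    using k_cell[OF s] p_nonneg[of s] by (simp add: abs_mult algebra_simps)
  then show ?thesis using p_nonneg[of s] by (simp add: powr_mult p_powr)
qed

lemma weight_fan:
  "2 * real j + 1 < s \<Longrightarrow> s < 2 * real j + 2 \<Longrightarrow> (fan_p r l s + \<bar>fan_k r l v s\<bar>) powr r = 1"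
  using rho_fan[of j s] k_fan[of j s] by (simp add: fan_p_def)

lemma weight_loc: "loc_integrable (\<lambda>s. (fan_p r l s + \<bar>fan_k r l v s\<bar>) powr r)"
proof (rule loc_integrable_bound)
  have "loc_integrable (\<lambda>s. \<rho> s * (1 + \<bar>v (x0 s)\<bar>) powr r)" by (rule x0_change(1)[OF vw_loc vw_borel])
  then show "loc_integrable (\<lambda>s. 1 + \<rho> s * (1 + \<bar>v (x0 s)\<bar>) powr r)"
    using loc_integrable_continuous[OF continuous_on_const[of UNIV "1::real"]] by (auto simp: loc_integrable_def)
  show "(\<lambda>s. (fan_p r l s + \<bar>fan_k r l v s\<bar>) powr r) \<in> borel_measurable borel"
    using p_borel k_borel by measurable
  fix s
  have nn: "0 \<le> \<rho> s * (1 + \<bar>v (x0 s)\<bar>) powr r" using rho_nonneg[of s] by simp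
  show "\<bar>(fan_p r l s + \<bar>fan_k r l v s\<bar>) powr r\<bar> \<le> 1 + \<rho> s * (1 + \<bar>v (x0 s)\<bar>) powr r"
  proof (cases "s \<le> 0")
    case True
    then have "fan_p r l s + \<bar>fan_k r l v s\<bar> = 1" by (simp add: fan_p_def fan_k_def fan_rho_def)
    then show ?thesis using nn by simp
  next
    case False
    show ?thesis
    proof (cases "s - 2 * real (nat \<lfloor>s / 2\<rfloor>) < 1")
      case True
      then have "fan_p r l s + \<bar>fan_k r l v s\<bar> = fan_p r l s * (1 + \<bar>v (x0 s)\<bar>)"
        using False p_nonneg[of s] by (simp add: fan_k_def abs_mult algebra_simps)
      then show ?thesis using nn by (simp add: powr_mult p_powr)
    next
      case 2: False
      then have "fan_p r l s + \<bar>fan_k r l v s\<bar> = 1" using False by (simp add: fan_p_def fan_k_def fan_rho_def)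
      then show ?thesis using nn by simp
    qed
  qed
qed

end

section \<open>Width of a cell together with its fan\<close>

locale fan_data = fan_labels r l v + char_data r C L F G "fan_p r l" "fan_k r l v"
  for r l v C L F G
begin

lemma Wp_cell: "Wp (2 * real j + 1) - Wp (2 * real j) = (LINT x:{node j..node (Suc j)}|lborel. (1 + \<bar>v x\<bar>) powr r)"
proof -
  have m1: "w \<in> borel_measurable borel" unfolding w_def by measurable
  have m2: "(\<lambda>s. \<rho> s * (1 + \<bar>v (x0 s)\<bar>) powr r) \<in> borel_measurable borel"
    using measurable_compose[OF x0_borel vw_borel] by measurable
  have "Wp (2 * real j + 1) - Wp (2 * real j) = (LINT s:{2 * real j..2 * real j + 1}|lborel. w s)"
    unfolding Wp_def by (rule prim_diff[OF lw]) simp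
  also have "\<dots> = (LINT s:{2 * real j..2 * real j + 1}|lborel. \<rho> s * (1 + \<bar>v (x0 s)\<bar>) powr r)"
    by (rule set_integral_interior_cong[OF m1 m2]) (simp add: w_def weight_cell)
  also have "\<dots> = (LINT x:{node j..node (Suc j)}|lborel. (1 + \<bar>v x\<bar>) powr r)"
    using x0_change(2)[OF vw_loc vw_borel, of "2 * real j" "2 * real j + 1"] by (simp add: x0_node x0_node')
  finally show ?thesis .
qed

lemma Wp_fan:
  assumes "2 * real j + 1 \<le> s" "s \<le> 2 * real j + 2"
  shows "Wp s - Wp (2 * real j + 1) = s - (2 * real j + 1)"
proof -
  have m1: "w \<in> borel_measurable borel" unfolding w_def by measurable
  have "Wp s - Wp (2 * real j + 1) = (LINT z:{2 * real j + 1..s}|lborel. w z)"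
    unfolding Wp_def by (rule prim_diff[OF lw assms(1)])
  also have "\<dots> = (LINT z:{2 * real j + 1..s}|lborel. 1)"
    by (rule set_integral_interior_cong[OF m1]) (use assms weight_fan[of j] in \<open>auto simp: w_def\<close>)
  finally show ?thesis using set_integral_Icc_const[OF assms(1), of 1] by simp
qed

text \<open>If the cell nearly collapses at time \<open>t\<close>, then \<open>A t\<close> is bounded away from zero at its right end,
  so that the adjacent fan has opened.\<close>

lemma cell_width:
  fixes g :: "real \<Rightarrow> real"
  defines "D T \<equiv> L * (1 + C * T) powr r * T"
  assumes t: "\<bar>t\<bar> \<le> T" and K: "0 < K"
    and g: "loc_integrable g" "g \<in> borel_measurable borel" "\<And>x. g x \<le> 1"
      "\<And>x. x \<in> {node j..node (Suc j)} \<Longrightarrow> K < \<bar>v x\<bar> \<Longrightarrow> g x \<le> 0"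
    and small: "D T * (LINT x:{node j..node (Suc j)}|lborel. (1 + \<bar>v x\<bar>) powr r) \<le> r / (4 * K)"
    and lj: "l j \<le> 4 powr r * (min 1 (r / (4 * K) / (D T + 1)) * (1 / (4 * K)) powr r)"
  shows "(1 / 4) powr r * (LINT x:{node j..node (Suc j)}|lborel. g x) \<le> X t (2 * real (Suc j)) - X t (2 * real j)"
proof -
  define c where "c = 2 * real j"
  have T0: "0 \<le> T" using t by simp
  have D0: "0 \<le> D T" using L0 T0 by (simp add: D_def)
  have r0: "0 < r" using r by simp
  have Ainc: "\<bar>A t y - A t x\<bar> \<le> D T * (Wp y - Wp x)" if "x \<le> y" for x y
    using Aop_inc[OF U_reg t that] by (simp add: A_def D_def cT_def mult_ac)
  have X2: "X t (c + 1) \<le> X t (c + 2)" "X t c \<le> X t (c + 1)" by (intro X_mono; simp)+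
  have S2: "2 * real (Suc j) = c + 2" by (simp add: c_def)
  show ?thesis
  \<comment> \<open>The threshold is twice the admissible variation r / (4 K). Below it, |A| stays
    at most 3 r / (4 K) on the whole cell; above it, |A| stays at least r / (4 K) on an initial
    stretch of the fan.\<close>
  proof (cases "\<bar>A t (c + 1)\<bar> \<le> r / (2 * K)")
    case True
    have As: "\<bar>A t s\<bar> \<le> 3 * r / (4 * K)" if s: "c \<le> s" "s \<le> c + 1" for s
    proof -
      have "\<bar>A t (c + 1) - A t s\<bar> \<le> D T * (Wp (c + 1) - Wp s)" by (rule Ainc[OF s(2)])
      also have "\<dots> \<le> D T * (Wp (c + 1) - Wp c)"
        using Wp_mono[OF s(1)] by (intro mult_left_mono D0) simp
      also have "\<dots> \<le> r / (4 * K)" using small by (simp add: c_def Wp_cell)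
      finally have "\<bar>A t s\<bar> \<le> r / (2 * K) + r / (4 * K)" using True by linarith
      also have "\<dots> = 3 * r / (4 * K)" using K by (simp add: field_simps)
      finally show ?thesis .
    qed
    have pt: "(1 / 4) powr r * (\<rho> s * g (x0 s)) \<le> \<bar>M t s\<bar> powr r" if s: "c < s" "s < c + 1" for s
    proof (cases "\<bar>v (x0 s)\<bar> \<le> K")
      case True
      have ps: "0 \<le> fan_p r l s" by (rule p_nonneg)
      have Me: "M t s = fan_p r l s * (1 + v (x0 s) * A t s / r)"
        using k_cell[of j s] s by (simp add: M_def mA_def c_def algebra_simps)
      \<comment> \<open>For slopes up to \<open>K\<close> the product |v A / r| is at most 3/4, so
        the factor of \<open>M\<close> is at least 1/4; this is the origin of the constant
        \<open>(1 / 4) powr r\<close>.\<close>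
      have "\<bar>v (x0 s)\<bar> * \<bar>A t s\<bar> \<le> K * (3 * r / (4 * K))"
        using True As[of s] s by (intro mult_mono) auto
      then have "\<bar>v (x0 s) * A t s / r\<bar> \<le> 3 / 4" using K r0 by (simp add: abs_mult field_simps)
      then have "1 / 4 \<le> \<bar>1 + v (x0 s) * A t s / r\<bar>" by linarith
      from mult_left_mono[OF this ps] have "fan_p r l s * (1 / 4) \<le> \<bar>M t s\<bar>"
        unfolding Me using ps by (simp add: abs_mult)
      then have "(fan_p r l s * (1 / 4)) powr r \<le> \<bar>M t s\<bar> powr r"
        using ps r0 by (intro powr_mono2) auto
      moreover have "(fan_p r l s * (1 / 4)) powr r = \<rho> s * (1 / 4) powr r"
        using powr_mult[of "fan_p r l s" "1 / 4" r] ps by (simp only: p_powr)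
      ultimately have "\<rho> s * (1 / 4) powr r \<le> \<bar>M t s\<bar> powr r" by simp
      moreover have "\<rho> s * g (x0 s) \<le> \<rho> s * 1" by (rule mult_left_mono[OF g(3) rho_nonneg])
      then have "(1 / 4) powr r * (\<rho> s * g (x0 s)) \<le> (1 / 4) powr r * (\<rho> s * 1)" by (rule mult_left_mono) simp
      ultimately show ?thesis by (simp add: mult.commute)
    next
      \<comment> \<open>Steep labels may have collapsed, but \<open>g\<close> is nonpositive
        there.\<close>
      case False
      have "x0 s \<in> {node j..node (Suc j)}"
        using x0_mono[of c s] x0_mono[of s "c + 1"] s by (simp add: c_def x0_node x0_node')
      then have "g (x0 s) \<le> 0" using g(4) False by simp
      then have "\<rho> s * g (x0 s) \<le> 0" using rho_nonneg[of s] by (simp add: mult_nonneg_nonpos)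
      then have "(1 / 4) powr r * (\<rho> s * g (x0 s)) \<le> 0" by (simp add: mult_nonneg_nonpos)
      also have "0 \<le> \<bar>M t s\<bar> powr r" by simp
      finally show ?thesis .
    qed
    have "(1 / 4) powr r * (LINT x:{node j..node (Suc j)}|lborel. g x) = (LINT s:{c..c + 1}|lborel. (1 / 4) powr r * (\<rho> s * g (x0 s)))"
      using x0_change(2)[OF g(1,2), of c "c + 1"] by (simp add: c_def x0_node x0_node')
    also have "\<dots> \<le> (LINT s:{c..c + 1}|lborel. \<bar>M t s\<bar> powr r)"
      by (rule set_integral_interior_mono[OF loc_integrableD[OF loc_integrable_scale[OF x0_change(1)[OF g(1,2)]]]
            loc_integrableD[OF Mr_loc] pt])
    also have "\<dots> = X t (c + 1) - X t c" by (rule X_inc[symmetric]) simp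
    also have "\<dots> \<le> X t (c + 2) - X t c" using X2 by simp
    finally show ?thesis by (simp only: S2) (simp add: c_def)
  next
    case False
    \<comment> \<open>The weight of a fan is 1 per unit of label, so over a stretch of length
      \<open>\<eta>\<close> the value of \<open>A\<close> changes by at most
      \<open>D T * \<eta>\<close>, that is, at most r / (4 K). The \<open>+ 1\<close> prevents
      division by 0.\<close>
    define \<eta> where "\<eta> = min 1 (r / (4 * K) / (D T + 1))"
    have \<eta>: "0 < \<eta>" "\<eta> \<le> 1" using K r0 D0 by (auto simp: \<eta>_def)
    have "D T * \<eta> \<le> (D T + 1) * (r / (4 * K) / (D T + 1))"
      using D0 \<eta> by (intro mult_mono) (auto simp: \<eta>_def)
    also have "\<dots> = r / (4 * K)" using D0 by simp
    finally have D\<eta>: "D T * \<eta> \<le> r / (4 * K)" .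
    have pt: "(1 / (4 * K)) powr r \<le> \<bar>M t s\<bar> powr r" if s: "c + 1 < s" "s < c + 1 + \<eta>" for s
    proof -
      have s2: "2 * real j + 1 < s" "s < 2 * real j + 2" using s \<eta> by (auto simp: c_def)
      have "\<bar>A t s - A t (c + 1)\<bar> \<le> D T * (Wp s - Wp (c + 1))" by (rule Ainc) (use s in simp)
      also have "Wp s - Wp (c + 1) = s - (c + 1)" using Wp_fan[of j s] s2 by (simp add: c_def)
      also have "D T * (s - (c + 1)) \<le> D T * \<eta>" using s by (intro mult_left_mono D0) simp
      finally have "\<bar>A t s - A t (c + 1)\<bar> \<le> r / (4 * K)" using D\<eta> by linarith
      moreover have "r / (2 * K) = r / (4 * K) + r / (4 * K)" using K by (simp add: field_simps)
      ultimately have "r / (4 * K) \<le> \<bar>A t s\<bar>" using False by linarith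
      then have "r / (4 * K) / r \<le> \<bar>A t s\<bar> / r" by (rule divide_right_mono) (use r0 in simp)
      then have "1 / (4 * K) \<le> \<bar>A t s / r\<bar>" using r0 by simp
      moreover have "M t s = A t s / r"
        using rho_fan[OF s2] k_fan[OF s2] by (simp add: M_def mA_def fan_p_def)
      ultimately show ?thesis using K r0 by (intro powr_mono2) auto
    qed
    \<comment> \<open>Now the fan alone has to provide the width. Since \<open>g\<close> is at most
      1, the claim needs at most \<open>(1 / 4) powr r * l j\<close>, and \<open>lj\<close> was
      designed for this comparison.\<close>
    have "(LINT x:{node j..node (Suc j)}|lborel. g x) \<le> (LINT x:{node j..node (Suc j)}|lborel. 1)"
      by (rule set_integral_interior_mono[OF loc_integrableD[OF g(1)]
            loc_integrableD[OF loc_integrable_continuous[OF continuous_on_const]] g(3)])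
    also have "\<dots> = l j"
      using set_integral_Icc_const[of "node j" "node (Suc j)" 1] less_imp_le[OF l(1)] by (simp add: node_def)
    also have "l j \<le> 4 powr r * (\<eta> * (1 / (4 * K)) powr r)" using lj by (simp add: \<eta>_def)
    finally have "(1 / 4) powr r * (LINT x:{node j..node (Suc j)}|lborel. g x) \<le> (1 / 4) powr r * (4 powr r * (\<eta> * (1 / (4 * K)) powr r))"
      by (rule mult_left_mono) simp
    also have "\<dots> = ((1 / 4) powr r * 4 powr r) * (\<eta> * (1 / (4 * K)) powr r)" by (simp only: mult.assoc)
    also have "(1 / 4 :: real) powr r * 4 powr r = 1" by (simp add: powr_mult[symmetric])
    also have "1 * (\<eta> * (1 / (4 * K)) powr r) = (LINT s:{c + 1..c + 1 + \<eta>}|lborel. (1 / (4 * K)) powr r)"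
      using set_integral_Icc_const[of "c + 1" "c + 1 + \<eta>"] \<eta> by simp
    also have "\<dots> \<le> (LINT s:{c + 1..c + 1 + \<eta>}|lborel. \<bar>M t s\<bar> powr r)"
      by (rule set_integral_interior_mono[OF loc_integrableD[OF loc_integrable_continuous[OF continuous_on_const]]
            loc_integrableD[OF Mr_loc] pt])
    also have "\<dots> = X t (c + 1 + \<eta>) - X t (c + 1)" by (rule X_inc[symmetric]) (use \<eta> in simp)
    also have "\<dots> \<le> X t (c + 2) - X t c" using X2 X_mono[of "c + 1 + \<eta>" "c + 2" t] \<eta> by simp
    finally show ?thesis by (simp only: S2) (simp add: c_def)
  qed
qed

text \<open>From some cell on, each cell with its fan keeps a fixed fraction of its integral of
  \<open>g\<close> at all times up to \<open>T\<close>. As the total integral of \<open>g\<close> is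
  infinite, positions exceed every bound. The earlier cells may collapse completely; for them only
  monotonicity of \<open>X t\<close> is used.\<close>

lemma escape:
  assumes g: "loc_integrable g" "g \<in> borel_measurable borel" "\<And>x. g x \<le> 1" "\<And>x. 0 \<le> g x"
    and div: "\<And>B. \<exists>n. B \<le> prim g (node n)"
    and fine: "\<And>T. \<exists>j0. \<forall>j\<ge>j0. \<exists>T' K. T \<le> T' \<and> fine_cell r C L v g T' K (node j) (node (Suc j))"
  shows "\<exists>S. \<forall>t. \<bar>t\<bar> \<le> T \<longrightarrow> B \<le> X t S"
proof -
  obtain j0 where j0: "\<And>j. j0 \<le> j \<Longrightarrow> \<exists>T' K. T \<le> T' \<and> fine_cell r C L v g T' K (node j) (node (Suc j))"
    using fine[of T] by blast
  have bmono: "node i \<le> node j" if "i \<le> j" for i j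
    unfolding node_def by (rule sum_mono2) (use that less_imp_le[OF l(1)] in auto)
  have step: "(1 / 4) powr r * (prim g (node (Suc j)) - prim g (node j)) \<le> X t (2 * real (Suc j)) - X t (2 * real j)"
    if j: "j0 \<le> j" and t: "\<bar>t\<bar> \<le> T" for j t
  proof -
    obtain T' K where h: "T \<le> T'" "0 < K" "\<And>x. x \<in> {node j..node (Suc j)} \<Longrightarrow> K < \<bar>v x\<bar> \<Longrightarrow> g x \<le> 0"
      "L * (1 + C * T') powr r * T' * (LINT x:{node j..node (Suc j)}|lborel. (1 + \<bar>v x\<bar>) powr r) \<le> r / (4 * K)"
      "node (Suc j) - node j \<le> 4 powr r * (min 1 (r / (4 * K) / (L * (1 + C * T') powr r * T' + 1)) * (1 / (4 * K)) powr r)"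
      using j0[OF j] unfolding fine_cell_def by blast
    have t': "\<bar>t\<bar> \<le> T'" using t h(1) by linarith
    have "l j \<le> 4 powr r * (min 1 (r / (4 * K) / (L * (1 + C * T') powr r * T' + 1)) * (1 / (4 * K)) powr r)"
      using h(5) by (simp add: node_def)
    from cell_width[OF t' h(2) g(1-3) h(3,4) this] show ?thesis
      using prim_diff[OF g(1) bmono, of j "Suc j"] by simp
  qed
  have total: "(1 / 4) powr r * (prim g (node J) - prim g (node j0)) \<le> X t (2 * real J) - X t (2 * real j0)"
    if "j0 \<le> J" and t: "\<bar>t\<bar> \<le> T" for J t
    using that(1)
  proof (induction J rule: dec_induct)
    case (step j)
    have "(1 / 4) powr r * (prim g (node (Suc j)) - prim g (node j0)) =
        (1 / 4) powr r * (prim g (node (Suc j)) - prim g (node j)) + (1 / 4) powr r * (prim g (node j) - prim g (node j0))"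
      by (simp only: distrib_left[symmetric]) simp
    then show ?case using \<open>\<And>t j. j0 \<le> j \<Longrightarrow> \<bar>t\<bar> \<le> T \<Longrightarrow> _\<close>[OF step(1) t] step.IH by linarith
  qed simp
  \<comment> \<open>Enough for the factor \<open>(1 / 4) powr r\<close>, the part of the integral
    before cell \<open>j0\<close>, and a possible displacement of label 0 to the left by up to
    \<open>\<bar>F 0\<bar> * T\<close>.\<close>
  define Bq where "Bq = prim g (node j0) + 4 powr r * (B + \<bar>F 0\<bar> * T)"
  obtain n where n: "Bq \<le> prim g (node n)" using div by blast
  define J where "J = max n j0"
  have "prim g (node n) \<le> prim g (node J)" by (rule prim_mono[OF g(1,4) bmono]) (simp add: J_def)
  then have "4 powr r * (B + \<bar>F 0\<bar> * T) \<le> prim g (node J) - prim g (node j0)" using n by (simp add: Bq_def)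
  then have "(1 / 4) powr r * (4 powr r * (B + \<bar>F 0\<bar> * T)) \<le> (1 / 4) powr r * (prim g (node J) - prim g (node j0))"
    by (rule mult_left_mono) simp
  moreover have "(1 / 4) powr r * (4 powr r * (B + \<bar>F 0\<bar> * T)) = B + \<bar>F 0\<bar> * T"
    by (simp add: mult.assoc[symmetric] powr_mult[symmetric])
  ultimately have big: "B + \<bar>F 0\<bar> * T \<le> (1 / 4) powr r * (prim g (node J) - prim g (node j0))" by simp
  show ?thesis
  proof (intro exI allI impI)
    fix t assume t: "\<bar>t\<bar> \<le> T"
    have "X t 0 \<le> X t (2 * real j0)" by (rule X_mono) simp
    moreover have "X t 0 = F 0 * t" by (simp add: X_def)
    moreover have "\<bar>F 0 * t\<bar> \<le> \<bar>F 0\<bar> * T" unfolding abs_mult using t by (rule mult_left_mono) simp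
    moreover have "j0 \<le> J" by (simp add: J_def)
    note total[OF this t]
    ultimately show "B \<le> X t (2 * real J)" using big by linarith
  qed
qed

end

section \<open>Choice of the cells\<close>

lemma loc_integrable_small:
  assumes h: "loc_integrable h" and "0 < \<delta>" "0 \<le> D"
  shows "\<exists>\<epsilon>>0. \<forall>a c. x \<le> a \<longrightarrow> a \<le> c \<longrightarrow> c \<le> y \<longrightarrow> c - a \<le> \<epsilon> \<longrightarrow> D * (LINT z:{a..c}|lborel. h z) \<le> \<delta>"
proof -
  have "uniformly_continuous_on {x..y} (prim h)"
    by (rule compact_uniformly_continuous[OF continuous_on_subset[OF prim_continuous[OF h]]]) auto
  moreover have "0 < \<delta> / (D + 1)" using assms by simp
  ultimately obtain d where d: "0 < d"
    "\<And>a c. a \<in> {x..y} \<Longrightarrow> c \<in> {x..y} \<Longrightarrow> dist c a < d \<Longrightarrow> dist (prim h c) (prim h a) < \<delta> / (D + 1)"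
    unfolding uniformly_continuous_on_def by blast
  show ?thesis
  proof (intro exI[of _ "d / 2"] conjI allI impI)
    fix a c assume ac: "x \<le> a" "a \<le> c" "c \<le> y" "c - a \<le> d / 2"
    then have "dist (prim h c) (prim h a) < \<delta> / (D + 1)" using d(1) by (intro d(2)) (auto simp: dist_real_def)
    then have "(LINT z:{a..c}|lborel. h z) \<le> \<delta> / (D + 1)"
      using prim_diff[OF h ac(2)] by (simp add: dist_real_def)
    then have "D * (LINT z:{a..c}|lborel. h z) \<le> D * (\<delta> / (D + 1))" by (rule mult_left_mono) fact
    also have "\<dots> \<le> (D + 1) * (\<delta> / (D + 1))" using assms by (intro mult_right_mono) auto
    also have "\<dots> = \<delta>" using assms by simp
    finally show "D * (LINT z:{a..c}|lborel. h z) \<le> \<delta>" .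
  qed (use d in simp)
qed

text \<open>On every unit interval between consecutive integers \<open>g\<close> has integral at
  least 1/2, yet it vanishes where |v| exceeds a bound attached to that interval. With these bounds
  fixed, a sufficient cell length depends only on the unit interval in which the cell begins. The
  time horizon grows with the position, so each \<open>T\<close> is served by all but finitely many
  cells.\<close>

lemma fine_labels_exist:
  fixes v :: "real \<Rightarrow> real" and C L r :: real
  assumes r: "2 \<le> r" and mv: "v \<in> borel_measurable borel" and lv: "loc_integrable v"
    and lw: "loc_integrable (\<lambda>x. (1 + \<bar>v x\<bar>) powr r)" and C: "0 \<le> C" and L: "0 \<le> L"
  obtains l :: "nat \<Rightarrow> real" and g :: "real \<Rightarrow> real"
  where "\<And>j. 0 < l j" "\<And>j. l j \<le> 1" "\<And>B. \<exists>n. B \<le> sum l {..<n}"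
    "loc_integrable g" "g \<in> borel_measurable borel" "\<And>x. g x \<le> 1" "\<And>x. 0 \<le> g x"
    "\<And>B. \<exists>n. B \<le> prim g (sum l {..<n})"
    "\<And>T. \<exists>j0. \<forall>j\<ge>j0. \<exists>T' K. T \<le> T' \<and> fine_cell r C L v g T' K (sum l {..<j}) (sum l {..<Suc j})"
proof -
  \<comment> \<open>As in Markov's inequality: relative to twice the mean of |v|, the function 1 -
    |v| / \<open>\<mu> n\<close> has integral at least 1/2. The \<open>+ 1\<close> keeps the
    denominator positive.\<close>
  define \<mu> where "\<mu> n = 2 * (LINT x:{real n..real n + 1}|lborel. \<bar>v x\<bar>) + 1" for n
  have lav: "loc_integrable (\<lambda>x. \<bar>v x\<bar>)" using lv by (auto simp: loc_integrable_def intro: set_integrable_abs)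
  have \<mu>: "1 \<le> \<mu> n" for n
    unfolding \<mu>_def using set_integral_nonneg_real[of "{real n..real n + 1}" "\<lambda>x. \<bar>v x\<bar>" lborel] by simp
  \<comment> \<open>A cell beginning in the n-th unit interval has length at most 1 and may extend
    into the next one.\<close>
  define K where "K n = max (\<mu> n) (\<mu> (Suc n))" for n
  have K: "0 < K n" for n using \<mu>[of n] by (simp add: K_def less_max_iff_disj)
  \<comment> \<open>The time horizon is \<open>n\<close> for cells that begin in the n-th unit
    interval.\<close>
  define D where "D n = L * (1 + C * real n) powr r * real n" for n
  have D: "0 \<le> D n" for n using L by (simp add: D_def)
  define \<omega> where "\<omega> n = 4 powr r * (min 1 (r / (4 * K n) / (D n + 1)) * (1 / (4 * K n)) powr r)" for n
  have \<omega>: "0 < \<omega> n" for n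
    unfolding \<omega>_def using K[of n] D[of n] r by (intro mult_pos_pos) auto
  have "\<exists>\<epsilon>. 0 < \<epsilon> \<and> \<epsilon> \<le> 1 \<and> \<epsilon> \<le> \<omega> n \<and> (\<forall>a c. real n \<le> a \<longrightarrow> a \<le> c \<longrightarrow> c \<le> real n + 2 \<longrightarrow> c - a \<le> \<epsilon> \<longrightarrow>
      D n * (LINT z:{a..c}|lborel. (1 + \<bar>v z\<bar>) powr r) \<le> r / (4 * K n))" for n
  proof -
    have "0 < r / (4 * K n)" using r K[of n] by simp
    from loc_integrable_small[OF lw this D, of "real n" "real n + 2" n]
    obtain e where e: "0 < e" "\<forall>a c. real n \<le> a \<longrightarrow> a \<le> c \<longrightarrow> c \<le> real n + 2 \<longrightarrow> c - a \<le> e \<longrightarrow>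
      D n * (LINT z:{a..c}|lborel. (1 + \<bar>v z\<bar>) powr r) \<le> r / (4 * K n)" by blast
    then show ?thesis using \<omega>[of n] by (intro exI[of _ "min e (min 1 (\<omega> n))"]) auto
  qed
  then obtain \<epsilon> where \<epsilon>: "\<And>n. 0 < \<epsilon> n" "\<And>n. \<epsilon> n \<le> 1" "\<And>n. \<epsilon> n \<le> \<omega> n"
    "\<And>n a c. real n \<le> a \<Longrightarrow> a \<le> c \<Longrightarrow> c \<le> real n + 2 \<Longrightarrow> c - a \<le> \<epsilon> n \<Longrightarrow>
      D n * (LINT z:{a..c}|lborel. (1 + \<bar>v z\<bar>) powr r) \<le> r / (4 * K n)"
    by metis
  \<comment> \<open>The break points: each step length is dictated by the unit interval reached so
    far.\<close>
  define bb where "bb = rec_nat 0 (\<lambda>_ x. x + \<epsilon> (nat \<lfloor>x\<rfloor>))"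
  have bb: "bb 0 = 0" "bb (Suc j) = bb j + \<epsilon> (nat \<lfloor>bb j\<rfloor>)" for j by (simp_all add: bb_def)
  define l where "l j = \<epsilon> (nat \<lfloor>bb j\<rfloor>)" for j
  have sl: "sum l {..<j} = bb j" for j by (induction j) (simp_all add: bb l_def)
  have bb0: "0 \<le> bb j" for j
  proof (induction j)
    case (Suc j) then show ?case using \<epsilon>(1)[of "nat \<lfloor>bb j\<rfloor>"] by (simp add: bb)
  qed (simp add: bb)
  have bbm: "bb i \<le> bb j" if "i \<le> j" for i j
    using that by (induction j rule: dec_induct) (use less_imp_le[OF \<epsilon>(1)] in \<open>auto simp: bb intro: add_increasing2\<close>)
  have unb: "\<exists>n. B \<le> bb n" for B
  proof (rule ccontr)
    assume "\<not> (\<exists>n. B \<le> bb n)"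
    then have lt: "bb n < B" for n by (simp add: not_le)
    \<comment> \<open>If the break points stayed below \<open>B\<close>, only finitely many step
      lengths could occur, and their minimum is positive.\<close>
    define \<delta> where "\<delta> = Min (\<epsilon> ` {..nat \<lfloor>B\<rfloor>})"
    have "\<delta> \<in> \<epsilon> ` {..nat \<lfloor>B\<rfloor>}" unfolding \<delta>_def by (rule Min_in) auto
    then have \<delta>: "0 < \<delta>" using \<epsilon>(1) by auto
    have "real n * \<delta> \<le> bb n" for n
    proof (induction n)
      case (Suc n)
      have "nat \<lfloor>bb n\<rfloor> \<le> nat \<lfloor>B\<rfloor>" using lt[of n] by (intro nat_mono floor_mono) simp
      then have "\<delta> \<le> \<epsilon> (nat \<lfloor>bb n\<rfloor>)" unfolding \<delta>_def by (intro Min_le) auto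
      then show ?case using Suc by (simp add: bb algebra_simps)
    qed (simp add: bb)
    moreover obtain n where "B < real n * \<delta>" using reals_Archimedean3[OF \<delta>] by blast
    ultimately show False using lt[of n] by (meson not_less order_trans less_imp_le linorder_not_le)
  qed
  \<comment> \<open>a lower bound for the indicator function of the set where \<open>\<bar>v\<bar>\<close> is at most \<open>\<mu>\<close>\<close>
  define g where "g x = max 0 (1 - \<bar>v x\<bar> / \<mu> (nat \<lfloor>x\<rfloor>))" for x
  have mg: "g \<in> borel_measurable borel"
  proof -
    have "(\<lambda>x::real. \<mu> (nat \<lfloor>x\<rfloor>)) \<in> borel_measurable borel"
      by (rule measurable_compose_countable[where f="\<lambda>i _. \<mu> i"]) measurable
    then show ?thesis unfolding g_def using mv by measurable
  qed
  have g0: "0 \<le> g x" for x by (simp add: g_def)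
  have g1: "g x \<le> 1" for x using \<mu>[of "nat \<lfloor>x\<rfloor>"] by (simp add: g_def)
  have lg: "loc_integrable g"
    by (rule loc_integrable_bound[OF loc_integrable_continuous[OF continuous_on_const[of _ 1]] mg])
       (simp add: g0 g1)
  have half: "prim g (real n + 1) - prim g (real n) \<ge> 1 / 2" for n
  proof -
    define J where "J = (LINT x:{real n..real n + 1}|lborel. \<bar>v x\<bar>)"
    have J0: "0 \<le> J" unfolding J_def by (rule set_integral_nonneg_real) simp
    have i: "set_integrable lborel {real n..real n + 1} (\<lambda>x. \<bar>v x\<bar> / \<mu> n)"
      using loc_integrableD[OF lav, of "real n" "real n + 1"] by simp
    have i1: "set_integrable lborel {real n..real n + 1} (\<lambda>x. 1::real)"
      by (rule loc_integrableD[OF loc_integrable_continuous[OF continuous_on_const]])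
    have "\<mu> n = 2 * J + 1" by (simp only: \<mu>_def J_def)
    then have "1 / 2 \<le> 1 - J / \<mu> n" using J0 by (simp add: field_simps)
    also have "\<dots> = (LINT x:{real n..real n + 1}|lborel. 1 - \<bar>v x\<bar> / \<mu> n)"
      using set_integral_diff(2)[OF i1 i] set_integral_Icc_const[of "real n" "real n + 1" 1] by (simp add: J_def)
    also have "\<dots> \<le> (LINT x:{real n..real n + 1}|lborel. g x)"
    proof (rule set_integral_interior_mono[OF set_integral_diff(1)[OF i1 i] loc_integrableD[OF lg]])
      fix x assume "real n < x" "x < real n + 1"
      then have "nat \<lfloor>x\<rfloor> = n" by (intro nat_eq_iff[THEN iffD2]) (auto intro!: floor_unique)
      then show "1 - \<bar>v x\<bar> / \<mu> n \<le> g x" by (simp add: g_def)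
    qed
    also have "\<dots> = prim g (real n + 1) - prim g (real n)" by (rule prim_diff[OF lg, symmetric]) simp
    finally show ?thesis .
  qed
  have qn: "real n / 2 \<le> prim g (real n)" for n
  proof (induction n)
    case (Suc n) then show ?case using half[of n] by (simp add: add.commute)
  qed simp
  show ?thesis
  proof (rule that[of l g])
    show "0 < l j" "l j \<le> 1" for j using \<epsilon> by (simp_all add: l_def)
    show "\<exists>n. B \<le> sum l {..<n}" for B using unb by (simp add: sl)
    show "\<exists>n. B \<le> prim g (sum l {..<n})" for B
    proof -
      obtain m :: nat where m: "2 * B \<le> real m" using real_arch_simple by blast
      obtain n where n: "real m \<le> bb n" using unb by blast
      have "B \<le> prim g (bb n)" using prim_mono[OF lg g0 n] qn[of m] m by linarith
      then show ?thesis by (auto simp: sl)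
    qed
    show "\<exists>j0. \<forall>j\<ge>j0. \<exists>T' K. T \<le> T' \<and> fine_cell r C L v g T' K (sum l {..<j}) (sum l {..<Suc j})" for T
    proof -
      \<comment> \<open>The \<open>+ 1\<close> compensates for rounding: the horizon at a cell is
        the integer part of its left end.\<close>
      obtain j0 where j0: "T + 1 \<le> bb j0" using unb by blast
      show ?thesis
      proof (intro exI[of _ j0] allI impI)
        fix j assume "j0 \<le> j"
        then have bj: "T + 1 \<le> bb j" using bbm[of j0 j] j0 by linarith
        define n where "n = nat \<lfloor>bb j\<rfloor>"
        have n: "real n \<le> bb j" "bb j < real n + 1" using bb0[of j] by (auto simp: n_def)
        have bs: "bb (Suc j) = bb j + \<epsilon> n" by (simp add: bb n_def)
        have bs2: "bb j \<le> bb (Suc j)" "bb (Suc j) < real n + 2" using n \<epsilon>(1,2)[of n] by (auto simp: bs)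
        have gv: "g x \<le> 0" if x: "x \<in> {bb j..bb (Suc j)}" "K n < \<bar>v x\<bar>" for x
        proof -
          have "nat \<lfloor>x\<rfloor> = n \<or> nat \<lfloor>x\<rfloor> = Suc n"
          proof (cases "x < real n + 1")
            case True
            then have "nat \<lfloor>x\<rfloor> = n" using x n by (intro nat_eq_iff[THEN iffD2]) (auto intro!: floor_unique)
            then show ?thesis ..
          next
            case False
            then have "nat \<lfloor>x\<rfloor> = Suc n" using x n bs2 by (intro nat_eq_iff[THEN iffD2]) (auto intro!: floor_unique)
            then show ?thesis ..
          qed
          then have "\<mu> (nat \<lfloor>x\<rfloor>) \<le> K n" by (auto simp: K_def)
          then have "\<mu> (nat \<lfloor>x\<rfloor>) < \<bar>v x\<bar>" using x(2) by simp
          then show ?thesis using \<mu>[of "nat \<lfloor>x\<rfloor>"] by (simp add: g_def field_simps)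
        qed
        have "fine_cell r C L v g (real n) (K n) (bb j) (bb (Suc j))"
          unfolding fine_cell_def D_def[symmetric] \<omega>_def[symmetric]
        proof (intro conjI ballI impI)
          show "0 < K n" by (rule K)
          show "g x \<le> 0" if "x \<in> {bb j..bb (Suc j)}" "K n < \<bar>v x\<bar>" for x by (rule gv[OF that])
          show "D n * (LINT x:{bb j..bb (Suc j)}|lborel. (1 + \<bar>v x\<bar>) powr r) \<le> r / (4 * K n)"
            using n bs2 bs by (intro \<epsilon>(4)) auto
          show "bb (Suc j) - bb j \<le> \<omega> n" using \<epsilon>(3)[of n] by (simp add: bs)
        qed
        moreover have "T \<le> real n" using bj n by linarith
        ultimately show "\<exists>T' K. T \<le> T' \<and> fine_cell r C L v g T' K (sum l {..<j}) (sum l {..<Suc j})"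
          unfolding sl by blast
      qed
    qed
  qed (fact lg mg g0 g1)+
qed

context fan_labels
begin

text \<open>On cells the density of the initial value is \<open>fan_p\<close> times v times the (r -
  1)-st power of \<open>fan_p\<close>, that is \<open>\<rho>\<close> times v; on fans it is 0. So
  the fans leave the initial value unchanged.\<close>

lemma x0_prim:
  assumes "0 \<le> s" "loc_integrable v"
  shows "prim (\<lambda>z. fan_k r l v z * spow (r - 1) (fan_p r l z)) s = prim v (x0 s)"
proof -
  have m2: "(\<lambda>z. \<rho> z * v (x0 z)) \<in> borel_measurable borel"
    using measurable_compose[OF x0_borel mv] by measurable
  have m1: "(\<lambda>z. fan_k r l v z * spow (r - 1) (fan_p r l z)) \<in> borel_measurable borel"
    by (rule borel_measurable_times[OF k_borel measurable_compose[OF p_borel spow_borel]])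
  have e: "fan_k r l v z * spow (r - 1) (fan_p r l z) = \<rho> z * v (x0 z)" if z: "0 < z" for z
  proof (cases "z - 2 * real (nat \<lfloor>z / 2\<rfloor>) < 1")
    case True
    have "fan_p r l z * spow (r - 1) (fan_p r l z) = \<rho> z"
      using powr_mult_base[OF p_nonneg, of z "r - 1"] p_nonneg[of z] p_powr[of z]
      by (cases "fan_p r l z = 0") (auto simp: spow_def)
    then show ?thesis using True z by (simp add: fan_k_def mult_ac)
  next
    case False
    then show ?thesis using z by (simp add: fan_p_def fan_rho_def)
  qed
  have le: "loc_integrable (\<lambda>z. \<rho> z * v (x0 z))" by (rule x0_change(1)[OF assms(2) mv])
  have "prim (\<lambda>z. fan_k r l v z * spow (r - 1) (fan_p r l z)) s
      = (LINT z:{0..s}|lborel. fan_k r l v z * spow (r - 1) (fan_p r l z))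
        - (LINT z:{s..0}|lborel. fan_k r l v z * spow (r - 1) (fan_p r l z))"
    by (simp only: prim_def)
  also have "(LINT z:{0..s}|lborel. fan_k r l v z * spow (r - 1) (fan_p r l z)) = (LINT z:{0..s}|lborel. \<rho> z * v (x0 z))"
    by (rule set_integral_interior_cong[OF m1 m2 e])
  also have "(LINT z:{s..0}|lborel. fan_k r l v z * spow (r - 1) (fan_p r l z)) = (LINT z:{s..0}|lborel. 0)"
    by (rule set_integral_interior_cong[OF m1]) (use assms in auto)
  also have "(LINT z:{0..s}|lborel. \<rho> z * v (x0 z)) = (LINT x:{x0 0..x0 s}|lborel. v x)"
    by (rule x0_change(2)[OF assms(2) mv assms(1)])
  also have "x0 0 = 0" by (simp add: fan_x_def)
  also have "(LINT x:{0..x0 s}|lborel. v x) = prim v (x0 s)"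
    using prim_diff[OF assms(2), of 0 "x0 s"] x0_mono[OF assms(1)] by (simp add: fan_x_def)
  finally show ?thesis by simp
qed

end

section \<open>Existence and Holder continuity of the weak solution\<close>

theorem theorem1:
  fixes lam L :: real and f u0 :: "real \<Rightarrow> real"
  assumes "0 < lam" and "lam \<le> 1 / 2"
    and "C2_fun f"
    and "deriv f 0 \<ge> 0"
    and "\<And>u1 u2. \<bar>deriv (deriv f) u1 - deriv (deriv f) u2\<bar> \<le> L * \<bar>u1 - u2\<bar>"
    and "bounded (range (deriv (deriv f)))"
    and "sobolev_W1_loc (1 / lam) u0"
    and "u0 0 = 0"
    and "(u0 has_real_derivative 0) (at 0 within {0..})"
  shows "\<exists>u. weak_solution lam f u0 u \<and>
           (lam \<in> {0<..1/3} \<union> {1/2} \<longrightarrow> locally_holder_on (1 - lam) ({0..} \<times> {0..}) u)"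
proof -
  define r where "r = 1 / lam"
  have r: "2 \<le> r" using assms(1,2) by (simp add: r_def field_simps)
  have lam: "lam = 1 / r" by (simp add: r_def)
  define F where "F = deriv f"
  define G where "G = deriv F"
  have FG: "(F has_real_derivative G x) (at x)" for x
    using assms(3) by (simp add: C2_fun_def F_def G_def DERIV_deriv_iff_field_differentiable)
  have GL: "\<bar>G x - G y\<bar> \<le> L * \<bar>x - y\<bar>" for x y using assms(5) by (simp add: F_def G_def)
  obtain C where "\<forall>y\<in>range G. norm y \<le> C" using assms(6) unfolding bounded_iff F_def G_def by blast
  then have GC: "\<bar>G x\<bar> \<le> C" for x by simp
  have C: "0 \<le> C" using GC[of 0] by linarith
  have L: "0 \<le> L" using GL[of 1 0] by simp
  have "1 \<le> r" using r by simp
  from sobolev_W1_loc_prim[OF this] assms(7)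
  obtain v where v: "v \<in> borel_measurable borel" "loc_integrable v"
      "loc_integrable (\<lambda>x. \<bar>v x\<bar> powr r)" "\<And>x. 0 \<le> x \<Longrightarrow> u0 x = u0 0 + prim v x"
    unfolding r_def by blast
  have vw: "loc_integrable (\<lambda>x. (1 + \<bar>v x\<bar>) powr r)"
    by (rule loc_integrable_one_plus_powr[OF _ v(1,3)]) (use r in simp)
  obtain l :: "nat \<Rightarrow> real" and g :: "real \<Rightarrow> real"
  where l: "\<And>j. 0 < l j" "\<And>j. l j \<le> 1" "\<And>B. \<exists>n. B \<le> sum l {..<n}"
    and g: "loc_integrable g" "g \<in> borel_measurable borel" "\<And>x. g x \<le> 1" "\<And>x. 0 \<le> g x"
    and div: "\<And>B. \<exists>n. B \<le> prim g (sum l {..<n})"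
    and fine: "\<And>T. \<exists>j0. \<forall>j\<ge>j0. \<exists>T' K. T \<le> T' \<and> fine_cell r C L v g T' K (sum l {..<j}) (sum l {..<Suc j})"
    using fine_labels_exist[OF r v(1,2) vw C L] by blast
  interpret D: fan_labels r l v
    using r v l by unfold_locales
  interpret D: char_data r C L F G "fan_p r l" "fan_k r l v"
  proof
    show "fan_p r l s = 1" "fan_k r l v s = 0" if "s \<le> 0" for s
      using that by (simp_all add: fan_p_def fan_rho_def fan_k_def)
  qed (fact r FG GC GL D.p_borel D.k_borel D.p_nonneg D.pk_pos D.weight_loc)+
  interpret D: fan_data r l v C L F G ..
  have esc: "\<exists>S. \<forall>t. \<bar>t\<bar> \<le> T \<longrightarrow> B \<le> D.X t S" for T B
    by (rule D.escape[OF g]) (unfold D.node_def, rule div, rule fine)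
  interpret D: char_sol r C L F G "fan_p r l" "fan_k r l v"
  proof
    show "0 \<le> F 0" using assms(4) by (simp add: F_def)
  qed (rule esc)
  have init: "D.u (x, 0) = u0 x" if x: "0 \<le> x" for x
  proof -
    obtain s where s: "fan_x l s = x" using D.x0_surj by blast
    have s0: "0 \<le> s" using D.x0_neg[of s] s x by (cases "0 \<le> s") auto
    \<comment> \<open>At time 0 nothing has accumulated, so \<open>M\<close> is \<open>fan_p\<close>
      and the positions are those of \<open>fan_x\<close>.\<close>
    have "D.A 0 z = 0" for z using D.A_bound[of 0 0 z] by simp
    then have M0: "D.M 0 z = fan_p r l z" for z by (simp add: D.M_def D.mA_def)
    have "(\<lambda>z. \<bar>D.M 0 z\<bar> powr r) = fan_rho l"
      using D.p_nonneg by (intro ext) (simp add: M0 D.p_powr)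
    then have "D.X 0 s = x" using s by (simp add: D.X_def fan_x_def)
    then have "D.u (x, 0) = prim v (fan_x l s)" using D.u_initial[of s] D.x0_prim[OF s0 v(2)] by simp
    then show ?thesis using v(4)[OF x] assms(8) s by simp
  qed
  have "weak_solution (1 / r) f u0 D.u"
    by (rule D.u_weak_solution[OF F_def[symmetric] _ init]) (simp_all add: G_def F_def)
  then show ?thesis using D.u_locally_Holder unfolding lam by blast
qed

end
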